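(* Let $a$ be weakly degenerate (WD) or strongly degenerate (SD) at $0$, with constant $K$. If $$T>\frac{4}{2-K}\max\Bigl\{1,\frac{4}{a(1)},\frac{4K}{a(1)}\Bigr\},$$ then the problem $$\begin{cases}y_{tt}+a(x)y_{xxxx}=0, & (t,x)\in(0,+\infty)\times(0,1),\\ y(t,0)=y(t,1)=0,\ y_x(t,0)=y_x(t,1)=0, & t\in(0,+\infty),\\ y(0,x)=y^0_T(x),\ y_t(0,x)=y^1_T(x), & x\in(0,1),\end{cases}$$ is observable in time $T$, i.e. there exists a constant $C>0$ such that for every $(y^0_T,y^1_T)\in\mathcal H_0$ the mild solution $y$ satisfies $$C\,E_y(0)\le\int_0^Ty_{xx}^2(t,1)\,dt. \qquad (\ast)$$ Moreover, if $C_T$ denotes the supremum of all constants $C>0$ for which $(\ast)$ holds for every $(y^0_T,y^1_T)\in\mathcal H_0$, then $$T(2-K)-4\max\Bigl\{1,\frac{4}{a(1)},\frac{4K}{a(1)}\Bigr\}\le C_T.$$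
   Context: Degeneracy: for $a:[0,1]\to\mathbb R$ with $a(0)=0$, $a>0$ on $(0,1]$, put $K:=\sup_{x\in(0,1]}\frac{x|a'(x)|}{a(x)}$. $a$ is weakly degenerate at $0$ (WD) if $a\in C[0,1]\cap C^1(0,1]$, $a(0)=0$, $a>0$ on $(0,1]$ and $K\in(0,1)$. $a$ is strongly degenerate at $0$ (SD) if $a\in C^1[0,1]$, $a(0)=0$, $a>0$ on $(0,1]$ and $K\in[1,2)$. Spaces: $L^2_{\frac1a}(0,1):=\{u\in L^2(0,1):\int_0^1\frac{u^2}{a}dx<\infty\}$ with norm$^2$ $\int_0^1\frac{u^2}{a}dx$; $H^2_{\frac1a}(0,1):=L^2_{\frac1a}(0,1)\cap H^2_0(0,1)$; $\mathcal H_0:=H^2_{\frac1a}(0,1)\times L^2_{\frac1a}(0,1)$ with norm$^2$ $\|(u,v)\|^2_{\mathcal H_0}=\int_0^1(u'')^2dx+\int_0^1\frac{v^2}{a}dx$. Operators: $Au:=au''''$ on $D(A):=\{u\in H^2_{\frac1a}(0,1):au''''\in L^2_{\frac1a}(0,1)\}$; $\mathcal A(u,v):=(v,-Au)$ on $D(\mathcal A):=D(A)\times H^2_{\frac1a}(0,1)\subset\mathcal H_0$. $\mathcal A$ generates a contraction semigroup on $\mathcal H_0$; the mild solution $y$ with data in $\mathcal H_0$ is the first component of the semigroup orbit $(y,y_t)$, and it is a classical solution if the data lie in $D(\mathcal A)$. For mild solutions the trace $y_{xx}(\cdot,1)$ is understood as the limit in $L^2(0,T)$ of the traces of classical solutions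 with data in $D(\mathcal A)$ converging in $\mathcal H_0$. Energy: $E_y(t):=\frac12\int_0^1\Bigl(\frac{y_t^2(t,x)}{a(x)}+y_{xx}^2(t,x)\Bigr)dx$. *)

theory Defs
  imports "HOL-Analysis.Analysis"
begin

section \<open>Degenerate coefficients\<close>

text \<open>Derivatives of the coefficient are taken within the interval, hence one-sided at 0 and 1.\<close>

definition deriv01 :: "(real \<Rightarrow> real) \<Rightarrow> real \<Rightarrow> real" where
  "deriv01 a x = vector_derivative a (at x within {0..1})"

definition C1_on01 :: "real set \<Rightarrow> (real \<Rightarrow> real) \<Rightarrow> bool" where
  "C1_on01 S a \<longleftrightarrow>
     (\<forall>x\<in>S. a differentiable (at x within {0..1})) \<and> continuous_on S (deriv01 a)"

definition degeneracy_quotient :: "(real \<Rightarrow> real) \<Rightarrow> real \<Rightarrow> real" where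
  "degeneracy_quotient a x = x * \<bar>deriv01 a x\<bar> / a x"

definition degeneracy_const :: "(real \<Rightarrow> real) \<Rightarrow> real" where
  "degeneracy_const a = (SUP x\<in>{0<..1}. degeneracy_quotient a x)"

text \<open>The boundedness condition says that the supremum is finite; the real-valued
  \<^const>\<open>Sup\<close> is meaningless on unbounded sets.\<close>

definition weakly_degenerate :: "(real \<Rightarrow> real) \<Rightarrow> bool" where
  "weakly_degenerate a \<longleftrightarrow>
     continuous_on {0..1} a \<and> C1_on01 {0<..1} a \<and> a 0 = 0 \<and> (\<forall>x\<in>{0<..1}. a x > 0) \<and>
     bdd_above (degeneracy_quotient a ` {0<..1}) \<and>
     0 < degeneracy_const a \<and> degeneracy_const a < 1"

definition strongly_degenerate :: "(real \<Rightarrow> real) \<Rightarrow> bool" where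
  "strongly_degenerate a \<longleftrightarrow>
     C1_on01 {0..1} a \<and> a 0 = 0 \<and> (\<forall>x\<in>{0<..1}. a x > 0) \<and>
     bdd_above (degeneracy_quotient a ` {0<..1}) \<and>
     1 \<le> degeneracy_const a \<and> degeneracy_const a < 2"

section \<open>Function spaces\<close>

text \<open>Elements of the Lebesgue and Sobolev spaces are represented by functions on the real line;
  only their restriction to the interval, up to null sets, matters. Equality in a space
  therefore means that the norm of the difference vanishes.\<close>

definition L2 :: "real set \<Rightarrow> (real \<Rightarrow> real) set" where
  "L2 I = {u. u \<in> borel_measurable (lebesgue_on I) \<and> integrable (lebesgue_on I) (\<lambda>x. (u x)\<^sup>2)}"

definition test_function :: "(real \<Rightarrow> real) \<Rightarrow> bool" where
  "test_function \<phi> \<longleftrightarrow>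
     (\<forall>n x. (deriv ^^ n) \<phi> differentiable (at x)) \<and>
     (\<exists>c d. 0 < c \<and> d < 1 \<and> (\<forall>x. x \<notin> {c..d} \<longrightarrow> \<phi> x = 0))"

definition locally_integrable :: "(real \<Rightarrow> real) \<Rightarrow> bool" where
  "locally_integrable u \<longleftrightarrow>
     (\<forall>c d. 0 < c \<longrightarrow> d < 1 \<longrightarrow> integrable (lebesgue_on {c..d}) u)"

definition has_weak_deriv :: "nat \<Rightarrow> (real \<Rightarrow> real) \<Rightarrow> (real \<Rightarrow> real) \<Rightarrow> bool" where
  "has_weak_deriv n u w \<longleftrightarrow>
     locally_integrable u \<and> locally_integrable w \<and>
     (\<forall>\<phi>. test_function \<phi> \<longrightarrow>
        (\<integral>x. u x * (deriv ^^ n) \<phi> x \<partial>lebesgue_on {0<..<1}) =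
        (-1) ^ n * (\<integral>x. w x * \<phi> x \<partial>lebesgue_on {0<..<1}))"

text \<open>Some representative of the weak derivative, which is unique up to null sets.\<close>

definition weak_deriv :: "nat \<Rightarrow> (real \<Rightarrow> real) \<Rightarrow> real \<Rightarrow> real" where
  "weak_deriv n u = (SOME w. has_weak_deriv n u w)"

definition H2 :: "(real \<Rightarrow> real) set" where
  "H2 = {u \<in> L2 {0<..<1}. \<forall>k\<in>{1,2}. \<exists>w\<in>L2 {0<..<1}. has_weak_deriv k u w}"

definition H2_norm :: "(real \<Rightarrow> real) \<Rightarrow> real" where
  "H2_norm u = sqrt ((\<integral>x. (u x)\<^sup>2 \<partial>lebesgue_on {0<..<1}) +
     (\<integral>x. (weak_deriv 1 u x)\<^sup>2 \<partial>lebesgue_on {0<..<1}) +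
     (\<integral>x. (weak_deriv 2 u x)\<^sup>2 \<partial>lebesgue_on {0<..<1}))"

text \<open>The closure of the test functions in \<^const>\<open>H2\<close>.\<close>

definition H20 :: "(real \<Rightarrow> real) set" where
  "H20 = {u \<in> H2. \<exists>\<phi>::nat \<Rightarrow> real \<Rightarrow> real. (\<forall>n. test_function (\<phi> n)) \<and>
            (\<lambda>n. H2_norm (\<lambda>x. u x - \<phi> n x)) \<longlonglongrightarrow> 0}"

definition L2_inv :: "(real \<Rightarrow> real) \<Rightarrow> (real \<Rightarrow> real) set" where
  "L2_inv a = {u \<in> L2 {0<..<1}. integrable (lebesgue_on {0<..<1}) (\<lambda>x. (u x)\<^sup>2 / a x)}"

definition H2_inv :: "(real \<Rightarrow> real) \<Rightarrow> (real \<Rightarrow> real) set" where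
  "H2_inv a = L2_inv a \<inter> H20"

type_synonym state = "(real \<Rightarrow> real) \<times> (real \<Rightarrow> real)"

definition H0 :: "(real \<Rightarrow> real) \<Rightarrow> state set" where
  "H0 a = H2_inv a \<times> L2_inv a"

definition H0_norm :: "(real \<Rightarrow> real) \<Rightarrow> state \<Rightarrow> real" where
  "H0_norm a U = sqrt ((\<integral>x. (weak_deriv 2 (fst U) x)\<^sup>2 \<partial>lebesgue_on {0<..<1}) +
                       (\<integral>x. (snd U x)\<^sup>2 / a x \<partial>lebesgue_on {0<..<1}))"

definition lincomb :: "real \<Rightarrow> state \<Rightarrow> real \<Rightarrow> state \<Rightarrow> state" where
  "lincomb c U d V = ((\<lambda>x. c * fst U x + d * fst V x), (\<lambda>x. c * snd U x + d * snd V x))"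

definition H0_dist :: "(real \<Rightarrow> real) \<Rightarrow> state \<Rightarrow> state \<Rightarrow> real" where
  "H0_dist a U V = H0_norm a (lincomb 1 U (-1) V)"

section \<open>Operators and semigroup\<close>

definition opA :: "(real \<Rightarrow> real) \<Rightarrow> (real \<Rightarrow> real) \<Rightarrow> real \<Rightarrow> real" where
  "opA a u = (\<lambda>x. a x * weak_deriv 4 u x)"

definition domA :: "(real \<Rightarrow> real) \<Rightarrow> (real \<Rightarrow> real) set" where
  "domA a = {u \<in> H2_inv a. \<exists>w. has_weak_deriv 4 u w \<and> (\<lambda>x. a x * w x) \<in> L2_inv a}"

definition wave_op :: "(real \<Rightarrow> real) \<Rightarrow> state \<Rightarrow> state" where
  "wave_op a U = (snd U, (\<lambda>x. - opA a (fst U) x))"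

definition wave_dom :: "(real \<Rightarrow> real) \<Rightarrow> state set" where
  "wave_dom a = domA a \<times> H2_inv a"

definition contraction_semigroup :: "(real \<Rightarrow> real) \<Rightarrow> (real \<Rightarrow> state \<Rightarrow> state) \<Rightarrow> bool" where
  "contraction_semigroup a S \<longleftrightarrow>
     (\<forall>t\<ge>0. \<forall>U\<in>H0 a. S t U \<in> H0 a \<and> H0_norm a (S t U) \<le> H0_norm a U) \<and>
     (\<forall>t\<ge>0. \<forall>U\<in>H0 a. \<forall>V\<in>H0 a. \<forall>c d.
        H0_dist a (S t (lincomb c U d V)) (lincomb c (S t U) d (S t V)) = 0) \<and>
     (\<forall>U\<in>H0 a. H0_dist a (S 0 U) U = 0) \<and>
     (\<forall>s\<ge>0. \<forall>t\<ge>0. \<forall>U\<in>H0 a. H0_dist a (S (s + t) U) (S s (S t U)) = 0) \<and>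
     (\<forall>U\<in>H0 a. ((\<lambda>t. H0_dist a (S t U) U) \<longlongrightarrow> 0) (at_right 0))"

text \<open>The generator of the semigroup, as a graph up to equality in the space \<^const>\<open>H0\<close>, is the
  operator \<^const>\<open>wave_op\<close> with domain exactly \<^const>\<open>wave_dom\<close>.\<close>

definition generated_by_wave_op :: "(real \<Rightarrow> real) \<Rightarrow> (real \<Rightarrow> state \<Rightarrow> state) \<Rightarrow> bool" where
  "generated_by_wave_op a S \<longleftrightarrow>
     (\<forall>U\<in>H0 a. \<forall>F\<in>H0 a.
        ((\<lambda>h. H0_dist a (lincomb (1 / h) (S h U) (- 1 / h) U) F) \<longlongrightarrow> 0) (at_right 0) \<longleftrightarrow>
        U \<in> wave_dom a \<and> H0_dist a (wave_op a U) F = 0)"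

section \<open>Energy, boundary traces, observability\<close>

text \<open>The mild solution with data \<open>U0\<close> is \<open>y(t, \<cdot>) = fst (S t U0)\<close>,
  and \<open>y_t(t, \<cdot>) = snd (S t U0)\<close>.\<close>

definition energy ::
  "(real \<Rightarrow> real) \<Rightarrow> (real \<Rightarrow> state \<Rightarrow> state) \<Rightarrow> state \<Rightarrow> real \<Rightarrow> real" where
  "energy a S U0 t = 1 / 2 * (\<integral>x. (snd (S t U0) x)\<^sup>2 / a x + (weak_deriv 2 (fst (S t U0)) x)\<^sup>2
                              \<partial>lebesgue_on {0<..<1})"

text \<open>The value at 1 of the second derivative: the left limit of a representative having one.
  For elements of \<^const>\<open>domA\<close> it exists, the second derivative being in \<open>H\<^sup>2\<close> near 1.\<close>

definition second_deriv_at_1 :: "(real \<Rightarrow> real) \<Rightarrow> real" where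
  "second_deriv_at_1 u = (THE c. \<exists>w. has_weak_deriv 2 u w \<and> (w \<longlongrightarrow> c) (at_left 1))"

definition classical_trace :: "(real \<Rightarrow> state \<Rightarrow> state) \<Rightarrow> state \<Rightarrow> real \<Rightarrow> real" where
  "classical_trace S U t = second_deriv_at_1 (fst (S t U))"

definition approximating_data :: "(real \<Rightarrow> real) \<Rightarrow> state \<Rightarrow> (nat \<Rightarrow> state) \<Rightarrow> bool" where
  "approximating_data a U0 U \<longleftrightarrow>
     (\<forall>n. U n \<in> wave_dom a) \<and> (\<lambda>n. H0_dist a (U n) U0) \<longlonglongrightarrow> 0"

text \<open>\<open>h\<close> is the trace \<open>y_xx(\<cdot>, 1)\<close> of the mild solution with data \<open>U0\<close>: the common
  limit in \<open>L\<^sup>2(0, T)\<close> of the traces of all approximating sequences of classical solutions.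
  It is determined up to null sets.\<close>

definition is_mild_trace ::
  "(real \<Rightarrow> real) \<Rightarrow> (real \<Rightarrow> state \<Rightarrow> state) \<Rightarrow> real \<Rightarrow> state \<Rightarrow> (real \<Rightarrow> real) \<Rightarrow> bool" where
  "is_mild_trace a S T U0 h \<longleftrightarrow>
     h \<in> L2 {0<..<T} \<and>
     (\<exists>U. approximating_data a U0 U) \<and>
     (\<forall>U. approximating_data a U0 U \<longrightarrow>
        (\<forall>n. classical_trace S (U n) \<in> L2 {0<..<T}) \<and>
        (\<lambda>n. \<integral>t. (classical_trace S (U n) t - h t)\<^sup>2 \<partial>lebesgue_on {0<..<T}) \<longlonglongrightarrow> 0)"

definition observability_inequality ::
  "(real \<Rightarrow> real) \<Rightarrow> (real \<Rightarrow> state \<Rightarrow> state) \<Rightarrow> real \<Rightarrow> real \<Rightarrow> bool" where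
  "observability_inequality a S T C \<longleftrightarrow>
     (\<forall>U0\<in>H0 a. \<exists>h. is_mild_trace a S T U0 h \<and>
        C * energy a S U0 0 \<le> (\<integral>t. (h t)\<^sup>2 \<partial>lebesgue_on {0<..<T}))"

definition observable ::
  "(real \<Rightarrow> real) \<Rightarrow> (real \<Rightarrow> state \<Rightarrow> state) \<Rightarrow> real \<Rightarrow> bool" where
  "observable a S T \<longleftrightarrow> (\<exists>C>0. observability_inequality a S T C)"

text \<open>The supremum is taken in the extended reals, so that it is meaningful without knowing
  beforehand that the set of admissible constants is bounded.\<close>

definition observability_const ::
  "(real \<Rightarrow> real) \<Rightarrow> (real \<Rightarrow> state \<Rightarrow> state) \<Rightarrow> real \<Rightarrow> ereal" where
  "observability_const a S T = (SUP C\<in>{C. C > 0 \<and> observability_inequality a S T C}. ereal C)"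

end

theory Submission
  imports Defs
begin

text \<open>
  For a classical solution the multiplier \<open>(x y_x - y / 2) / a\<close> gives, with
  \<open>\<Phi> = \<integral> y_t (x y_x - y / 2) / a\<close>, the identity
  \<open>y_xx(t, 1)\<^sup>2 = 2 \<Phi>' + \<integral> (2 - x a' / a) y_t\<^sup>2 / a + 2 \<integral> y_xx\<^sup>2\<close>.
  As \<open>\<bar>x a' / a\<bar> \<le> K < 2\<close>, as the energy is conserved, and as \<open>x\<^sup>2 / a \<le> 1 / a(1)\<close> bounds
  \<open>\<bar>\<Phi>\<bar>\<close> by the energy, integration in time bounds the trace from below (observability) and from
  above (hidden regularity). The upper bound makes the traces of approximating classical
  solutions converge in \<open>L\<^sup>2(0, T)\<close>, and the lower bound passes to the limit.

  The integrations by parts in space rest on two representations: an element of \<open>H\<^sup>2_0\<close> is the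
  double primitive from 0 of its second derivative, and the second derivative of an element of
  \<open>D(A)\<close> is affine up to the double primitive from 1 of its fourth derivative, which is only
  controlled with the weight \<open>x\<close>. In this form they become instances of Fubini's theorem.
\<close>

section \<open>Square-integrable functions\<close>

text \<open>The weight 1/2 in the multiplier balances the two energies. With
  \<open>x y_x - \<theta> y\<close> the elastic part gets the coefficient
  \<open>3 - 2 \<theta>\<close> and the kinetic part \<open>1 + 2 \<theta> - x a' / a\<close>;
  \<theta> = 1/2 is the least value for which \<open>\<bar>x a' / a\<bar> \<le> K\<close> keeps both
  at least \<open>2 - K\<close>.

  Two obstacles shape the rest. At 0 only \<open>x u''''\<close> is square integrable, so
  \<open>u'''\<close> is merely bounded by a multiple of \<open>x^(-1/2)\<close> and boundary terms
  at 0 have no separate meaning; integration by parts is therefore done against double primitives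
  from 0, and whatever remains sits at 1. Moreover, states are concrete functions, and the semigroup
  laws and the commutation with the generator hold up to distance 0 in \<open>H0\<close>. They are
  used inside bilinear forms bounded by the energy norm, which cannot see such differences. The
  trace is brought into this setting by pairing the generator with a fixed state; this gives its
  continuity in time, which the time integrals rest on.\<close>

lemma L2_mult_integrable:
  assumes "f \<in> L2 I" "g \<in> L2 I"
  shows "integrable (lebesgue_on I) (\<lambda>x. f x * g x)"
proof (rule Bochner_Integration.integrable_bound)
  show "integrable (lebesgue_on I) (\<lambda>x. (f x)\<^sup>2 + (g x)\<^sup>2)"
    using assms by (auto simp: L2_def)
  show "(\<lambda>x. f x * g x) \<in> borel_measurable (lebesgue_on I)"
    using assms by (auto simp: L2_def)
  have "\<bar>f x * g x\<bar> \<le> (f x)\<^sup>2 + (g x)\<^sup>2" for x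
  proof -
    have "2 * (\<bar>f x\<bar> * \<bar>g x\<bar>) \<le> (f x)\<^sup>2 + (g x)\<^sup>2"
      using sum_squares_bound[of "\<bar>f x\<bar>" "\<bar>g x\<bar>"] by simp
    moreover have "0 \<le> \<bar>f x\<bar> * \<bar>g x\<bar>" by simp
    ultimately show ?thesis unfolding abs_mult by linarith
  qed
  then show "AE x in lebesgue_on I. norm (f x * g x) \<le> norm ((f x)\<^sup>2 + (g x)\<^sup>2)"
    by (intro AE_I2) (metis abs_ge_self order_trans real_norm_def)
qed

lemma L2_lincomb:
  assumes "f \<in> L2 I" "g \<in> L2 I"
  shows "(\<lambda>x. c * f x + d * g x) \<in> L2 I"
proof -
  have "integrable (lebesgue_on I) (\<lambda>x. c\<^sup>2 * (f x)\<^sup>2 + 2 * c * d * (f x * g x) + d\<^sup>2 * (g x)\<^sup>2)"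
    using assms L2_mult_integrable[OF assms] by (auto simp: L2_def)
  moreover have "(\<lambda>x. (c * f x + d * g x)\<^sup>2) =
      (\<lambda>x. c\<^sup>2 * (f x)\<^sup>2 + 2 * c * d * (f x * g x) + d\<^sup>2 * (g x)\<^sup>2)"
    by (auto simp: power2_eq_square algebra_simps)
  ultimately show ?thesis using assms by (auto simp: L2_def)
qed

lemma L2_diff: "f \<in> L2 I \<Longrightarrow> g \<in> L2 I \<Longrightarrow> (\<lambda>x. f x - g x) \<in> L2 I"
  using L2_lincomb[of f I g 1 "-1"] by simp

lemma L2_cong_AE:
  assumes "f \<in> L2 I" "g \<in> borel_measurable (lebesgue_on I)" "AE x in lebesgue_on I. f x = g x"
  shows "g \<in> L2 I"
proof -
  have "integrable (lebesgue_on I) (\<lambda>x. (g x)\<^sup>2)"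
    by (rule integrable_cong_AE_imp[of _ "\<lambda>x. (f x)\<^sup>2"]) (use assms in \<open>auto simp: L2_def\<close>)
  then show ?thesis using assms by (auto simp: L2_def)
qed

lemma L2_bound:
  assumes "g \<in> L2 I" "f \<in> borel_measurable (lebesgue_on I)"
    and "AE x in lebesgue_on I. \<bar>f x\<bar> \<le> \<bar>g x\<bar>"
  shows "f \<in> L2 I"
proof -
  have "integrable (lebesgue_on I) (\<lambda>x. (f x)\<^sup>2)"
    by (rule Bochner_Integration.integrable_bound[of _ "\<lambda>x. (g x)\<^sup>2"])
       (use assms in \<open>auto simp: L2_def abs_le_square_iff\<close>)
  then show ?thesis using assms by (auto simp: L2_def)
qed

text \<open>The quadratic is evaluated at its minimum \<open>b / c\<close>; if \<open>c = 0\<close>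
  it is affine in \<open>t\<close>, and a nonzero \<open>b\<close> would give it the value -1 at
  \<open>(a + 1) / (2 * b)\<close>. This serves both Cauchy-Schwarz inequalities, the one in
  \<open>L2\<close> and the one for \<open>ip\<close>.\<close>

lemma discriminant_nonpos:
  fixes a b c :: real
  assumes "\<And>t. a - 2 * t * b + t\<^sup>2 * c \<ge> 0" "c \<ge> 0"
  shows "b\<^sup>2 \<le> a * c"
proof (cases "c = 0")
  case True
  have "b = 0"
  proof (rule ccontr)
    assume "b \<noteq> 0"
    then show False using assms(1)[of "(a + 1) / (2 * b)"] True by (auto simp: field_simps)
  qed
  then show ?thesis using True by simp
next
  case False
  then have c: "c > 0" using assms by simp
  have "0 \<le> (a - 2 * (b / c) * b + (b / c)\<^sup>2 * c) * c"
    using assms(1)[of "b / c"] c by (intro mult_nonneg_nonneg) auto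
  also have "\<dots> = a * c - b\<^sup>2" using c by (simp add: field_simps power2_eq_square)
  finally show ?thesis by simp
qed

lemma L2_Cauchy_Schwarz:
  assumes "f \<in> L2 I" "g \<in> L2 I"
  shows "(\<integral>x. f x * g x \<partial>lebesgue_on I)\<^sup>2
          \<le> (\<integral>x. (f x)\<^sup>2 \<partial>lebesgue_on I) * (\<integral>x. (g x)\<^sup>2 \<partial>lebesgue_on I)"
proof (rule discriminant_nonpos)
  have f: "integrable (lebesgue_on I) (\<lambda>x. (f x)\<^sup>2)" and g: "integrable (lebesgue_on I) (\<lambda>x. (g x)\<^sup>2)"
    using assms by (auto simp: L2_def)
  note fg = L2_mult_integrable[OF assms]
  fix t :: real
  have "0 \<le> (\<integral>x. (f x - t * g x)\<^sup>2 \<partial>lebesgue_on I)" by simp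
  also have "\<dots> = (\<integral>x. (f x)\<^sup>2 - 2 * t * (f x * g x) + t\<^sup>2 * (g x)\<^sup>2 \<partial>lebesgue_on I)"
    by (rule Bochner_Integration.integral_cong) (auto simp: power2_eq_square algebra_simps)
  also have "\<dots> = (\<integral>x. (f x)\<^sup>2 \<partial>lebesgue_on I) - 2 * t * (\<integral>x. f x * g x \<partial>lebesgue_on I)
                   + t\<^sup>2 * (\<integral>x. (g x)\<^sup>2 \<partial>lebesgue_on I)"
    using f g fg by simp
  finally show "0 \<le> (\<integral>x. (f x)\<^sup>2 \<partial>lebesgue_on I) - 2 * t * (\<integral>x. f x * g x \<partial>lebesgue_on I)
                   + t\<^sup>2 * (\<integral>x. (g x)\<^sup>2 \<partial>lebesgue_on I)" .
qed simp

lemma sqrt_add_le_of_bounds: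
  fixes a b c :: real
  assumes "c\<^sup>2 \<le> a * b" "a \<ge> 0" "b \<ge> 0"
  shows "sqrt (a + 2 * c + b) \<le> sqrt a + sqrt b"
proof (rule real_le_lsqrt)
  have "c \<le> sqrt a * sqrt b"
    using assms by (metis real_le_rsqrt real_sqrt_mult)
  then show "a + 2 * c + b \<le> (sqrt a + sqrt b)\<^sup>2"
    using assms by (simp add: power2_sum)
qed (use assms in auto)

lemma L2_triangle:
  assumes "f \<in> L2 I" "g \<in> L2 I"
  shows "sqrt (\<integral>x. (f x + g x)\<^sup>2 \<partial>lebesgue_on I)
          \<le> sqrt (\<integral>x. (f x)\<^sup>2 \<partial>lebesgue_on I) + sqrt (\<integral>x. (g x)\<^sup>2 \<partial>lebesgue_on I)"
proof -
  have f: "integrable (lebesgue_on I) (\<lambda>x. (f x)\<^sup>2)" and g: "integrable (lebesgue_on I) (\<lambda>x. (g x)\<^sup>2)"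
    using assms by (auto simp: L2_def)
  note fg = L2_mult_integrable[OF assms]
  have "(\<integral>x. (f x + g x)\<^sup>2 \<partial>lebesgue_on I)
      = (\<integral>x. (f x)\<^sup>2 + 2 * (f x * g x) + (g x)\<^sup>2 \<partial>lebesgue_on I)"
    by (rule Bochner_Integration.integral_cong) (auto simp: power2_eq_square algebra_simps)
  also have "\<dots> = (\<integral>x. (f x)\<^sup>2 \<partial>lebesgue_on I) + 2 * (\<integral>x. f x * g x \<partial>lebesgue_on I)
                   + (\<integral>x. (g x)\<^sup>2 \<partial>lebesgue_on I)"
    using f g fg by simp
  finally show ?thesis
    using sqrt_add_le_of_bounds[OF L2_Cauchy_Schwarz[OF assms]] by simp
qed

lemma L2_integrable:
  assumes "f \<in> L2 I" "finite_measure (lebesgue_on I)"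
  shows "integrable (lebesgue_on I) f"
proof -
  interpret finite_measure "lebesgue_on I" by fact
  have "(\<lambda>_. 1) \<in> L2 I" by (auto simp: L2_def)
  from L2_mult_integrable[OF assms(1) this] show ?thesis by simp
qed

lemma L2_tendsto_integral_mult:
  assumes "\<And>n. f n \<in> L2 I" "g \<in> L2 I" "h \<in> L2 I"
    and "(\<lambda>n. \<integral>x. (f n x - g x)\<^sup>2 \<partial>lebesgue_on I) \<longlonglongrightarrow> 0"
  shows "(\<lambda>n. \<integral>x. f n x * h x \<partial>lebesgue_on I) \<longlonglongrightarrow> (\<integral>x. g x * h x \<partial>lebesgue_on I)"
proof -
  have "(\<lambda>n. (\<integral>x. f n x * h x \<partial>lebesgue_on I) - (\<integral>x. g x * h x \<partial>lebesgue_on I)) \<longlonglongrightarrow> 0"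
  proof (rule Lim_null_comparison)
    let ?H = "\<integral>x. (h x)\<^sup>2 \<partial>lebesgue_on I"
    have "(\<lambda>n. sqrt ((\<integral>x. (f n x - g x)\<^sup>2 \<partial>lebesgue_on I) * ?H)) \<longlonglongrightarrow> sqrt (0 * ?H)"
      by (intro tendsto_intros assms)
    then show "(\<lambda>n. sqrt ((\<integral>x. (f n x - g x)\<^sup>2 \<partial>lebesgue_on I) * ?H)) \<longlonglongrightarrow> 0" by simp
    have "norm ((\<integral>x. f n x * h x \<partial>lebesgue_on I) - (\<integral>x. g x * h x \<partial>lebesgue_on I))
        \<le> sqrt ((\<integral>x. (f n x - g x)\<^sup>2 \<partial>lebesgue_on I) * ?H)" for n
    proof -
      have "(\<integral>x. f n x * h x \<partial>lebesgue_on I) - (\<integral>x. g x * h x \<partial>lebesgue_on I)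
          = (\<integral>x. (f n x - g x) * h x \<partial>lebesgue_on I)"
        using L2_mult_integrable[OF assms(1)[of n] assms(3)] L2_mult_integrable[OF assms(2,3)]
        by (simp add: left_diff_distrib)
      then show ?thesis
        using L2_Cauchy_Schwarz[OF L2_diff[OF assms(1)[of n] assms(2)] assms(3)]
        by (simp add: real_le_rsqrt)
    qed
    then show "\<forall>\<^sub>F n in sequentially.
        norm ((\<integral>x. f n x * h x \<partial>lebesgue_on I) - (\<integral>x. g x * h x \<partial>lebesgue_on I))
        \<le> sqrt ((\<integral>x. (f n x - g x)\<^sup>2 \<partial>lebesgue_on I) * ?H)"
      by simp
  qed
  then show ?thesis by (simp add: LIM_zero_iff)
qed

text \<open>Expanding around the limit \<open>g\<close> leaves the vanishing error and one pairing
  with a fixed function. The lemma carries the observability inequality from classical to mild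
  traces.\<close>

lemma L2_tendsto_norm:
  assumes "\<And>n. f n \<in> L2 I" "g \<in> L2 I"
    and "(\<lambda>n. \<integral>x. (f n x - g x)\<^sup>2 \<partial>lebesgue_on I) \<longlonglongrightarrow> 0"
  shows "(\<lambda>n. \<integral>x. (f n x)\<^sup>2 \<partial>lebesgue_on I) \<longlonglongrightarrow> (\<integral>x. (g x)\<^sup>2 \<partial>lebesgue_on I)"
proof -
  have eq: "(\<integral>x. (f n x)\<^sup>2 \<partial>lebesgue_on I) = (\<integral>x. (f n x - g x)\<^sup>2 \<partial>lebesgue_on I)
       + 2 * (\<integral>x. f n x * g x \<partial>lebesgue_on I) - (\<integral>x. (g x)\<^sup>2 \<partial>lebesgue_on I)" for n
  proof -
    have "(\<integral>x. (f n x)\<^sup>2 \<partial>lebesgue_on I)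
        = (\<integral>x. (f n x - g x)\<^sup>2 + 2 * (f n x * g x) - (g x)\<^sup>2 \<partial>lebesgue_on I)"
      by (rule Bochner_Integration.integral_cong) (auto simp: power2_eq_square algebra_simps)
    also have "\<dots> = (\<integral>x. (f n x - g x)\<^sup>2 \<partial>lebesgue_on I)
       + 2 * (\<integral>x. f n x * g x \<partial>lebesgue_on I) - (\<integral>x. (g x)\<^sup>2 \<partial>lebesgue_on I)"
      using L2_mult_integrable[OF assms(1)[of n] assms(2)] L2_diff[OF assms(1)[of n] assms(2)] assms(2)
      by (auto simp: L2_def)
    finally show ?thesis .
  qed
  have "(\<lambda>n. (\<integral>x. (f n x - g x)\<^sup>2 \<partial>lebesgue_on I)
       + 2 * (\<integral>x. f n x * g x \<partial>lebesgue_on I) - (\<integral>x. (g x)\<^sup>2 \<partial>lebesgue_on I))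
     \<longlonglongrightarrow> 0 + 2 * (\<integral>x. g x * g x \<partial>lebesgue_on I) - (\<integral>x. (g x)\<^sup>2 \<partial>lebesgue_on I)"
    by (intro tendsto_intros assms L2_tendsto_integral_mult)
  moreover have "(\<integral>x. g x * g x \<partial>lebesgue_on I) = (\<integral>x. (g x)\<^sup>2 \<partial>lebesgue_on I)"
    by (simp add: power2_eq_square)
  ultimately show ?thesis by (simp add: eq)
qed

lemma L2_measurable: "f \<in> L2 I \<Longrightarrow> f \<in> borel_measurable (lebesgue_on I)"
  by (simp add: L2_def)

text \<open>The pointwise bound (p + q)^2 \<le> 2 p^2 + 2 q^2 stays with squared norms, the form in
  which convergence is stated throughout.\<close>

lemma L2_lincomb_tendsto_0:
  assumes "\<And>n. f n \<in> L2 I" "\<And>n. g n \<in> L2 I"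
    and "(\<lambda>n. \<integral>x. (f n x)\<^sup>2 \<partial>lebesgue_on I) \<longlonglongrightarrow> 0" "(\<lambda>n. \<integral>x. (g n x)\<^sup>2 \<partial>lebesgue_on I) \<longlonglongrightarrow> 0"
  shows "(\<lambda>n. \<integral>x. (c * f n x + d * g n x)\<^sup>2 \<partial>lebesgue_on I) \<longlonglongrightarrow> 0"
proof (rule tendsto_sandwich[OF _ _ tendsto_const])
  let ?b = "\<lambda>n. 2 * c\<^sup>2 * (\<integral>x. (f n x)\<^sup>2 \<partial>lebesgue_on I) + 2 * d\<^sup>2 * (\<integral>x. (g n x)\<^sup>2 \<partial>lebesgue_on I)"
  have "?b \<longlonglongrightarrow> 2 * c\<^sup>2 * 0 + 2 * d\<^sup>2 * 0" by (intro tendsto_intros assms)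
  then show "?b \<longlonglongrightarrow> 0" by simp
  have "(\<integral>x. (c * f n x + d * g n x)\<^sup>2 \<partial>lebesgue_on I) \<le> ?b n" for n
  proof -
    have i: "integrable (lebesgue_on I) (\<lambda>x. (f n x)\<^sup>2)" "integrable (lebesgue_on I) (\<lambda>x. (g n x)\<^sup>2)"
      "integrable (lebesgue_on I) (\<lambda>x. (c * f n x + d * g n x)\<^sup>2)"
      using assms(1)[of n] assms(2)[of n] L2_lincomb[OF assms(1)[of n] assms(2)[of n]]
      by (auto simp: L2_def)
    have "(\<integral>x. (c * f n x + d * g n x)\<^sup>2 \<partial>lebesgue_on I)
        \<le> (\<integral>x. 2 * c\<^sup>2 * (f n x)\<^sup>2 + 2 * d\<^sup>2 * (g n x)\<^sup>2 \<partial>lebesgue_on I)"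
    proof (rule integral_mono)
      fix x
      have "0 \<le> (c * f n x - d * g n x)\<^sup>2" by simp
      then show "(c * f n x + d * g n x)\<^sup>2 \<le> 2 * c\<^sup>2 * (f n x)\<^sup>2 + 2 * d\<^sup>2 * (g n x)\<^sup>2"
        by (simp add: power2_eq_square algebra_simps)
    qed (use i in auto)
    also have "\<dots> = ?b n" using i by simp
    finally show ?thesis .
  qed
  then show "\<forall>\<^sub>F n in sequentially. (\<integral>x. (c * f n x + d * g n x)\<^sup>2 \<partial>lebesgue_on I) \<le> ?b n"
    by simp
qed simp

text \<open>Riesz--Fischer on a set of finite measure: a rapidly converging subsequence converges
  almost everywhere, and Fatou's lemma identifies its limit with the \<open>L\<^sup>2\<close> limit.\<close>

lemma L2_complete:
  assumes fin: "finite_measure (lebesgue_on I)" and f: "\<And>n. f n \<in> L2 I"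
    and cauchy: "\<And>e. e > 0 \<Longrightarrow> \<exists>N. \<forall>m\<ge>N. \<forall>n\<ge>N. (\<integral>x. (f m x - f n x)\<^sup>2 \<partial>lebesgue_on I) < e"
  obtains h where "h \<in> L2 I" "(\<lambda>n. \<integral>x. (f n x - h x)\<^sup>2 \<partial>lebesgue_on I) \<longlonglongrightarrow> 0"
proof -
  interpret M: finite_measure "lebesgue_on I" by fact
  let ?M = "lebesgue_on I" and ?\<mu> = "measure (lebesgue_on I) (space (lebesgue_on I))"
  have fi: "integrable ?M (f n)" for n by (rule L2_integrable[OF f fin])
  have fm: "f n \<in> borel_measurable ?M" for n by (rule L2_measurable[OF f])
  have i2: "integrable ?M (\<lambda>x. (f m x - f n x)\<^sup>2)" for m n
    using L2_diff[OF f f, of m n] by (simp add: L2_def)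
  \<comment> \<open>Finite measure makes L2-Cauchy sequences L1-Cauchy, which is what
    \<open>cauchy_L1_AE_cauchy_subseq\<close> takes as input.\<close>
  have L1: "(\<integral>x. norm (f m x - f n x) \<partial>?M)\<^sup>2 \<le> (\<integral>x. (f m x - f n x)\<^sup>2 \<partial>?M) * ?\<mu>" for m n
  proof -
    have 1: "(\<lambda>x. \<bar>f m x - f n x\<bar>) \<in> L2 I"
      using borel_measurable_abs[OF L2_measurable[OF L2_diff[OF f f, of m n]]] i2[of m n] by (simp add: L2_def)
    have 2: "(\<lambda>x. 1) \<in> L2 I" by (simp add: L2_def)
    from L2_Cauchy_Schwarz[OF 1 2] show ?thesis by simp
  qed
  obtain r where r: "strict_mono (r :: nat \<Rightarrow> nat)" "AE x in ?M. Cauchy (\<lambda>i. f (r i) x)"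
  proof (rule cauchy_L1_AE_cauchy_subseq[of ?M f])
    fix e :: real assume e: "e > 0"
    \<comment> \<open>The \<open>+ 1\<close> keeps the quotient meaningful when the set is
      null.\<close>
    then have "e\<^sup>2 / (?\<mu> + 1) > 0" by (intro divide_pos_pos) (auto simp: add_nonneg_pos)
    from cauchy[OF this] obtain N where
      N: "\<And>m n. m \<ge> N \<Longrightarrow> n \<ge> N \<Longrightarrow> (\<integral>x. (f m x - f n x)\<^sup>2 \<partial>?M) < e\<^sup>2 / (?\<mu> + 1)" by blast
    have "(\<integral>x. norm (f i x - f j x) \<partial>?M) < e" if "i \<ge> N" "j \<ge> N" for i j
    proof (rule power2_less_imp_less)
      have "(\<integral>x. norm (f i x - f j x) \<partial>?M)\<^sup>2 \<le> (\<integral>x. (f i x - f j x)\<^sup>2 \<partial>?M) * ?\<mu>" by (rule L1)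
      also have "\<dots> \<le> (\<integral>x. (f i x - f j x)\<^sup>2 \<partial>?M) * (?\<mu> + 1)" by (intro mult_left_mono) auto
      also have "\<dots> < e\<^sup>2 / (?\<mu> + 1) * (?\<mu> + 1)"
        by (intro mult_strict_right_mono N that) (auto simp: add_nonneg_pos)
      also have "\<dots> = e\<^sup>2" using measure_nonneg[of ?M "space ?M"] by (simp add: add_nonneg_eq_0_iff)
      finally show "(\<integral>x. norm (f i x - f j x) \<partial>?M)\<^sup>2 < e\<^sup>2" .
    qed (use e in simp)
    then show "\<exists>N. \<forall>i\<ge>N. \<forall>j\<ge>N. (\<integral>x. norm (f i x - f j x) \<partial>?M) < e" by blast
  qed (use fi in auto)
  define h where "h x = lim (\<lambda>i. f (r i) x)" for x
  have hm: "h \<in> borel_measurable ?M"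
    unfolding h_def[abs_def] by (rule borel_measurable_lim_metric) (rule fm)
  have conv: "AE x in ?M. (\<lambda>i. f (r i) x) \<longlonglongrightarrow> h x"
    using r(2) by eventually_elim (simp add: h_def Cauchy_convergent convergent_LIMSEQ_iff[symmetric])
  have Fatou: "(\<integral>\<^sup>+x. ennreal ((f n x - h x)\<^sup>2) \<partial>?M) \<le> ennreal e"
    if "\<And>k. k \<ge> N \<Longrightarrow> (\<integral>x. (f n x - f (r k) x)\<^sup>2 \<partial>?M) \<le> e" for n N e
  proof -
    have "(\<integral>\<^sup>+x. ennreal ((f n x - h x)\<^sup>2) \<partial>?M) = (\<integral>\<^sup>+x. liminf (\<lambda>k. ennreal ((f n x - f (r k) x)\<^sup>2)) \<partial>?M)"
    proof (rule nn_integral_cong_AE)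
      show "AE x in ?M. ennreal ((f n x - h x)\<^sup>2) = liminf (\<lambda>k. ennreal ((f n x - f (r k) x)\<^sup>2))"
        using conv
      proof eventually_elim
        case (elim x)
        have "(\<lambda>k. ennreal ((f n x - f (r k) x)\<^sup>2)) \<longlonglongrightarrow> ennreal ((f n x - h x)\<^sup>2)"
          by (intro tendsto_ennrealI tendsto_intros elim)
        then show ?case using lim_imp_Liminf[OF sequentially_bot] by metis
      qed
    qed
    also have "\<dots> \<le> liminf (\<lambda>k. \<integral>\<^sup>+x. ennreal ((f n x - f (r k) x)\<^sup>2) \<partial>?M)"
      by (intro nn_integral_liminf) (use fm in auto)
    also have "\<dots> \<le> liminf (\<lambda>k. ennreal e)"
    proof (rule Liminf_mono, rule eventually_sequentiallyI[of N])
      fix k assume "k \<ge> N"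
      then show "(\<integral>\<^sup>+x. ennreal ((f n x - f (r k) x)\<^sup>2) \<partial>?M) \<le> ennreal e"
        by (subst nn_integral_eq_integral[OF i2]) (auto intro!: ennreal_leI that)
    qed
    also have "\<dots> = ennreal e" by (simp add: Liminf_const)
    finally show ?thesis .
  qed
  have small: "integrable ?M (\<lambda>x. (f n x - h x)\<^sup>2) \<and> (\<integral>x. (f n x - h x)\<^sup>2 \<partial>?M) \<le> e"
    if "e \<ge> 0" "\<And>k. k \<ge> N \<Longrightarrow> (\<integral>x. (f n x - f (r k) x)\<^sup>2 \<partial>?M) \<le> e" for n N e
  proof -
    have F: "(\<integral>\<^sup>+x. ennreal ((f n x - h x)\<^sup>2) \<partial>?M) \<le> ennreal e" using that by (intro Fatou) auto
    have I: "integrable ?M (\<lambda>x. (f n x - h x)\<^sup>2)"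
      using F fm hm by (intro integrableI_bounded) (auto simp: less_top[symmetric] top_unique)
    have "ennreal (\<integral>x. (f n x - h x)\<^sup>2 \<partial>?M) \<le> ennreal e"
      using F nn_integral_eq_integral[OF I] by simp
    then show ?thesis using I that(1) by simp
  qed
  have ev: "\<exists>N. \<forall>n\<ge>N. integrable ?M (\<lambda>x. (f n x - h x)\<^sup>2) \<and> (\<integral>x. (f n x - h x)\<^sup>2 \<partial>?M) \<le> e" if "e > 0" for e
  proof -
    from cauchy[OF that] obtain N where N: "\<And>m n. m \<ge> N \<Longrightarrow> n \<ge> N \<Longrightarrow> (\<integral>x. (f m x - f n x)\<^sup>2 \<partial>?M) < e" by blast
    have "(\<integral>x. (f n x - f (r k) x)\<^sup>2 \<partial>?M) \<le> e" if "n \<ge> N" "k \<ge> N" for n k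
      using N[of n "r k"] that seq_suble[OF r(1), of k] by simp
    then show ?thesis using small[of e N] that by (intro exI[of _ N]) auto
  qed
  show ?thesis
  proof (rule that[of h])
    obtain n where "integrable ?M (\<lambda>x. (f n x - h x)\<^sup>2)" using ev[of 1] by auto
    then have "(\<lambda>x. f n x - h x) \<in> L2 I" using fm hm by (simp add: L2_def)
    from L2_diff[OF f[of n] this] show "h \<in> L2 I" by simp
    show "(\<lambda>n. \<integral>x. (f n x - h x)\<^sup>2 \<partial>?M) \<longlonglongrightarrow> 0"
    proof (rule LIMSEQ_I)
      fix e :: real assume "e > 0"
      then obtain N where N: "\<And>n. n \<ge> N \<Longrightarrow> (\<integral>x. (f n x - h x)\<^sup>2 \<partial>?M) \<le> e / 2"
        using ev[of "e / 2"] by auto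
      have "(\<integral>x. (f n x - h x)\<^sup>2 \<partial>?M) < e" if "n \<ge> N" for n
        using N[OF that] \<open>e > 0\<close> by linarith
      then show "\<exists>N. \<forall>n\<ge>N. norm ((\<integral>x. (f n x - h x)\<^sup>2 \<partial>?M) - 0) < e"
        by (intro exI[of _ N]) auto
    qed
  qed
qed

section \<open>Test functions\<close>

definition smooth :: "(real \<Rightarrow> real) \<Rightarrow> bool" where
  "smooth f \<longleftrightarrow> (\<forall>n x. (deriv ^^ n) f differentiable (at x))"

text \<open>Higher derivatives of products or compositions need not be computed: it suffices to
  exhibit a family of differentiable functions that \<open>deriv\<close> does not leave.\<close>

lemma smooth_coinduct:
  assumes "f \<in> F" and "\<And>g. g \<in> F \<Longrightarrow> (\<forall>x. g differentiable (at x)) \<and> deriv g \<in> F"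
  shows "smooth f"
proof -
  have "(deriv ^^ n) f \<in> F" for n
    by (induction n) (use assms in auto)
  then show ?thesis using assms(2) by (auto simp: smooth_def)
qed

lemma smooth_differentiable: "smooth f \<Longrightarrow> f differentiable (at x)"
  unfolding smooth_def by (metis funpow_0)

lemma smooth_deriv: "smooth f \<Longrightarrow> smooth (deriv f)"
  unfolding smooth_def by (metis funpow_swap1 funpow.simps(2) comp_apply)

lemma smooth_has_real_derivative: "smooth f \<Longrightarrow> (f has_real_derivative deriv f x) (at x)"
  by (metis DERIV_deriv_iff_real_differentiable smooth_differentiable)

lemma smooth_continuous_on: "smooth f \<Longrightarrow> continuous_on A f"
  by (meson DERIV_continuous continuous_at_imp_continuous_on smooth_has_real_derivative)

inductive smooth_closure :: "(real \<Rightarrow> real) \<Rightarrow> bool" where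
  base: "smooth f \<Longrightarrow> smooth_closure f"
| add: "smooth_closure f \<Longrightarrow> smooth_closure g \<Longrightarrow> smooth_closure (\<lambda>x. f x + g x)"
| mult: "smooth_closure f \<Longrightarrow> smooth_closure g \<Longrightarrow> smooth_closure (\<lambda>x. f x * g x)"

lemma smooth_closure_deriv:
  "smooth_closure f \<Longrightarrow> (\<forall>x. (f has_real_derivative deriv f x) (at x)) \<and> smooth_closure (deriv f)"
proof (induction rule: smooth_closure.induct)
  case (base f)
  then show ?case
    by (auto simp: smooth_has_real_derivative intro: smooth_closure.base smooth_deriv)
next
  case (add f g)
  then have d: "((\<lambda>x. f x + g x) has_real_derivative deriv f x + deriv g x) (at x)" for x
    by (auto intro!: derivative_eq_intros)
  then have "deriv (\<lambda>x. f x + g x) = (\<lambda>x. deriv f x + deriv g x)"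
    by (auto intro!: DERIV_imp_deriv)
  then show ?case using d add by (auto intro: smooth_closure.add)
next
  case (mult f g)
  then have d: "((\<lambda>x. f x * g x) has_real_derivative deriv f x * g x + f x * deriv g x) (at x)" for x
    by (auto intro!: derivative_eq_intros)
  then have "deriv (\<lambda>x. f x * g x) = (\<lambda>x. deriv f x * g x + f x * deriv g x)"
    by (auto intro!: DERIV_imp_deriv)
  then show ?case using d mult by (auto intro!: smooth_closure.add smooth_closure.mult)
qed

lemma smooth_closure_imp_smooth: "smooth_closure f \<Longrightarrow> smooth f"
  by (rule smooth_coinduct[of _ "Collect smooth_closure"])
     (use smooth_closure_deriv real_differentiable_def in blast)+

lemma smooth_add: "smooth f \<Longrightarrow> smooth g \<Longrightarrow> smooth (\<lambda>x. f x + g x)"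
  by (rule smooth_closure_imp_smooth[OF smooth_closure.add[OF smooth_closure.base smooth_closure.base]])

lemma smooth_mult: "smooth f \<Longrightarrow> smooth g \<Longrightarrow> smooth (\<lambda>x. f x * g x)"
  by (rule smooth_closure_imp_smooth[OF smooth_closure.mult[OF smooth_closure.base smooth_closure.base]])

lemma smooth_affine: "smooth (\<lambda>x. c + d * x)"
proof (rule smooth_coinduct[of _ "{f. \<exists>c d. f = (\<lambda>x. c + d * x)}"])
  fix g :: "real \<Rightarrow> real" assume "g \<in> {f. \<exists>c d. f = (\<lambda>x. c + d * x)}"
  then obtain c d where g: "g = (\<lambda>x. c + d * x)" by auto
  have D: "(g has_real_derivative d) (at x)" for x
    unfolding g by (auto intro!: derivative_eq_intros)
  then have "deriv g = (\<lambda>x. d + 0 * x)" by (auto intro!: DERIV_imp_deriv)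
  then show "(\<forall>x. g differentiable (at x)) \<and> deriv g \<in> {f. \<exists>c d. f = (\<lambda>x. c + d * x)}"
    using D real_differentiable_def by blast
qed auto

lemma smooth_const: "smooth (\<lambda>x. c)"
  using smooth_affine[of c 0] by simp

lemma smooth_ident: "smooth (\<lambda>x. x)"
  using smooth_affine[of 0 1] by simp

lemma smooth_lincomb: "smooth f \<Longrightarrow> smooth g \<Longrightarrow> smooth (\<lambda>x. c * f x + d * g x)"
  by (intro smooth_add smooth_mult smooth_const)

text \<open>The family for the coinduction carries a factor \<open>e\<close>, which collects the
  powers of \<open>d\<close> produced by the chain rule.\<close>

lemma smooth_compose_affine:
  assumes "smooth f" shows "smooth (\<lambda>x. f (c + d * x))"
proof (rule smooth_coinduct[of _ "{h. \<exists>e g. smooth g \<and> h = (\<lambda>x. e * g (c + d * x))}"])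
  have "(\<lambda>x. f (c + d * x)) = (\<lambda>x. 1 * f (c + d * x))" by simp
  then show "(\<lambda>x. f (c + d * x)) \<in> {h. \<exists>e g. smooth g \<and> h = (\<lambda>x. e * g (c + d * x))}"
    using assms by blast
next
  fix h assume "h \<in> {h. \<exists>e g. smooth g \<and> h = (\<lambda>x. e * g (c + d * x))}"
  then obtain e g where g: "smooth g" "h = (\<lambda>x. e * g (c + d * x))" by auto
  have D: "(h has_real_derivative (e * d) * deriv g (c + d * x)) (at x)" for x
    unfolding g(2)
    by (auto intro!: derivative_eq_intros DERIV_chain2[OF smooth_has_real_derivative[OF g(1)]])
  then have "deriv h = (\<lambda>x. (e * d) * deriv g (c + d * x))" by (auto intro!: DERIV_imp_deriv)
  then show "(\<forall>x. h differentiable (at x)) \<and>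
      deriv h \<in> {h. \<exists>e g. smooth g \<and> h = (\<lambda>x. e * g (c + d * x))}"
    using D smooth_deriv[OF g(1)] real_differentiable_def by blast
qed

lemma smooth_antiderivative:
  assumes "\<And>x. (f has_real_derivative g x) (at x)" "smooth g"
  shows "smooth f"
proof (rule smooth_coinduct[of _ "insert f (Collect smooth)"])
  have "deriv f = g" using assms(1) by (auto intro!: DERIV_imp_deriv)
  then show "(\<forall>x. h differentiable (at x)) \<and> deriv h \<in> insert f (Collect smooth)"
    if "h \<in> insert f (Collect smooth)" for h
    using that assms smooth_deriv smooth_differentiable real_differentiable_def by auto
qed auto

text \<open>Prepares the approximation by test functions, which obtains smoothness from
  Stone-Weierstrass polynomials.\<close>

lemma smooth_real_polynomial_function:
  fixes p :: "real \<Rightarrow> real"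
  assumes "real_polynomial_function p" shows "smooth p"
  using assms
proof induction
  case (linear f)
  have "f x = 0 + f 1 * x" for x
    using linear_cmul[OF bounded_linear.linear[OF linear], of x 1] by simp
  then have "f = (\<lambda>x. 0 + f 1 * x)" by (rule ext)
  then show ?case using smooth_affine[of 0 "f 1"] by simp
qed (auto intro: smooth_const smooth_add smooth_mult)

section \<open>Flat functions and bumps\<close>

lemma poly_times_exp_neg_tendsto_0: "((\<lambda>y. poly p y * exp (- y)) \<longlongrightarrow> (0::real)) at_top"
proof -
  have "((\<lambda>y. \<Sum>i\<le>degree p. coeff p i * (y ^ i / exp y)) \<longlongrightarrow> (\<Sum>i\<le>degree p. coeff p i * 0)) at_top"
    by (intro tendsto_intros tendsto_power_div_exp_0)
  moreover have "(\<Sum>i\<le>degree p. coeff p i * (y ^ i / exp y)) = poly p y * exp (- y)" for y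
    by (simp add: poly_altdef sum_distrib_right exp_minus divide_inverse mult.assoc)
  ultimately show ?thesis by simp
qed

definition flat_poly :: "real poly \<Rightarrow> real \<Rightarrow> real" where
  "flat_poly p x = (if x > 0 then poly p (inverse x) * exp (- inverse x) else 0)"

lemma flat_poly_has_derivative:
  "(flat_poly p has_real_derivative flat_poly ([:0, 0, 1:] * (p - pderiv p)) x) (at x)"
proof (cases x "0::real" rule: linorder_cases)
  case less
  have "((\<lambda>_. 0) has_real_derivative 0) (at x)" by simp
  then have "(flat_poly p has_real_derivative 0) (at x)"
    by (rule DERIV_cong_ev[THEN iffD1, rotated -1])
       (use less eventually_nhds_in_open[of "{..<0}" x] in
         \<open>auto simp: flat_poly_def elim!: eventually_mono\<close>)
  then show ?thesis using less by (simp add: flat_poly_def)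
next
  case greater
  have "((\<lambda>x. poly p (inverse x) * exp (- inverse x)) has_real_derivative
      poly (pderiv p) (inverse x) * - (inverse x ^ 2) * exp (- inverse x)
       + poly p (inverse x) * (exp (- inverse x) * inverse x ^ 2)) (at x)"
    using greater
    by (auto intro!: derivative_eq_intros DERIV_chain2[OF poly_DERIV] simp: power2_eq_square)
  moreover have "poly (pderiv p) (inverse x) * - (inverse x ^ 2) * exp (- inverse x)
       + poly p (inverse x) * (exp (- inverse x) * inverse x ^ 2)
     = flat_poly ([:0, 0, 1:] * (p - pderiv p)) x"
    using greater by (simp add: flat_poly_def power2_eq_square algebra_simps)
  ultimately have "((\<lambda>x. poly p (inverse x) * exp (- inverse x)) has_real_derivative
      flat_poly ([:0, 0, 1:] * (p - pderiv p)) x) (at x)" by simp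
  then show ?thesis
    by (rule DERIV_cong_ev[THEN iffD1, rotated -1])
       (use greater eventually_nhds_in_open[of "{0<..}" x] in
         \<open>auto simp: flat_poly_def elim!: eventually_mono\<close>)
next
  case equal
  have "((\<lambda>h. flat_poly p h / h) \<longlongrightarrow> 0) (at_left 0)"
    by (rule tendsto_eventually) (auto simp: flat_poly_def eventually_at_filter)
  moreover have "((\<lambda>h. flat_poly p h / h) \<longlongrightarrow> 0) (at_right 0)"
  proof (rule Lim_transform_eventually)
    \<comment> \<open>Dividing by \<open>h\<close> multiplies the polynomial in \<open>1 / h\<close>
      by its variable, which is \<open>pCons 0 p\<close>, and the exponential still wins.\<close>
    show "((\<lambda>h. poly (pCons 0 p) (inverse h) * exp (- inverse h)) \<longlongrightarrow> 0) (at_right (0::real))"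
      using filterlim_compose[OF poly_times_exp_neg_tendsto_0 filterlim_inverse_at_top_right] .
    show "\<forall>\<^sub>F h in at_right 0. poly (pCons 0 p) (inverse h) * exp (- inverse h) = flat_poly p h / h"
      by (auto simp: flat_poly_def eventually_at_filter field_simps)
  qed
  ultimately have "((\<lambda>h. flat_poly p h / h) \<longlongrightarrow> 0) (at 0)"
    by (simp add: filterlim_at_split)
  then show ?thesis using equal
    by (simp add: has_field_derivative_iff flat_poly_def)
qed

lemma smooth_flat_poly: "smooth (flat_poly p)"
proof (rule smooth_coinduct[of _ "range flat_poly"])
  fix g assume "g \<in> range flat_poly"
  then obtain p where p: "g = flat_poly p" by auto
  have "deriv g = flat_poly ([:0, 0, 1:] * (p - pderiv p))"
    unfolding p by (intro ext DERIV_imp_deriv flat_poly_has_derivative)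
  then show "(\<forall>x. g differentiable (at x)) \<and> deriv g \<in> range flat_poly"
    using flat_poly_has_derivative p real_differentiable_def by blast
qed auto

text \<open>Two opposite flat functions, positive together exactly on (c, d). The factor
  \<open>Suc n\<close> steepens the flanks, so that the bumps tend to the indicator of the open
  interval.\<close>

definition bump :: "real \<Rightarrow> real \<Rightarrow> nat \<Rightarrow> real \<Rightarrow> real" where
  "bump c d n x = flat_poly 1 (real (Suc n) * (x - c)) * flat_poly 1 (real (Suc n) * (d - x))"

lemma smooth_bump: "smooth (bump c d n)"
proof -
  have "smooth (\<lambda>x. flat_poly 1 (- (real (Suc n) * c) + real (Suc n) * x)
                  * flat_poly 1 (real (Suc n) * d + (- real (Suc n)) * x))"
    by (intro smooth_mult smooth_compose_affine smooth_flat_poly)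
  moreover have "bump c d n = (\<lambda>x. flat_poly 1 (- (real (Suc n) * c) + real (Suc n) * x)
                  * flat_poly 1 (real (Suc n) * d + (- real (Suc n)) * x))"
    by (auto simp: bump_def algebra_simps)
  ultimately show ?thesis by simp
qed

lemma flat_poly_1_bounds: "flat_poly 1 x \<ge> 0" "flat_poly 1 x \<le> 1"
  by (auto simp: flat_poly_def)

lemma bump_nonneg: "bump c d n x \<ge> 0" and bump_le_1: "bump c d n x \<le> 1"
  unfolding bump_def by (intro mult_nonneg_nonneg mult_le_one flat_poly_1_bounds)+

lemma bump_pos: "x \<in> {c<..<d} \<Longrightarrow> bump c d n x > 0"
  by (auto simp: bump_def flat_poly_def intro!: mult_pos_pos)

lemma bump_outside: "x \<notin> {c<..<d} \<Longrightarrow> bump c d n x = 0"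
  by (auto simp: bump_def flat_poly_def zero_less_mult_iff)

lemma flat_poly_1_scaled_tendsto: "y > 0 \<Longrightarrow> (\<lambda>n. flat_poly 1 (real (Suc n) * y)) \<longlonglongrightarrow> 1"
proof -
  assume y: "y > 0"
  have "(\<lambda>n. exp (- (inverse (real (Suc n)) * inverse y))) \<longlonglongrightarrow> exp (- (0 * inverse y))"
    by (intro tendsto_intros LIMSEQ_inverse_real_of_nat)
  moreover have "flat_poly 1 (real (Suc n) * y) = exp (- (inverse (real (Suc n)) * inverse y))" for n
    using y by (simp add: flat_poly_def)
  ultimately show ?thesis by simp
qed

lemma bump_tendsto_indicator: "(\<lambda>n. bump c d n x) \<longlonglongrightarrow> indicator {c<..<d} x"
proof (cases "x \<in> {c<..<d}")
  case True
  then have "(\<lambda>n. bump c d n x) \<longlonglongrightarrow> 1 * 1"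
    unfolding bump_def by (intro tendsto_mult flat_poly_1_scaled_tendsto) auto
  then show ?thesis using True by simp
qed (simp add: bump_outside)


section \<open>Integration over the unit interval\<close>

abbreviation "M01 \<equiv> lebesgue_on {0<..<1::real}"

lemma finite_measure_M01: "finite_measure M01"
  by (rule finite_measure_lebesgue_on) auto

lemma continuous_imp_measurable_M01:
  "continuous_on {0<..<1} f \<Longrightarrow> (f :: real \<Rightarrow> real) \<in> borel_measurable M01"
  by (rule continuous_imp_measurable_on_sets_lebesgue) auto

lemma integrable_M01_bounded:
  fixes f :: "real \<Rightarrow> real"
  assumes "f \<in> borel_measurable M01" "\<And>x. x \<in> {0<..<1} \<Longrightarrow> \<bar>f x\<bar> \<le> B"
  shows "integrable M01 f"
proof -
  interpret finite_measure M01 by (rule finite_measure_M01)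
  show ?thesis by (rule integrable_const_bound[of _ B]) (use assms in \<open>auto intro!: AE_I2\<close>)
qed

lemma bounded_imp_L2:
  fixes f :: "real \<Rightarrow> real"
  assumes "f \<in> borel_measurable M01" "\<And>x. x \<in> {0<..<1} \<Longrightarrow> \<bar>f x\<bar> \<le> B"
  shows "f \<in> L2 {0<..<1}"
proof -
  have "integrable M01 (\<lambda>x. (f x)\<^sup>2)"
  proof (rule integrable_M01_bounded[where B="B\<^sup>2"])
    show "\<bar>(f x)\<^sup>2\<bar> \<le> B\<^sup>2" if "x \<in> {0<..<1}" for x
      using assms(2)[OF that] by (simp add: abs_le_square_iff[symmetric]) 
  qed (use assms in auto)
  then show ?thesis using assms by (auto simp: L2_def)
qed

lemma continuous_bounded_M01:
  assumes "continuous_on {0..1} (f :: real \<Rightarrow> real)"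
  obtains B where "\<And>x. x \<in> {0..1} \<Longrightarrow> \<bar>f x\<bar> \<le> B" 
proof -
  have "bounded (f ` {0..1})" using assms by (intro compact_imp_bounded compact_continuous_image) auto
  then obtain B where "\<forall>x\<in>{0..1}. \<bar>f x\<bar> \<le> B" by (auto simp: bounded_iff)
  then show ?thesis by (intro that[of B]) auto
qed

lemma continuous_L2:
  assumes "continuous_on {0..1} (f :: real \<Rightarrow> real)"
  shows "f \<in> L2 {0<..<1}"
proof -
  obtain B where "\<And>x. x \<in> {0..1} \<Longrightarrow> \<bar>f x\<bar> \<le> B" using continuous_bounded_M01[OF assms] by blast
  then show ?thesis
    by (intro bounded_imp_L2[where B=B] continuous_imp_measurable_M01)
       (use assms in \<open>auto intro: continuous_on_subset\<close>)
qed

lemma L2_integrable_M01: "f \<in> L2 {0<..<1} \<Longrightarrow> integrable M01 f"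
  by (rule L2_integrable[OF _ finite_measure_M01])

text \<open>The passage from the Lebesgue integral over the open interval to the gauge integral over
  the closed one, where the fundamental theorem of calculus is available.\<close>

lemma integral_M01_eq:
  "integrable M01 f \<Longrightarrow> (\<integral>x. f x \<partial>M01) = integral {0..1} (f :: real \<Rightarrow> real)"
  by (simp add: lebesgue_integral_eq_integral integral_open_interval_real)

lemma integral_M01_eqI:
  "integrable M01 f \<Longrightarrow> (f has_integral I) {0..1} \<Longrightarrow> (\<integral>x. f x \<partial>M01) = (I :: real)"
  by (simp add: integral_M01_eq integral_unique)

section \<open>Test functions and their primitives\<close>

lemma test_function_alt:
  "test_function \<phi> \<longleftrightarrow> smooth \<phi> \<and> (\<exists>c d. 0 < c \<and> d < 1 \<and> (\<forall>x. x \<notin> {c..d} \<longrightarrow> \<phi> x = 0))"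
  by (simp add: test_function_def smooth_def)

lemma test_function_smooth: "test_function \<phi> \<Longrightarrow> smooth \<phi>"
  by (simp add: test_function_alt)

lemma test_function_support:
  assumes "test_function \<phi>"
  obtains c d where "0 < c" "c < d" "d < 1" "\<And>x. x \<notin> {c..d} \<Longrightarrow> \<phi> x = 0"
proof -
  obtain c d where cd: "0 < c" "d < 1" "\<And>x. x \<notin> {c..d} \<Longrightarrow> \<phi> x = 0"
    using assms by (auto simp: test_function_alt)
  \<comment> \<open>The interval in the definition may be empty; widening it to contain [1/3, 1/2]
    ensures \<open>c < d\<close>.\<close>
  show ?thesis
    by (rule that[of "min c (1/3)" "max d (1/2)"]) (use cd(1,2) in \<open>auto intro!: cd(3)\<close>)
qed

lemma test_function_continuous_on: "test_function \<phi> \<Longrightarrow> continuous_on A \<phi>"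
  by (simp add: test_function_smooth smooth_continuous_on)

lemma test_function_outside: "test_function \<phi> \<Longrightarrow> x \<notin> {0<..<1} \<Longrightarrow> \<phi> x = 0"
  by (erule test_function_support) auto

lemma test_function_mult: "test_function \<phi> \<Longrightarrow> smooth f \<Longrightarrow> test_function (\<lambda>x. f x * \<phi> x)"
  unfolding test_function_alt by (metis mult_zero_right smooth_mult)

lemma test_function_lincomb:
  assumes "test_function \<phi>" "test_function \<psi>"
  shows "test_function (\<lambda>x. c * \<phi> x + d * \<psi> x)"
proof -
  obtain c1 d1 where 1: "0 < c1" "d1 < 1" "\<And>x. x \<notin> {c1..d1} \<Longrightarrow> \<phi> x = 0"
    using assms(1) by (auto simp: test_function_alt)
  obtain c2 d2 where 2: "0 < c2" "d2 < 1" "\<And>x. x \<notin> {c2..d2} \<Longrightarrow> \<psi> x = 0"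
    using assms(2) by (auto simp: test_function_alt)
  have "c * \<phi> x + d * \<psi> x = 0" if "x \<notin> {min c1 c2..max d1 d2}" for x
    using that 1(3)[of x] 2(3)[of x] by fastforce
  then have "0 < min c1 c2 \<and> max d1 d2 < 1 \<and>
      (\<forall>x. x \<notin> {min c1 c2..max d1 d2} \<longrightarrow> c * \<phi> x + d * \<psi> x = 0)"
    using 1(1,2) 2(1,2) by auto
  then show ?thesis
    using assms smooth_lincomb unfolding test_function_alt by blast
qed

lemma test_function_deriv:
  assumes "test_function \<phi>" shows "test_function (deriv \<phi>)"
proof -
  obtain c d where cd: "0 < c" "d < 1" "\<And>x. x \<notin> {c..d} \<Longrightarrow> \<phi> x = 0"
    using assms by (auto simp: test_function_alt)
  have "deriv \<phi> x = 0" if "x \<notin> {c..d}" for x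
  proof (rule DERIV_imp_deriv)
    have "((\<lambda>_. 0) has_real_derivative 0) (at x)" by simp
    then show "(\<phi> has_real_derivative 0) (at x)"
      by (rule DERIV_cong_ev[THEN iffD1, rotated -1])
         (use that eventually_nhds_in_open[of "- {c..d}" x] in
           \<open>auto simp: cd(3) closed_Compl open_Compl elim!: eventually_mono\<close>)
  qed
  then show ?thesis using assms cd smooth_deriv unfolding test_function_alt by blast
qed

lemma test_function_funpow_deriv: "test_function \<phi> \<Longrightarrow> test_function ((deriv ^^ n) \<phi>)"
  by (induction n) (auto simp: test_function_deriv)

lemma test_function_has_real_derivative:
  "test_function \<phi> \<Longrightarrow> (\<phi> has_real_derivative deriv \<phi> x) (at x)"
  by (simp add: smooth_has_real_derivative test_function_smooth)

lemma test_function_L2: "test_function \<phi> \<Longrightarrow> \<phi> \<in> L2 {0<..<1}"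
  by (rule continuous_L2[OF test_function_continuous_on])

lemma test_function_bounded:
  assumes "test_function \<phi>" obtains B where "\<And>x. \<bar>\<phi> x\<bar> \<le> B" "B \<ge> 0"
proof -
  obtain B where B: "\<And>x. x \<in> {0..1} \<Longrightarrow> \<bar>\<phi> x\<bar> \<le> B"
    using continuous_bounded_M01[OF test_function_continuous_on[OF assms]] by blast
  have "\<bar>\<phi> x\<bar> \<le> \<bar>B\<bar>" for x
    using B[of x] test_function_outside[OF assms, of x] by (cases "x \<in> {0<..<1}") auto
  then show ?thesis using that by (meson abs_ge_zero)
qed

lemma test_function_bump: "0 < c \<Longrightarrow> d < 1 \<Longrightarrow> test_function (bump c d n)"
  unfolding test_function_alt using smooth_bump bump_outside
  by (metis atLeastAtMost_iff greaterThanLessThan_iff less_imp_le)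

text \<open>The primitive is 0 to the left of the support, and also to the right because the total
  integral vanishes. The second-order du Bois-Reymond argument uses this twice.\<close>

lemma test_function_antiderivative:
  assumes \<psi>: "test_function \<psi>" and 0: "(\<integral>x. \<psi> x \<partial>M01) = 0"
  obtains \<eta> where "test_function \<eta>" "deriv \<eta> = \<psi>"
proof -
  obtain c d where cd: "0 < c" "c < d" "d < 1" "\<And>x. x \<notin> {c..d} \<Longrightarrow> \<psi> x = 0"
    using test_function_support[OF \<psi>] by blast
  define \<eta> where "\<eta> x = integral {-1..x} \<psi>" for x
  have io: "\<psi> integrable_on {u..v}" for u v
    by (rule integrable_continuous_real[OF test_function_continuous_on[OF \<psi>]])
  have left: "\<eta> x = 0" if "x < c" for x
    unfolding \<eta>_def using that cd by (intro integral_unique has_integral_is_0) auto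
  have right: "\<eta> x = 0" if x: "x > d" for x
  proof -
    have "integral {-1..x} \<psi> = integral {-1..0} \<psi> + integral {0..x} \<psi>"
      using x cd by (intro Henstock_Kurzweil_Integration.integral_combine[symmetric] io) auto
    also have "integral {-1..0} \<psi> = 0"
      using cd by (intro integral_unique has_integral_is_0) auto
    also have "integral {0..x} \<psi> = integral {0..d} \<psi> + integral {d..x} \<psi>"
      using x cd by (intro Henstock_Kurzweil_Integration.integral_combine[symmetric] io) auto
    also have "integral {d..x} \<psi> = integral {d<..<x} \<psi>" by (rule integral_open_interval_real)
    also have "\<dots> = 0"
      using cd by (intro integral_unique has_integral_is_0) auto
    also have "integral {0..d} \<psi> = integral {0..1} \<psi> - integral {d..1} \<psi>"
      using Henstock_Kurzweil_Integration.integral_combine[OF _ _ io, of 0 d 1] cd by simp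
    also have "integral {d..1} \<psi> = integral {d<..<1} \<psi>" by (rule integral_open_interval_real)
    also have "\<dots> = 0"
      using cd by (intro integral_unique has_integral_is_0) auto
    also have "integral {0..1} \<psi> = 0"
      using 0 integral_M01_eq[OF L2_integrable_M01[OF test_function_L2[OF \<psi>]]] by simp
    finally show ?thesis by (simp add: \<eta>_def)
  qed
  have D: "(\<eta> has_real_derivative \<psi> x) (at x)" for x
  proof (cases "x < c")
    case True
    have "((\<lambda>_. 0) has_real_derivative \<psi> x) (at x)" using True cd by simp
    then show ?thesis
      by (rule DERIV_cong_ev[THEN iffD1, rotated -1])
         (use True left eventually_nhds_in_open[of "{..<c}" x] in \<open>auto elim!: eventually_mono\<close>)
  next
    case False
    have "(\<eta> has_vector_derivative \<psi> x) (at x within {-1..x+1})"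
      unfolding \<eta>_def using False cd
      by (intro integral_has_vector_derivative test_function_continuous_on[OF \<psi>]) auto
    moreover have "at x within {-1..x+1} = at x"
      using False cd by (intro at_within_interior) auto
    ultimately show ?thesis by (simp add: has_real_derivative_iff_has_vector_derivative)
  qed
  show ?thesis
  proof (rule that)
    show "deriv \<eta> = \<psi>" by (intro ext DERIV_imp_deriv D)
    show "test_function \<eta>"
      unfolding test_function_alt
      using smooth_antiderivative[OF D test_function_smooth[OF \<psi>]] cd left right
      by (metis atLeastAtMost_iff not_le)
  qed
qed

lemma test_function_integral_by_parts:
  assumes \<phi>: "test_function \<phi>" and f: "\<And>x. (f has_real_derivative f' x) (at x)"
    and f': "continuous_on UNIV f'"
  shows "(\<integral>x. f x * deriv \<phi> x \<partial>M01) = - (\<integral>x. f' x * \<phi> x \<partial>M01)"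
proof -
  note cont = test_function_continuous_on[OF \<phi>] test_function_continuous_on[OF test_function_deriv[OF \<phi>]]
  have cf: "continuous_on A f" for A
    by (meson DERIV_continuous continuous_at_imp_continuous_on f)
  have 1: "integrable M01 (\<lambda>x. f x * deriv \<phi> x)" "integrable M01 (\<lambda>x. f' x * \<phi> x)"
    by (rule L2_integrable_M01[OF continuous_L2], intro continuous_intros cont cf,
        rule L2_integrable_M01[OF continuous_L2], intro continuous_intros cont
        continuous_on_subset[OF f'] subset_UNIV)
  have "((\<lambda>x. f x * deriv \<phi> x + f' x * \<phi> x) has_integral f 1 * \<phi> 1 - f 0 * \<phi> 0) {0..1}"
    by (rule fundamental_theorem_of_calculus)
       (auto intro!: derivative_eq_intros has_vector_derivative_at_within[OF
          has_real_derivative_iff_has_vector_derivative[THEN iffD1]]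
          f test_function_has_real_derivative[OF \<phi>])
  moreover have "\<phi> 0 = 0" "\<phi> 1 = 0" using test_function_outside[OF \<phi>] by auto
  ultimately have "(\<integral>x. f x * deriv \<phi> x + f' x * \<phi> x \<partial>M01) = 0"
    using 1 by (intro integral_M01_eqI) auto
  then show ?thesis using 1 by simp
qed

text \<open>A measurable function is an almost everywhere limit of continuous ones. Clipping these
  at \<open>B\<close>, replacing them on [0, 1] by Stone-Weierstrass polynomials and multiplying by
  bumps gives smoothness, bound and support together, in place of a mollification. The 1 in
  \<open>B + 1\<close> bounds the polynomial error.\<close>

lemma test_function_approximation:
  assumes f: "f \<in> borel_measurable M01" "\<And>x. \<bar>f x\<bar> \<le> B" and cd: "0 < c" "d < 1"
  obtains \<psi> :: "nat \<Rightarrow> real \<Rightarrow> real" where "\<And>n. test_function (\<psi> n)"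
    "\<And>n x. x \<notin> {c<..<d} \<Longrightarrow> \<psi> n x = 0" "\<And>n x. \<bar>\<psi> n x\<bar> \<le> B + 1"
    "AE x in M01. (\<lambda>n. \<psi> n x) \<longlonglongrightarrow> indicator {c<..<d} x * f x"
proof -
  have B: "B \<ge> 0" using f(2)[of 0] by linarith
  have "f measurable_on {0<..<1}"
    using f(1) by (simp add: measurable_on_iff_borel_measurable)
  then obtain N g where N: "negligible N" and g: "\<And>n. continuous_on UNIV (g n)"
    and lim: "\<And>x. x \<notin> N \<Longrightarrow> (\<lambda>n. g n x) \<longlonglongrightarrow> (if x \<in> {0<..<1} then f x else 0)"
    unfolding measurable_on_def by blast
  define h where "h n x = max (- B) (min B (g n x))" for n :: nat and x
  have "\<exists>p. real_polynomial_function p \<and> (\<forall>x\<in>{0..1}. \<bar>h n x - p x\<bar> < inverse (real (Suc n)))" for n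
  proof -
    have "continuous_on {0..1} (h n)"
      unfolding h_def by (intro continuous_intros continuous_on_subset[OF g]) auto
    then show ?thesis
      by (rule Stone_Weierstrass_real_polynomial_function[rotated, of _ _ "inverse (real (Suc n))"])
         auto
  qed
  then obtain p where p: "\<And>n. real_polynomial_function (p n)"
    "\<And>n x. x \<in> {0..1} \<Longrightarrow> \<bar>h n x - p n x\<bar> < inverse (real (Suc n))"
    by metis
  define \<psi> where "\<psi> n x = p n x * bump c d n x" for n x
  show ?thesis
  proof (rule that[of \<psi>])
    show "test_function (\<psi> n)" for n
      unfolding \<psi>_def using cd
      by (intro test_function_mult test_function_bump smooth_real_polynomial_function p)
    show "\<psi> n x = 0" if "x \<notin> {c<..<d}" for n x
      using that by (simp add: \<psi>_def bump_outside)
    show "\<bar>\<psi> n x\<bar> \<le> B + 1" for n x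
    proof (cases "x \<in> {c<..<d}")
      case True
      have "\<bar>h n x\<bar> \<le> B" using B by (auto simp: h_def)
      moreover have "inverse (real (Suc n)) \<le> 1" by (simp add: inverse_le_1_iff)
      ultimately have "\<bar>p n x\<bar> \<le> B + 1" using p(2)[of x n] True cd by auto
      then have "\<bar>p n x\<bar> * \<bar>bump c d n x\<bar> \<le> (B + 1) * 1"
        using B bump_nonneg[of c d n x] bump_le_1[of c d n x] by (intro mult_mono) auto
      then show ?thesis by (simp add: \<psi>_def abs_mult)
    qed (use B in \<open>simp add: \<psi>_def bump_outside\<close>)
    have *: "(\<lambda>n. \<psi> n x) \<longlonglongrightarrow> indicator {c<..<d} x * f x" if x: "x \<in> {0<..<1}" "x \<notin> N" for x
    proof -
      have "(\<lambda>n. h n x) \<longlonglongrightarrow> max (- B) (min B (f x))"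
        unfolding h_def using lim[OF x(2)] x by (intro tendsto_intros) auto
      also have "max (- B) (min B (f x)) = f x" using f(2)[of x] by auto
      finally have h: "(\<lambda>n. h n x) \<longlonglongrightarrow> f x" .
      have "(\<lambda>n. h n x - p n x) \<longlonglongrightarrow> 0"
        by (rule Lim_null_comparison[OF _ LIMSEQ_inverse_real_of_nat])
           (use p(2)[of x] x in \<open>auto intro!: always_eventually less_imp_le\<close>)
      from tendsto_diff[OF h this] have "(\<lambda>n. p n x) \<longlonglongrightarrow> f x" by simp
      from tendsto_mult[OF this bump_tendsto_indicator[of c d x]] show ?thesis
        by (simp add: \<psi>_def mult.commute)
    qed
    have N: "AE x in M01. x \<notin> N"
      using AE_not_in[of N lebesgue] N
      by (auto simp: AE_restrict_space_iff negligible_iff_null_sets elim!: eventually_mono)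
    show "AE x in M01. (\<lambda>n. \<psi> n x) \<longlonglongrightarrow> indicator {c<..<d} x * f x"
    proof (rule AE_mp[OF N], rule AE_I2, rule impI)
      fix x assume "x \<in> space M01" "x \<notin> N"
      then show "(\<lambda>n. \<psi> n x) \<longlonglongrightarrow> indicator {c<..<d} x * f x" using * by simp
    qed
  qed
qed

section \<open>Weak derivatives\<close>

lemma locally_integrable_iff:
  "locally_integrable g \<longleftrightarrow>
     (\<forall>c d. 0 < c \<longrightarrow> d < 1 \<longrightarrow> integrable M01 (\<lambda>x. indicator {c..d} x * g x))"
proof -
  have "integrable (lebesgue_on {c..d}) g \<longleftrightarrow> integrable M01 (\<lambda>x. indicator {c..d} x * g x)"
    if "0 < c" "d < 1" for c d
  proof -
    have "(\<lambda>x. indicator {0<..<1} x *\<^sub>R (indicator {c..d} x * g x)) = (\<lambda>x. indicator {c..d} x *\<^sub>R g x)"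
      using that by (auto simp: indicator_def)
    then show ?thesis by (simp add: integrable_restrict_space)
  qed
  then show ?thesis unfolding locally_integrable_def by blast
qed

lemma sets_M01I: "A \<in> sets borel \<Longrightarrow> A \<subseteq> {0<..<1} \<Longrightarrow> A \<in> sets M01"
  by (auto simp: sets_restrict_space_iff)

lemma integrable_M01_imp_locally_integrable:
  assumes "integrable M01 g" shows "locally_integrable g"
  unfolding locally_integrable_iff
proof (intro allI impI)
  fix c d :: real assume "0 < c" "d < 1"
  then have "{c..d} \<in> sets M01" by (intro sets_M01I) auto
  from integrable_mult_indicator[OF this assms]
  show "integrable M01 (\<lambda>x. indicator {c..d} x * g x)" by simp
qed

text \<open>Cutting off to the intervals [1/(n+1), 1 - 1/(n+1)] gives a sequence that is eventually
  constant at every point of (0, 1).\<close>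

lemma locally_integrable_measurable:
  assumes "locally_integrable g" shows "g \<in> borel_measurable M01"
proof (rule borel_measurable_LIMSEQ_real)
  let ?c = "\<lambda>n::nat. inverse (real (Suc n))"
  show "(\<lambda>x. indicator {?c n..1 - ?c n} x * g x) \<in> borel_measurable M01" for n
    using assms unfolding locally_integrable_iff by (auto intro: borel_measurable_integrable)
  fix x :: real assume "x \<in> space M01"
  then have x: "0 < x" "x < 1" by auto
  have "\<forall>\<^sub>F n in sequentially. ?c n < min x (1 - x)"
    using order_tendstoD(2)[OF LIMSEQ_inverse_real_of_nat, of "min x (1 - x)"] x by simp
  then have "\<forall>\<^sub>F n in sequentially. g x = indicator {?c n..1 - ?c n} x * g x"
    by eventually_elim (auto simp: indicator_def)
  then show "(\<lambda>n. indicator {?c n..1 - ?c n} x * g x) \<longlonglongrightarrow> g x"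
    by (rule Lim_transform_eventually[OF tendsto_const])
qed

lemma locally_integrable_times_bounded:
  assumes "locally_integrable g" "f \<in> borel_measurable M01" "0 < c" "d < 1"
    and "\<And>x. \<bar>f x\<bar> \<le> B" "\<And>x. x \<notin> {c..d} \<Longrightarrow> f x = 0"
  shows "integrable M01 (\<lambda>x. g x * f x)"
proof (rule Bochner_Integration.integrable_bound)
  show "integrable M01 (\<lambda>x. B * (indicator {c..d} x * g x))"
    using assms unfolding locally_integrable_iff by auto
  show "(\<lambda>x. g x * f x) \<in> borel_measurable M01"
    using locally_integrable_measurable[OF assms(1)] assms(2) by auto
  have "\<bar>g x * f x\<bar> \<le> \<bar>B * (indicator {c..d} x * g x)\<bar>" for x
  proof (cases "x \<in> {c..d}")
    case True
    have "\<bar>f x\<bar> * \<bar>g x\<bar> \<le> \<bar>B\<bar> * \<bar>g x\<bar>"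
      using assms(5)[of x] by (intro mult_right_mono) auto
    then show ?thesis using True by (simp add: abs_mult mult.commute)
  qed (use assms(6) in simp)
  then show "AE x in M01. norm (g x * f x) \<le> norm (B * (indicator {c..d} x * g x))"
    by (intro AE_I2) simp
qed

lemma test_function_measurable: "test_function \<phi> \<Longrightarrow> \<phi> \<in> borel_measurable M01"
  by (rule continuous_imp_measurable_M01[OF test_function_continuous_on])

lemma locally_integrable_times_test_function:
  assumes "locally_integrable g" "test_function \<phi>"
  shows "integrable M01 (\<lambda>x. g x * \<phi> x)"
proof -
  obtain c d where cd: "0 < c" "c < d" "d < 1" "\<And>x. x \<notin> {c..d} \<Longrightarrow> \<phi> x = 0"
    using test_function_support[OF assms(2)] by blast
  obtain B where "\<And>x. \<bar>\<phi> x\<bar> \<le> B" using test_function_bounded[OF assms(2)] by blast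
  then show ?thesis
    using locally_integrable_times_bounded[OF assms(1) test_function_measurable[OF assms(2)] cd(1,3)] cd(4)
    by blast
qed

lemma locally_integrable_lincomb:
  "locally_integrable f \<Longrightarrow> locally_integrable g \<Longrightarrow> locally_integrable (\<lambda>x. c * f x + d * g x)"
  unfolding locally_integrable_def by auto

text \<open>Testing with smooth approximations of \<open>sgn g\<close> gives \<open>\<integral> \<bar>g\<bar> = 0\<close> on compact subintervals.\<close>

lemma fundamental_lemma_calculus_of_variations:
  assumes g: "locally_integrable g"
    and 0: "\<And>\<phi>. test_function \<phi> \<Longrightarrow> (\<integral>x. g x * \<phi> x \<partial>M01) = 0"
  shows "AE x in M01. g x = 0"
proof -
  have gm[measurable]: "g \<in> borel_measurable M01" by (rule locally_integrable_measurable[OF g])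
  have cd: "AE x in M01. indicator {c<..<d} x * g x = 0" if "0 < c" "d < 1" for c d
  proof -
    have "(\<lambda>x. sgn (g x)) \<in> borel_measurable M01" "\<bar>sgn (g x)\<bar> \<le> 1" for x
      by (auto simp: sgn_real_def)
    from test_function_approximation[OF this that]
    obtain \<psi> :: "nat \<Rightarrow> real \<Rightarrow> real" where \<psi>: "\<And>n. test_function (\<psi> n)"
      "\<And>n x. x \<notin> {c<..<d} \<Longrightarrow> \<psi> n x = 0" "\<And>n x. \<bar>\<psi> n x\<bar> \<le> 1 + 1"
      "AE x in M01. (\<lambda>n. \<psi> n x) \<longlonglongrightarrow> indicator {c<..<d} x * sgn (g x)"
      by blast
    have \<psi>m: "\<psi> n \<in> borel_measurable M01" for n
      by (rule test_function_measurable[OF \<psi>(1)])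
    have "{c<..<d} \<in> sets M01" using that by (intro sets_M01I) auto
    then have im: "(indicator {c<..<d} :: real \<Rightarrow> real) \<in> borel_measurable M01"
      by (rule borel_measurable_indicator)
    have ic: "integrable M01 (\<lambda>x. 2 * \<bar>indicator {c..d} x * g x\<bar>)"
      using g that unfolding locally_integrable_iff by auto
    have "(\<lambda>n. \<integral>x. g x * \<psi> n x \<partial>M01) \<longlonglongrightarrow> (\<integral>x. indicator {c<..<d} x * \<bar>g x\<bar> \<partial>M01)"
    proof (rule integral_dominated_convergence)
      show "integrable M01 (\<lambda>x. 2 * \<bar>indicator {c..d} x * g x\<bar>)" by fact
      show "AE x in M01. (\<lambda>n. g x * \<psi> n x) \<longlonglongrightarrow> indicator {c<..<d} x * \<bar>g x\<bar>"
        using \<psi>(4)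
      proof eventually_elim
        case (elim x)
        from tendsto_mult[OF tendsto_const this, of "g x"] show ?case
          by (simp add: mult.left_commute abs_sgn)
      qed
      show "AE x in M01. norm (g x * \<psi> n x) \<le> 2 * \<bar>indicator {c..d} x * g x\<bar>" for n
      proof (rule AE_I2)
        fix x show "norm (g x * \<psi> n x) \<le> 2 * \<bar>indicator {c..d} x * g x\<bar>"
        proof (cases "x \<in> {c<..<d}")
          case True
          have "\<bar>g x\<bar> * \<bar>\<psi> n x\<bar> \<le> \<bar>g x\<bar> * 2" using \<psi>(3)[of n x] by (intro mult_left_mono) auto
          then show ?thesis using True by (auto simp: abs_mult)
        qed (simp add: \<psi>(2))
      qed
    qed (intro borel_measurable_times borel_measurable_abs gm \<psi>m im)+
    then have "(\<integral>x. indicator {c<..<d} x * \<bar>g x\<bar> \<partial>M01) = 0"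
      using 0[OF \<psi>(1)] by (simp add: LIMSEQ_const_iff)
    moreover have "integrable M01 (\<lambda>x. indicator {c<..<d} x * \<bar>g x\<bar>)"
      by (rule Bochner_Integration.integrable_bound[OF ic borel_measurable_times[OF im borel_measurable_abs[OF gm]]])
         (auto intro!: AE_I2 simp: indicator_def)
    ultimately show ?thesis
      by (subst (asm) integral_nonneg_eq_0_iff_AE) (auto elim!: eventually_mono)
  qed
  let ?c = "\<lambda>n::nat. inverse (real (Suc n))"
  have "AE x in M01. \<forall>n. indicator {?c n<..<1 - ?c n} x * g x = 0"
    unfolding AE_all_countable by (intro allI cd) auto
  then show ?thesis
  proof (rule AE_mp, intro AE_I2 impI)
    fix x assume x: "x \<in> space M01" and *: "\<forall>n. indicator {?c n<..<1 - ?c n} x * g x = 0"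
    have "\<forall>\<^sub>F n in sequentially. ?c n < min x (1 - x)"
      using order_tendstoD(2)[OF LIMSEQ_inverse_real_of_nat, of "min x (1 - x)"] x by simp
    then obtain n where "?c n < min x (1 - x)" by (auto simp: eventually_sequentially)
    then show "g x = 0" using spec[OF *, of n] by auto
  qed
qed

section \<open>Uniqueness and linearity of weak derivatives\<close>

lemma has_weak_deriv_integral:
  "has_weak_deriv n u w \<Longrightarrow> test_function \<phi> \<Longrightarrow>
    (\<integral>x. u x * (deriv ^^ n) \<phi> x \<partial>M01) = (-1) ^ n * (\<integral>x. w x * \<phi> x \<partial>M01)"
  by (simp add: has_weak_deriv_def)

lemma has_weak_deriv_unique:
  assumes "has_weak_deriv n u w" "has_weak_deriv n u w'"
  shows "AE x in M01. w x = w' x"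
proof -
  have l: "locally_integrable w" "locally_integrable w'"
    using assms by (auto simp: has_weak_deriv_def)
  have "AE x in M01. 1 * w x + (-1) * w' x = 0"
  proof (rule fundamental_lemma_calculus_of_variations[OF locally_integrable_lincomb[OF l]])
    fix \<phi> assume \<phi>: "test_function \<phi>"
    have "(-1) ^ n * (\<integral>x. w x * \<phi> x \<partial>M01) = (-1) ^ n * (\<integral>x. w' x * \<phi> x \<partial>M01)"
      using has_weak_deriv_integral[OF assms(1) \<phi>] has_weak_deriv_integral[OF assms(2) \<phi>] by simp
    then have "(\<integral>x. w x * \<phi> x \<partial>M01) = (\<integral>x. w' x * \<phi> x \<partial>M01)" by simp
    then show "(\<integral>x. (1 * w x + (-1) * w' x) * \<phi> x \<partial>M01) = 0"
      using l[THEN locally_integrable_times_test_function[OF _ \<phi>]] by (simp add: algebra_simps)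
  qed
  then show ?thesis by simp
qed

lemma has_weak_deriv_weak_deriv: "has_weak_deriv n u w \<Longrightarrow> has_weak_deriv n u (weak_deriv n u)"
  unfolding weak_deriv_def by (rule someI[of "has_weak_deriv n u"])

text \<open>As \<open>weak_deriv\<close> is a choice, its properties are shown for any one witness
  and transferred almost everywhere.\<close>

lemma weak_deriv_AE_eq: "has_weak_deriv n u w \<Longrightarrow> AE x in M01. weak_deriv n u x = w x"
  by (rule has_weak_deriv_unique[OF has_weak_deriv_weak_deriv])

lemma has_weak_deriv_lincomb:
  assumes "has_weak_deriv n u w" "has_weak_deriv n u' w'"
  shows "has_weak_deriv n (\<lambda>x. c * u x + d * u' x) (\<lambda>x. c * w x + d * w' x)"
  unfolding has_weak_deriv_def
proof (intro conjI allI impI)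
  have l: "locally_integrable w" "locally_integrable w'" "locally_integrable u" "locally_integrable u'"
    using assms by (auto simp: has_weak_deriv_def)
  then show "locally_integrable (\<lambda>x. c * u x + d * u' x)" "locally_integrable (\<lambda>x. c * w x + d * w' x)"
    by (auto intro: locally_integrable_lincomb)
  fix \<phi> assume \<phi>: "test_function \<phi>"
  note i = l[THEN locally_integrable_times_test_function[OF _ \<phi>]]
  note i' = l[THEN locally_integrable_times_test_function[OF _ test_function_funpow_deriv[OF \<phi>, of n]]]
  have "(\<integral>x. (c * u x + d * u' x) * (deriv ^^ n) \<phi> x \<partial>M01)
      = (\<integral>x. c * (u x * (deriv ^^ n) \<phi> x) + d * (u' x * (deriv ^^ n) \<phi> x) \<partial>M01)"
    by (simp add: algebra_simps)
  also have "\<dots> = c * (\<integral>x. u x * (deriv ^^ n) \<phi> x \<partial>M01) + d * (\<integral>x. u' x * (deriv ^^ n) \<phi> x \<partial>M01)"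
    using i' by simp
  also have "\<dots> = (-1) ^ n * (c * (\<integral>x. w x * \<phi> x \<partial>M01) + d * (\<integral>x. w' x * \<phi> x \<partial>M01))"
    unfolding has_weak_deriv_integral[OF assms(1) \<phi>] has_weak_deriv_integral[OF assms(2) \<phi>]
    by (simp add: algebra_simps)
  also have "c * (\<integral>x. w x * \<phi> x \<partial>M01) + d * (\<integral>x. w' x * \<phi> x \<partial>M01)
      = (\<integral>x. c * (w x * \<phi> x) + d * (w' x * \<phi> x) \<partial>M01)"
    using i by simp
  also have "\<dots> = (\<integral>x. (c * w x + d * w' x) * \<phi> x \<partial>M01)"
    by (simp add: algebra_simps)
  finally show "(\<integral>x. (c * u x + d * u' x) * (deriv ^^ n) \<phi> x \<partial>M01)
      = (-1) ^ n * (\<integral>x. (c * w x + d * w' x) * \<phi> x \<partial>M01)" .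
qed

lemma has_weak_deriv_cong_AE:
  assumes "has_weak_deriv n u w" "locally_integrable u'" "locally_integrable w'"
    and "AE x in M01. u x = u' x" "AE x in M01. w x = w' x"
  shows "has_weak_deriv n u' w'"
  unfolding has_weak_deriv_def
proof (intro conjI allI impI assms)
  fix \<phi> assume \<phi>: "test_function \<phi>"
  have "locally_integrable u" "locally_integrable w"
    using assms(1) by (auto simp: has_weak_deriv_def)
  note m = this[THEN locally_integrable_measurable] assms(2,3)[THEN locally_integrable_measurable]
    test_function_measurable[OF \<phi>] test_function_measurable[OF test_function_funpow_deriv[OF \<phi>, of n]]
  have "(\<integral>x. u' x * (deriv ^^ n) \<phi> x \<partial>M01) = (\<integral>x. u x * (deriv ^^ n) \<phi> x \<partial>M01)"
    using m assms(4) by (intro integral_cong_AE) (auto elim!: eventually_mono)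
  also have "\<dots> = (-1) ^ n * (\<integral>x. w x * \<phi> x \<partial>M01)"
    by (rule has_weak_deriv_integral[OF assms(1) \<phi>])
  also have "(\<integral>x. w x * \<phi> x \<partial>M01) = (\<integral>x. w' x * \<phi> x \<partial>M01)"
    using m assms(5) by (intro integral_cong_AE) (auto elim!: eventually_mono)
  finally show "(\<integral>x. u' x * (deriv ^^ n) \<phi> x \<partial>M01) = (-1) ^ n * (\<integral>x. w' x * \<phi> x \<partial>M01)" .
qed

lemma test_function_locally_integrable: "test_function \<phi> \<Longrightarrow> locally_integrable \<phi>"
  by (intro integrable_M01_imp_locally_integrable L2_integrable_M01 test_function_L2)

lemma funpow_deriv_Suc: "(deriv ^^ n) (deriv f) = deriv ((deriv ^^ n) (f :: real \<Rightarrow> real))"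
  by (simp add: funpow_swap1)

lemma has_weak_deriv_test_function:
  assumes "test_function \<phi>" shows "has_weak_deriv n \<phi> ((deriv ^^ n) \<phi>)"
  unfolding has_weak_deriv_def
proof (intro conjI allI impI test_function_locally_integrable test_function_funpow_deriv assms)
  fix \<psi> assume \<psi>: "test_function \<psi>"
  show "(\<integral>x. \<phi> x * (deriv ^^ n) \<psi> x \<partial>M01) = (-1) ^ n * (\<integral>x. (deriv ^^ n) \<phi> x * \<psi> x \<partial>M01)"
    using assms
  proof (induction n arbitrary: \<phi>)
    case (Suc n)
    have "(\<integral>x. \<phi> x * (deriv ^^ Suc n) \<psi> x \<partial>M01) = (\<integral>x. \<phi> x * deriv ((deriv ^^ n) \<psi>) x \<partial>M01)"
      by simp
    also have "\<dots> = - (\<integral>x. deriv \<phi> x * (deriv ^^ n) \<psi> x \<partial>M01)"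
      by (intro test_function_integral_by_parts test_function_funpow_deriv \<psi>
          test_function_has_real_derivative test_function_continuous_on test_function_deriv Suc.prems)
    also have "\<dots> = (-1) ^ Suc n * (\<integral>x. (deriv ^^ n) (deriv \<phi>) x * \<psi> x \<partial>M01)"
      using Suc.IH[OF test_function_deriv[OF Suc.prems]] by simp
    finally show ?case by (simp add: funpow_deriv_Suc)
  qed simp
qed

text \<open>Removing its first two moments by multiples of \<open>b\<close> and \<open>b'\<close>, for a bump \<open>b\<close> of
  integral 1, turns any test function into a second derivative of a test function.\<close>

lemma du_Bois_Reymond_second_order:
  assumes g: "locally_integrable g"
    and 0: "\<And>\<phi>. test_function \<phi> \<Longrightarrow> (\<integral>x. g x * (deriv ^^ 2) \<phi> x \<partial>M01) = 0"
  obtains A B where "AE x in M01. g x = A + B * x"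
proof -
  define b0 where "b0 = bump (1/3) (2/3) 0"
  have b0: "test_function b0" unfolding b0_def by (rule test_function_bump) auto
  have "(\<integral>x. b0 x \<partial>M01) > 0"
  proof (rule ccontr)
    assume "\<not> ?thesis"
    moreover have "(\<integral>x. b0 x \<partial>M01) \<ge> 0" by (rule integral_nonneg_AE) (simp add: b0_def bump_nonneg)
    ultimately have "(\<integral>x. b0 x \<partial>M01) = 0" by simp
    then have "AE x in M01. b0 x = 0"
      by (subst (asm) integral_nonneg_eq_0_iff_AE)
         (auto simp: b0_def bump_nonneg intro!: L2_integrable_M01 test_function_L2 b0[unfolded b0_def])
    then have ae: "AE x in M01. x \<notin> {1/3<..<2/3}"
      by eventually_elim (metis b0_def bump_pos less_irrefl)
    have "{1/3<..<2/3} \<in> sets M01" by (intro sets_M01I) auto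
    then have "{1/3<..<2/3} \<in> null_sets M01" using ae by (simp add: AE_iff_null_sets)
    then have "emeasure M01 {1/3<..<2/3} = 0" by auto
    moreover have "emeasure M01 {1/3<..<2/3} = emeasure lebesgue {1/3<..<2/3::real}"
      by (rule emeasure_restrict_space) auto
    ultimately show False by simp
  qed
  then obtain b where b: "test_function b" "(\<integral>x. b x \<partial>M01) = 1"
  proof -
    assume p: "(\<integral>x. b0 x \<partial>M01) > 0"
    show ?thesis
      by (rule that[of "\<lambda>x. (1 / (\<integral>x. b0 x \<partial>M01)) * b0 x + 0 * b0 x"])
         (rule test_function_lincomb[OF b0 b0], use p in simp)
  qed
  have i: "integrable M01 \<phi>" if "test_function \<phi>" for \<phi>
    using that by (intro L2_integrable_M01 test_function_L2)
  define m1 where "m1 = (\<integral>x. x * b x \<partial>M01)"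
  define c0 where "c0 = (\<integral>x. g x * b x \<partial>M01)"
  define c1 where "c1 = (\<integral>x. g x * deriv b x \<partial>M01)"
  \<comment> \<open>\<open>c0\<close> and \<open>c1\<close> pair \<open>g\<close> with
    \<open>b\<close> and \<open>b'\<close>, and \<open>m1\<close> pairs the identity with
    \<open>b\<close>. Eliminating \<open>q\<close> below turns the pairing of \<open>g\<close> with
    \<psi> into that of \<open>A - c1 x\<close> with \<psi>, which explains this value.\<close>
  define A where "A = c0 + m1 * c1"
  have "AE x in M01. 1 * g x + (-1) * (A - c1 * x) = 0"
  proof (rule fundamental_lemma_calculus_of_variations)
    have la: "locally_integrable (\<lambda>x. A - c1 * x)"
      by (intro integrable_M01_imp_locally_integrable L2_integrable_M01 continuous_L2 continuous_intros)
    then show "locally_integrable (\<lambda>x. 1 * g x + (-1) * (A - c1 * x))"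
      by (intro locally_integrable_lincomb g)
    fix \<psi> assume \<psi>: "test_function \<psi>"
    define p where "p = (\<integral>x. \<psi> x \<partial>M01)"
    define \<psi>1 where "\<psi>1 = (\<lambda>x. 1 * \<psi> x + (- p) * b x)"
    have \<psi>1: "test_function \<psi>1" unfolding \<psi>1_def by (intro test_function_lincomb \<psi> b)
    have "(\<integral>x. \<psi>1 x \<partial>M01) = 0"
      unfolding \<psi>1_def using i[OF \<psi>] i[OF b(1)] b(2) by (simp add: p_def)
    then obtain \<eta> where \<eta>: "test_function \<eta>" "deriv \<eta> = \<psi>1"
      using test_function_antiderivative[OF \<psi>1] by blast
    define q where "q = (\<integral>x. \<eta> x \<partial>M01)"
    define \<eta>1 where "\<eta>1 = (\<lambda>x. 1 * \<eta> x + (- q) * b x)"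
    have \<eta>1: "test_function \<eta>1" unfolding \<eta>1_def by (intro test_function_lincomb \<eta> b)
    have "(\<integral>x. \<eta>1 x \<partial>M01) = 0"
      unfolding \<eta>1_def using i[OF \<eta>(1)] i[OF b(1)] b(2) by (simp add: q_def)
    then obtain \<zeta> where \<zeta>: "test_function \<zeta>" "deriv \<zeta> = \<eta>1"
      using test_function_antiderivative[OF \<eta>1] by blast
    have d2: "(deriv ^^ 2) \<zeta> x = \<psi> x - p * b x - q * deriv b x" for x
    proof -
      have "(deriv ^^ 2) \<zeta> x = deriv \<eta>1 x" by (simp add: numeral_2_eq_2 \<zeta>)
      also have "\<dots> = \<psi>1 x - q * deriv b x"
        unfolding \<eta>1_def using \<eta>(2)
        by (intro DERIV_imp_deriv)
           (auto intro!: derivative_eq_intros test_function_has_real_derivative b \<eta>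
             simp: \<eta>(2)[symmetric])
      finally show ?thesis by (simp add: \<psi>1_def)
    qed
    have ig: "integrable M01 (\<lambda>x. g x * \<psi> x)" "integrable M01 (\<lambda>x. g x * b x)"
      "integrable M01 (\<lambda>x. g x * deriv b x)"
      by (intro locally_integrable_times_test_function[OF g] \<psi> b test_function_deriv)+
    have "0 = (\<integral>x. g x * \<psi> x - p * (g x * b x) - q * (g x * deriv b x) \<partial>M01)"
      using 0[OF \<zeta>(1)] unfolding d2 by (simp add: algebra_simps)
    also have "\<dots> = (\<integral>x. g x * \<psi> x \<partial>M01) - p * c0 - q * c1"
      using ig by (simp add: c0_def c1_def)
    finally have 1: "(\<integral>x. g x * \<psi> x \<partial>M01) = p * c0 + q * c1" by simp
    have ix: "integrable M01 (\<lambda>x. x * \<psi> x)" "integrable M01 (\<lambda>x. x * b x)"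
      by (intro i test_function_mult \<psi> b smooth_ident)+
    \<comment> \<open>One integration by parts expresses the mean \<open>q\<close> of the
      intermediate primitive through first moments.\<close>
    have "(\<integral>x. x * \<psi>1 x \<partial>M01) = - (\<integral>x. 1 * \<eta> x \<partial>M01)"
      unfolding \<eta>(2)[symmetric] by (intro test_function_integral_by_parts \<eta>) auto
    then have "q = - (\<integral>x. x * \<psi> x - p * (x * b x) \<partial>M01)"
      by (simp add: q_def \<psi>1_def algebra_simps)
    also have "\<dots> = - (\<integral>x. x * \<psi> x \<partial>M01) + p * m1"
      using ix by (simp add: m1_def)
    finally have q: "q = - (\<integral>x. x * \<psi> x \<partial>M01) + p * m1" .
    have "(\<integral>x. (1 * g x + (-1) * (A - c1 * x)) * \<psi> x \<partial>M01)
        = (\<integral>x. g x * \<psi> x - A * \<psi> x + c1 * (x * \<psi> x) \<partial>M01)"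
      by (rule Bochner_Integration.integral_cong) (auto simp: algebra_simps)
    also have "\<dots> = (\<integral>x. g x * \<psi> x \<partial>M01) - A * p + c1 * (\<integral>x. x * \<psi> x \<partial>M01)"
      using ig(1) i[OF \<psi>] ix by (simp add: p_def)
    also have "\<dots> = 0" unfolding 1 q A_def by (simp add: algebra_simps)
    finally show "(\<integral>x. (1 * g x + (-1) * (A - c1 * x)) * \<psi> x \<partial>M01) = 0" .
  qed
  then show ?thesis by (intro that[of A "- c1"]) (auto elim!: eventually_mono)
qed

section \<open>Primitives and the space \<open>H20\<close>\<close>

lemma borel_measurable_M01I: "f \<in> borel_measurable borel \<Longrightarrow> f \<in> borel_measurable M01"
  by (intro measurable_restrict_space1 measurable_completion) simp

lemma ident_measurable_M01: "(\<lambda>x. x) \<in> borel_measurable M01"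
  by (rule borel_measurable_M01I) simp

definition integral_from_0 :: "(real \<Rightarrow> real) \<Rightarrow> real \<Rightarrow> real" where
  "integral_from_0 g x = integral {0..x} g"

definition integral_to_1 :: "(real \<Rightarrow> real) \<Rightarrow> real \<Rightarrow> real" where
  "integral_to_1 g x = integral {x..1} g"

lemma M01_integrable_on: "integrable M01 (g :: real \<Rightarrow> real) \<Longrightarrow> g integrable_on {0..1}"
  using integrable_on_lebesgue_on[of "{0<..<1}" g] integrable_on_Icc_iff_Ioo[of g 0 1] by auto

lemma M01_integrable_on_subinterval:
  "integrable M01 (g :: real \<Rightarrow> real) \<Longrightarrow> 0 \<le> c \<Longrightarrow> d \<le> 1 \<Longrightarrow> g integrable_on {c..d}"
  by (rule integrable_on_subinterval[OF M01_integrable_on]) auto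

lemma integrable_indicator_M01:
  assumes "integrable M01 (g :: real \<Rightarrow> real)"
  shows "integrable M01 (\<lambda>t. indicator {c..d} t * g t)"
proof (rule Bochner_Integration.integrable_bound[OF assms])
  have "(\<lambda>t. indicator {c..d} t :: real) \<in> borel_measurable M01"
    by (rule borel_measurable_M01I) auto
  then show "(\<lambda>t. indicator {c..d} t * g t) \<in> borel_measurable M01"
    using assms by auto
qed (auto intro!: AE_I2 simp: indicator_def)

lemma integral_indicator_M01:
  fixes g :: "real \<Rightarrow> real"
  assumes "integrable M01 (\<lambda>t. indicator {c..d} t * g t)" "0 \<le> c" "d \<le> 1"
  shows "(\<integral>t. indicator {c..d} t * g t \<partial>M01) = integral {c..d} g"
proof -
  have "(\<integral>t. indicator {c..d} t * g t \<partial>M01) = integral {0..1} (\<lambda>t. indicator {c..d} t * g t)"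
    by (rule integral_M01_eq[OF assms(1)])
  also have "\<dots> = integral {0..1} (\<lambda>t. if t \<in> {c..d} then g t else 0)"
    by (rule Henstock_Kurzweil_Integration.integral_cong) (auto simp: indicator_def)
  also have "\<dots> = integral ({c..d} \<inter> {0..1}) g"
    by (rule Henstock_Kurzweil_Integration.integral_restrict_Int)
  also have "{c..d} \<inter> {0..1} = {c..d}" using assms by auto
  finally show ?thesis .
qed

lemma integral_from_0_eq:
  "integrable M01 g \<Longrightarrow> x \<le> 1 \<Longrightarrow> integral_from_0 g x = (\<integral>t. indicator {0..x} t * g t \<partial>M01)"
  unfolding integral_from_0_def
  by (rule integral_indicator_M01[OF integrable_indicator_M01, symmetric]) auto

lemma integral_from_0_zero [simp]: "integral_from_0 g 0 = 0"
  by (simp add: integral_from_0_def)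

lemma integral_to_1_one [simp]: "integral_to_1 g 1 = 0"
  by (simp add: integral_to_1_def)

lemma continuous_on_integral_from_0:
  "integrable M01 g \<Longrightarrow> continuous_on {0..1} (integral_from_0 g)"
  unfolding integral_from_0_def[abs_def]
  by (intro indefinite_integral_continuous_1 M01_integrable_on)

lemma integral_from_0_lincomb:
  assumes "integrable M01 f" "integrable M01 g" "x \<le> 1"
  shows "integral_from_0 (\<lambda>t. c * f t + d * g t) x = c * integral_from_0 f x + d * integral_from_0 g x"
proof (cases "0 \<le> x")
  case True
  have "f integrable_on {0..x}" "g integrable_on {0..x}"
    using assms True by (auto intro: M01_integrable_on_subinterval)
  then have "((\<lambda>t. c * f t + d * g t) has_integral c * integral {0..x} f + d * integral {0..x} g) {0..x}"
    by (intro has_integral_add has_integral_mult_right integrable_integral)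
  then show ?thesis unfolding integral_from_0_def by (rule integral_unique)
qed (simp add: integral_from_0_def)

lemma integral_from_0_cong_AE:
  assumes "integrable M01 f" "integrable M01 g" "AE x in M01. f x = g x" "x \<le> 1"
  shows "integral_from_0 f x = integral_from_0 g x"
  unfolding integral_from_0_eq[OF assms(1,4)] integral_from_0_eq[OF assms(2,4)]
  using integrable_indicator_M01[OF assms(1), of 0 x] integrable_indicator_M01[OF assms(2), of 0 x] assms(3)
  by (intro integral_cong_AE) (auto elim!: eventually_mono)

lemma integral_indicator_from_0:
  assumes "0 \<le> x" "x \<le> 1"
  shows "(\<integral>t. (indicator {0..x} t)\<^sup>2 \<partial>M01) = (x :: real)"
proof -
  have "(\<integral>t. (indicator {0..x} t)\<^sup>2 \<partial>M01) = (\<integral>t. indicator {0..x} t * (1 :: real) \<partial>M01)"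
    by (rule Bochner_Integration.integral_cong) (auto simp: indicator_def)
  also have "\<dots> = integral {0..x} (\<lambda>t. 1)"
    using assms finite_measure_M01
    by (intro integral_indicator_M01 integrable_indicator_M01 finite_measure.integrable_const) auto
  finally show ?thesis using assms by simp
qed

text \<open>Cauchy-Schwarz against the indicator of [0, x], whose squared norm is x. For
  \<open>g = u''\<close> this bounds \<open>u'\<close> by sqrt x times the norm of
  \<open>u''\<close>.\<close>

lemma integral_from_0_square_le:
  assumes "g \<in> L2 {0<..<1}" "0 \<le> x" "x \<le> 1"
  shows "(integral_from_0 g x)\<^sup>2 \<le> x * (\<integral>t. (g t)\<^sup>2 \<partial>M01)"
proof -
  have "(indicator {0..x} :: real \<Rightarrow> real) \<in> L2 {0<..<1}"
    by (rule bounded_imp_L2[where B=1])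
       (auto intro!: borel_measurable_M01I simp: indicator_def)
  from L2_Cauchy_Schwarz[OF this assms(1)] show ?thesis
    using assms by (simp add: integral_from_0_eq L2_integrable_M01 integral_indicator_from_0)
qed

lemma integral_from_0_L2:
  assumes "integrable M01 g" shows "integral_from_0 g \<in> L2 {0<..<1}"
  by (rule continuous_L2[OF continuous_on_integral_from_0[OF assms]])

lemma integral_from_0_abs_le:
  assumes "integrable M01 f" "\<And>t. 0 \<le> t \<Longrightarrow> t \<le> x \<Longrightarrow> \<bar>f t\<bar> \<le> C" "0 \<le> x" "x \<le> 1"
  shows "\<bar>integral_from_0 f x\<bar> \<le> C * x"
proof -
  have "0 \<le> C" using assms(2)[of 0] assms(3) by (meson abs_ge_zero order_trans order_refl)
  moreover have "(f has_integral integral_from_0 f x) {0..x}"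
    unfolding integral_from_0_def using assms by (auto intro: M01_integrable_on_subinterval integrable_integral)
  ultimately have "norm (integral_from_0 f x) \<le> C * measure lborel {0..x}"
    using assms(2) by (intro has_integral_bound_real[of C "{}" f]) auto
  then show ?thesis using assms by simp
qed

text \<open>Integrating the bound \<open>sqrt (x * N)\<close> once more costs a factor x, hence the
  cube. The resulting decay x^(3/2) of elements of \<open>H20\<close> is what later absorbs the
  weight \<open>1 / a\<close>.\<close>

lemma integral_from_0_twice_square_le:
  assumes "g \<in> L2 {0<..<1}" "0 \<le> x" "x \<le> 1"
  shows "(integral_from_0 (integral_from_0 g) x)\<^sup>2 \<le> x ^ 3 * (\<integral>t. (g t)\<^sup>2 \<partial>M01)"
proof -
  let ?N = "\<integral>t. (g t)\<^sup>2 \<partial>M01"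
  have "\<bar>integral_from_0 (integral_from_0 g) x\<bar> \<le> sqrt (x * ?N) * x"
  proof (rule integral_from_0_abs_le)
    show "integrable M01 (integral_from_0 g)"
      by (intro L2_integrable_M01 integral_from_0_L2 assms)
    fix t assume t: "0 \<le> t" "t \<le> x"
    have "(integral_from_0 g t)\<^sup>2 \<le> t * ?N" using t assms by (intro integral_from_0_square_le) auto
    also have "\<dots> \<le> x * ?N" using t by (intro mult_right_mono) auto
    finally show "\<bar>integral_from_0 g t\<bar> \<le> sqrt (x * ?N)" by (simp add: real_le_rsqrt)
  qed (use assms in auto)
  then have "(integral_from_0 (integral_from_0 g) x)\<^sup>2 \<le> (sqrt (x * ?N) * x)\<^sup>2"
    by (meson abs_ge_zero power2_le_iff_abs_le order_trans)
  also have "\<dots> = x ^ 3 * ?N" using assms by (simp add: power_mult_distrib power3_eq_cube power2_eq_square)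
  finally show ?thesis .
qed

lemma integral_from_0_has_derivative:
  assumes "continuous_on {0..1} g" "x \<in> {0<..<1}"
  shows "(integral_from_0 g has_real_derivative g x) (at x)"
proof -
  have "(integral_from_0 g has_vector_derivative g x) (at x within {0..1})"
    unfolding integral_from_0_def[abs_def] using assms by (intro integral_has_vector_derivative) auto
  moreover have "at x within {0..1} = at x" using assms by (intro at_within_interior) auto
  ultimately show ?thesis by (simp add: has_real_derivative_iff_has_vector_derivative)
qed

text \<open>Double primitives are recognised below by differentiating a candidate twice.
  Differentiability is asked for in the interior only, which admits derivatives such as
  \<open>x * G' x\<close> without a value at the endpoints.\<close>

lemma integral_from_0_derivative_eq:
  assumes "continuous_on {0..1} f" "f 0 = 0" "0 \<le> x" "x \<le> 1"
    and "\<And>t. t \<in> {0<..<1} \<Longrightarrow> (f has_real_derivative f' t) (at t)"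
  shows "integral_from_0 f' x = f x"
proof -
  have "(f' has_integral (f x - f 0)) {0..x}"
    using assms by (intro fundamental_theorem_of_calculus_interior)
      (auto intro: continuous_on_subset simp: has_real_derivative_iff_has_vector_derivative)
  then show ?thesis using assms by (simp add: integral_from_0_def integral_unique)
qed

text \<open>Both integrals are the double integral of \<open>f s * q x\<close> over the triangle
  \<open>x \<le> s\<close>: an integration by parts free of boundary terms. \<open>f\<close> itself
  may fail to be integrable near 0; finite are its tails and, by the hypothesis \<open>fq\<close>,
  the absolute double integral.\<close>

lemma Fubini_triangle:
  assumes f: "f \<in> borel_measurable M01" and q: "integrable M01 q"
    and fx: "\<And>x. x \<in> {0<..<1} \<Longrightarrow> integrable M01 (\<lambda>t. indicator {x..1} t * f t)"
    and fq: "integrable M01 (\<lambda>s. \<bar>f s\<bar> * integral_from_0 (\<lambda>t. \<bar>q t\<bar>) s)"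
  shows "integrable M01 (\<lambda>x. integral_to_1 f x * q x)"
    and "(\<integral>x. integral_to_1 f x * q x \<partial>M01) = (\<integral>s. f s * integral_from_0 q s \<partial>M01)"
proof -
  interpret M: finite_measure M01 by (rule finite_measure_M01)
  interpret pair_sigma_finite M01 M01 ..
  have qm: "q \<in> borel_measurable M01" using q by auto
  have idm: "(\<lambda>x. x) \<in> borel_measurable M01" by (rule borel_measurable_M01I) auto
  define F where "F s x = (if x \<le> s then f s * q x else 0)" for s x
  have Fm: "case_prod F \<in> borel_measurable (M01 \<Otimes>\<^sub>M M01)"
  proof -
    have [measurable]: "fst \<in> borel_measurable (M01 \<Otimes>\<^sub>M M01)" "snd \<in> borel_measurable (M01 \<Otimes>\<^sub>M M01)"
      using measurable_compose[OF measurable_fst idm] measurable_compose[OF measurable_snd idm] by auto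
    have [measurable]: "(\<lambda>p. f (fst p)) \<in> borel_measurable (M01 \<Otimes>\<^sub>M M01)"
      "(\<lambda>p. q (snd p)) \<in> borel_measurable (M01 \<Otimes>\<^sub>M M01)"
      using measurable_compose[OF measurable_fst f] measurable_compose[OF measurable_snd qm] by auto
    show ?thesis unfolding F_def case_prod_beta' by measurable
  qed
  have Fx: "F s x = f s * (indicator {0..s} x * q x)" if "x \<in> space M01" for s x
    using that by (auto simp: F_def)
  have Fs: "F s x = q x * (indicator {x..1} s * f s)" if "s \<in> space M01" for s x
    using that by (auto simp: F_def)
  have I: "integrable (M01 \<Otimes>\<^sub>M M01) (case_prod F)"
  proof (rule Fubini_integrable[OF Fm])
    have *: "(\<integral>x. norm (F s x) \<partial>M01) = \<bar>f s\<bar> * integral_from_0 (\<lambda>t. \<bar>q t\<bar>) s"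
      if "s \<in> space M01" for s
    proof -
      have "(\<integral>x. norm (F s x) \<partial>M01) = (\<integral>x. \<bar>f s\<bar> * (indicator {0..s} x * \<bar>q x\<bar>) \<partial>M01)"
        by (rule Bochner_Integration.integral_cong) (auto simp: F_def abs_mult)
      then show ?thesis using that q by (simp add: integral_from_0_eq)
    qed
    have "integrable M01 (\<lambda>s. \<integral>x. norm (case_prod F (s, x)) \<partial>M01)
        \<longleftrightarrow> integrable M01 (\<lambda>s. \<bar>f s\<bar> * integral_from_0 (\<lambda>t. \<bar>q t\<bar>) s)"
      by (rule Bochner_Integration.integrable_cong[OF refl]) (unfold prod.case, rule *)
    then show "integrable M01 (\<lambda>s. \<integral>x. norm (case_prod F (s, x)) \<partial>M01)"
      using fq by blast
    have "integrable M01 (F s)" for s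
    proof -
      have "integrable M01 (F s) \<longleftrightarrow> integrable M01 (\<lambda>x. f s * (indicator {0..s} x * q x))"
        by (rule Bochner_Integration.integrable_cong[OF refl]) (rule Fx)
      then show ?thesis using integrable_indicator_M01[OF q, of 0 s] by simp
    qed
    then show "AE s in M01. integrable M01 (\<lambda>x. case_prod F (s, x))" by simp
  qed
  have 1: "(\<integral>s. F s x \<partial>M01) = integral_to_1 f x * q x" if "x \<in> space M01" for x
  proof -
    have "(\<integral>s. F s x \<partial>M01) = (\<integral>s. q x * (indicator {x..1} s * f s) \<partial>M01)"
      by (rule Bochner_Integration.integral_cong) (simp_all add: Fs)
    also have "\<dots> = q x * integral {x..1} f"
      using that fx[of x] integral_indicator_M01[OF fx[of x]] by simp
    finally show ?thesis by (simp add: integral_to_1_def mult.commute)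
  qed
  have 2: "(\<integral>x. F s x \<partial>M01) = f s * integral_from_0 q s" if "s \<in> space M01" for s
  proof -
    have "(\<integral>x. F s x \<partial>M01) = (\<integral>x. f s * (indicator {0..s} x * q x) \<partial>M01)"
      by (rule Bochner_Integration.integral_cong) (simp_all add: Fx)
    then show ?thesis using that q by (simp add: integral_from_0_eq)
  qed
  show "integrable M01 (\<lambda>x. integral_to_1 f x * q x)"
  proof -
    have "integrable M01 (\<lambda>x. \<integral>s. F s x \<partial>M01) \<longleftrightarrow> integrable M01 (\<lambda>x. integral_to_1 f x * q x)"
      by (rule Bochner_Integration.integrable_cong[OF refl]) (rule 1)
    then show ?thesis using integrable_snd[OF I] by blast
  qed
  have "(\<integral>x. integral_to_1 f x * q x \<partial>M01) = (\<integral>x. (\<integral>s. F s x \<partial>M01) \<partial>M01)"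
    by (rule Bochner_Integration.integral_cong) (simp_all add: 1)
  also have "\<dots> = (\<integral>s. (\<integral>x. F s x \<partial>M01) \<partial>M01)" by (rule Fubini_integral[OF I])
  also have "\<dots> = (\<integral>s. f s * integral_from_0 q s \<partial>M01)"
    by (rule Bochner_Integration.integral_cong) (simp_all add: 2)
  finally show "(\<integral>x. integral_to_1 f x * q x \<partial>M01) = (\<integral>s. f s * integral_from_0 q s \<partial>M01)" .
qed

section \<open>The spaces H2 and H20\<close>

lemma H2_weak_deriv:
  assumes "u \<in> H2" "k \<in> {1, 2}"
  shows "has_weak_deriv k u (weak_deriv k u)" "weak_deriv k u \<in> L2 {0<..<1}"
proof -
  obtain w where w: "w \<in> L2 {0<..<1}" "has_weak_deriv k u w"
    using assms unfolding H2_def by blast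
  show *: "has_weak_deriv k u (weak_deriv k u)" by (rule has_weak_deriv_weak_deriv[OF w(2)])
  then have "weak_deriv k u \<in> borel_measurable M01"
    by (auto simp: has_weak_deriv_def intro: locally_integrable_measurable)
  then show "weak_deriv k u \<in> L2 {0<..<1}"
    using weak_deriv_AE_eq[OF w(2)] by (intro L2_cong_AE[OF w(1)]) (auto elim!: eventually_mono)
qed

lemma H2_L2: "u \<in> H2 \<Longrightarrow> u \<in> L2 {0<..<1}"
  by (simp add: H2_def)

lemma H2_lincomb:
  assumes "u \<in> H2" "v \<in> H2" shows "(\<lambda>x. c * u x + d * v x) \<in> H2"
  unfolding H2_def
proof (intro CollectI conjI ballI L2_lincomb H2_L2 assms)
  fix k :: nat assume k: "k \<in> {1, 2}"
  show "\<exists>w\<in>L2 {0<..<1}. has_weak_deriv k (\<lambda>x. c * u x + d * v x) w"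
    using H2_weak_deriv[OF assms(1) k] H2_weak_deriv[OF assms(2) k]
    by (intro bexI[of _ "\<lambda>x. c * weak_deriv k u x + d * weak_deriv k v x"] has_weak_deriv_lincomb L2_lincomb)
qed

lemma test_function_H2: "test_function \<phi> \<Longrightarrow> \<phi> \<in> H2"
  unfolding H2_def
  using has_weak_deriv_test_function test_function_L2 test_function_funpow_deriv by blast

lemma weak_deriv_lincomb_AE:
  "has_weak_deriv k u w \<Longrightarrow> has_weak_deriv k v w' \<Longrightarrow>
    AE x in M01. weak_deriv k (\<lambda>x. c * u x + d * v x) x = c * w x + d * w' x"
  by (rule weak_deriv_AE_eq[OF has_weak_deriv_lincomb])

lemma H2_norm_tendsto_0_iff:
  "(\<lambda>n. H2_norm (f n)) \<longlonglongrightarrow> 0 \<longleftrightarrow>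
    (\<lambda>n. \<integral>x. (f n x)\<^sup>2 \<partial>M01) \<longlonglongrightarrow> 0 \<and> (\<forall>k\<in>{1,2}. (\<lambda>n. \<integral>x. (weak_deriv k (f n) x)\<^sup>2 \<partial>M01) \<longlonglongrightarrow> 0)"
proof -
  let ?S = "\<lambda>n. (\<integral>x. (f n x)\<^sup>2 \<partial>M01) + (\<integral>x. (weak_deriv 1 (f n) x)\<^sup>2 \<partial>M01)
     + (\<integral>x. (weak_deriv 2 (f n) x)\<^sup>2 \<partial>M01)"
  have "(\<lambda>n. H2_norm (f n)) \<longlonglongrightarrow> 0 \<longleftrightarrow> ?S \<longlonglongrightarrow> 0"
  proof
    assume "(\<lambda>n. H2_norm (f n)) \<longlonglongrightarrow> 0"
    from tendsto_power[OF this, of 2] show "?S \<longlonglongrightarrow> 0" by (simp add: H2_norm_def)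
  next
    assume "?S \<longlonglongrightarrow> 0"
    from tendsto_real_sqrt[OF this] show "(\<lambda>n. H2_norm (f n)) \<longlonglongrightarrow> 0" by (simp add: H2_norm_def)
  qed
  also have "?S \<longlonglongrightarrow> 0 \<longleftrightarrow>
    (\<lambda>n. \<integral>x. (f n x)\<^sup>2 \<partial>M01) \<longlonglongrightarrow> 0 \<and> (\<forall>k\<in>{1,2}. (\<lambda>n. \<integral>x. (weak_deriv k (f n) x)\<^sup>2 \<partial>M01) \<longlonglongrightarrow> 0)"
  proof
    assume S: "?S \<longlonglongrightarrow> 0"
    have "(\<lambda>n. \<integral>x. (f n x)\<^sup>2 \<partial>M01) \<longlonglongrightarrow> 0"
      by (rule tendsto_sandwich[OF _ _ tendsto_const S]) (auto intro!: always_eventually add_nonneg_nonneg)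
    moreover have "(\<lambda>n. \<integral>x. (weak_deriv 1 (f n) x)\<^sup>2 \<partial>M01) \<longlonglongrightarrow> 0"
      by (rule tendsto_sandwich[OF _ _ tendsto_const S]) (auto intro!: always_eventually add_nonneg_nonneg)
    moreover have "(\<lambda>n. \<integral>x. (weak_deriv 2 (f n) x)\<^sup>2 \<partial>M01) \<longlonglongrightarrow> 0"
      by (rule tendsto_sandwich[OF _ _ tendsto_const S]) (auto intro!: always_eventually add_nonneg_nonneg)
    ultimately show "(\<lambda>n. \<integral>x. (f n x)\<^sup>2 \<partial>M01) \<longlonglongrightarrow> 0 \<and>
      (\<forall>k\<in>{1,2}. (\<lambda>n. \<integral>x. (weak_deriv k (f n) x)\<^sup>2 \<partial>M01) \<longlonglongrightarrow> 0)" by auto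
  next
    assume "(\<lambda>n. \<integral>x. (f n x)\<^sup>2 \<partial>M01) \<longlonglongrightarrow> 0 \<and>
      (\<forall>k\<in>{1,2}. (\<lambda>n. \<integral>x. (weak_deriv k (f n) x)\<^sup>2 \<partial>M01) \<longlonglongrightarrow> 0)"
    then have "?S \<longlonglongrightarrow> 0 + 0 + 0" by (intro tendsto_add) auto
    then show "?S \<longlonglongrightarrow> 0" by simp
  qed
  finally show ?thesis .
qed

lemma weak_deriv_diff_test_function_AE:
  assumes "u \<in> H2" "test_function \<phi>" "k \<in> {1, 2}"
  shows "AE x in M01. weak_deriv k (\<lambda>x. u x - \<phi> x) x = weak_deriv k u x - (deriv ^^ k) \<phi> x"
  using weak_deriv_lincomb_AE[OF H2_weak_deriv(1)[OF assms(1,3)] has_weak_deriv_test_function[OF assms(2)],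
      of 1 "-1"] by simp

lemma integral_weak_deriv_diff_test_function:
  assumes "u \<in> H2" "test_function \<phi>" "k \<in> {1, 2}"
  shows "(\<integral>x. (weak_deriv k (\<lambda>x. u x - \<phi> x) x)\<^sup>2 \<partial>M01) = (\<integral>x. (weak_deriv k u x - (deriv ^^ k) \<phi> x)\<^sup>2 \<partial>M01)"
proof (rule integral_cong_AE)
  have "(\<lambda>x. 1 * u x + (-1) * \<phi> x) \<in> H2" by (intro H2_lincomb assms test_function_H2)
  then have "weak_deriv k (\<lambda>x. u x - \<phi> x) \<in> L2 {0<..<1}"
    using H2_weak_deriv(2)[OF _ assms(3)] by simp
  then show "(\<lambda>x. (weak_deriv k (\<lambda>x. u x - \<phi> x) x)\<^sup>2) \<in> borel_measurable M01" by (auto simp: L2_def)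
  have "(\<lambda>x. weak_deriv k u x - (deriv ^^ k) \<phi> x) \<in> L2 {0<..<1}"
    by (intro L2_diff H2_weak_deriv test_function_L2 test_function_funpow_deriv assms)
  then show "(\<lambda>x. (weak_deriv k u x - (deriv ^^ k) \<phi> x)\<^sup>2) \<in> borel_measurable M01" by (auto simp: L2_def)
qed (use weak_deriv_diff_test_function_AE[OF assms] in \<open>auto elim!: eventually_mono\<close>)

text \<open>Replaces the \<open>H2_norm\<close> of a difference by three separate limits, in which
  the approximants contribute classical derivatives.\<close>

lemma H20_iff:
  "u \<in> H20 \<longleftrightarrow> u \<in> H2 \<and> (\<exists>\<phi>. (\<forall>n::nat. test_function (\<phi> n)) \<and>
     (\<lambda>n. \<integral>x. (u x - \<phi> n x)\<^sup>2 \<partial>M01) \<longlonglongrightarrow> 0 \<and>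
     (\<forall>k\<in>{1,2}. (\<lambda>n. \<integral>x. (weak_deriv k u x - (deriv ^^ k) (\<phi> n) x)\<^sup>2 \<partial>M01) \<longlonglongrightarrow> 0))"
proof -
  have "((\<lambda>n. H2_norm (\<lambda>x. u x - \<phi> n x)) \<longlonglongrightarrow> 0) \<longleftrightarrow>
     (\<lambda>n. \<integral>x. (u x - \<phi> n x)\<^sup>2 \<partial>M01) \<longlonglongrightarrow> 0 \<and>
     (\<forall>k\<in>{1,2}. (\<lambda>n. \<integral>x. (weak_deriv k u x - (deriv ^^ k) (\<phi> n) x)\<^sup>2 \<partial>M01) \<longlonglongrightarrow> 0)"
    if "u \<in> H2" "\<forall>n. test_function (\<phi> n)" for \<phi> :: "nat \<Rightarrow> real \<Rightarrow> real"
  proof -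
    have "(\<integral>x. (weak_deriv k (\<lambda>x. u x - \<phi> n x) x)\<^sup>2 \<partial>M01)
        = (\<integral>x. (weak_deriv k u x - (deriv ^^ k) (\<phi> n) x)\<^sup>2 \<partial>M01)" if k: "k \<in> {1, 2}" for k n
      using integral_weak_deriv_diff_test_function[OF _ _ k] \<open>u \<in> H2\<close> \<open>\<forall>n. test_function (\<phi> n)\<close> by blast
    then show ?thesis unfolding H2_norm_tendsto_0_iff by simp
  qed
  then show ?thesis unfolding H20_def by blast
qed

lemma H20_H2: "u \<in> H20 \<Longrightarrow> u \<in> H2"
  by (simp add: H20_def)

lemma H20_lincomb:
  assumes "u \<in> H20" "v \<in> H20" shows "(\<lambda>x. c * u x + d * v x) \<in> H20"
proof -
  note H2 = assms[THEN H20_H2]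
  obtain \<phi> where \<phi>: "\<And>n::nat. test_function (\<phi> n)" "(\<lambda>n. \<integral>x. (u x - \<phi> n x)\<^sup>2 \<partial>M01) \<longlonglongrightarrow> 0"
     "\<And>k. k\<in>{1,2} \<Longrightarrow> (\<lambda>n. \<integral>x. (weak_deriv k u x - (deriv ^^ k) (\<phi> n) x)\<^sup>2 \<partial>M01) \<longlonglongrightarrow> 0"
    using assms(1) unfolding H20_iff by blast
  obtain \<psi> where \<psi>: "\<And>n::nat. test_function (\<psi> n)" "(\<lambda>n. \<integral>x. (v x - \<psi> n x)\<^sup>2 \<partial>M01) \<longlonglongrightarrow> 0"
     "\<And>k. k\<in>{1,2} \<Longrightarrow> (\<lambda>n. \<integral>x. (weak_deriv k v x - (deriv ^^ k) (\<psi> n) x)\<^sup>2 \<partial>M01) \<longlonglongrightarrow> 0"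
    using assms(2) unfolding H20_iff by blast
  show ?thesis unfolding H20_iff
  proof (intro conjI H2_lincomb H2 exI allI ballI)
    show t: "test_function (\<lambda>x. c * \<phi> n x + d * \<psi> n x)" for n
      by (intro test_function_lincomb \<phi> \<psi>)
    have "(\<lambda>n. \<integral>x. (c * (u x - \<phi> n x) + d * (v x - \<psi> n x))\<^sup>2 \<partial>M01) \<longlonglongrightarrow> 0"
      by (intro L2_lincomb_tendsto_0 L2_diff H2_L2 H2 test_function_L2 \<phi> \<psi>)
    moreover have "c * (u x - \<phi> n x) + d * (v x - \<psi> n x) = c * u x + d * v x - (c * \<phi> n x + d * \<psi> n x)"
      for x n by (simp add: algebra_simps)
    ultimately show "(\<lambda>n. \<integral>x. (c * u x + d * v x - (c * \<phi> n x + d * \<psi> n x))\<^sup>2 \<partial>M01) \<longlonglongrightarrow> 0" by simp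
    fix k :: nat assume k: "k \<in> {1, 2}"
    have lim: "(\<lambda>n. \<integral>x. (c * (weak_deriv k u x - (deriv ^^ k) (\<phi> n) x)
        + d * (weak_deriv k v x - (deriv ^^ k) (\<psi> n) x))\<^sup>2 \<partial>M01) \<longlonglongrightarrow> 0"
      by (intro L2_lincomb_tendsto_0 L2_diff H2_weak_deriv H2 k test_function_L2
          test_function_funpow_deriv \<phi> \<psi>)
    \<comment> \<open>Linearity of the choice \<open>weak_deriv\<close>, and here also of the
      iterated \<open>deriv\<close>, is taken from the uniqueness of weak derivatives. It holds
      almost everywhere, hence the comparison of integrals.\<close>
    have "(\<integral>x. (weak_deriv k (\<lambda>x. c * u x + d * v x) x - (deriv ^^ k) (\<lambda>x. c * \<phi> n x + d * \<psi> n x) x)\<^sup>2 \<partial>M01)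
       = (\<integral>x. (c * (weak_deriv k u x - (deriv ^^ k) (\<phi> n) x)
        + d * (weak_deriv k v x - (deriv ^^ k) (\<psi> n) x))\<^sup>2 \<partial>M01)" for n
    proof (rule integral_cong_AE)
      note L = L2_diff[OF H2_weak_deriv(2)[OF H2_lincomb[OF H2, of c d] k]
          test_function_L2[OF test_function_funpow_deriv[OF t[of n], of k]]]
        L2_lincomb[OF L2_diff[OF H2_weak_deriv(2)[OF H2(1) k] test_function_L2[OF test_function_funpow_deriv[OF \<phi>(1)[of n], of k]]]
           L2_diff[OF H2_weak_deriv(2)[OF H2(2) k] test_function_L2[OF test_function_funpow_deriv[OF \<psi>(1)[of n], of k]]], of c d]
      show "(\<lambda>x. (weak_deriv k (\<lambda>x. c * u x + d * v x) x - (deriv ^^ k) (\<lambda>x. c * \<phi> n x + d * \<psi> n x) x)\<^sup>2) \<in> borel_measurable M01"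
       "(\<lambda>x. (c * (weak_deriv k u x - (deriv ^^ k) (\<phi> n) x)
        + d * (weak_deriv k v x - (deriv ^^ k) (\<psi> n) x))\<^sup>2) \<in> borel_measurable M01"
        using L unfolding L2_def by auto
      show "AE x in M01. (weak_deriv k (\<lambda>x. c * u x + d * v x) x - (deriv ^^ k) (\<lambda>x. c * \<phi> n x + d * \<psi> n x) x)\<^sup>2
        = (c * (weak_deriv k u x - (deriv ^^ k) (\<phi> n) x) + d * (weak_deriv k v x - (deriv ^^ k) (\<psi> n) x))\<^sup>2"
        using weak_deriv_lincomb_AE[OF H2_weak_deriv(1)[OF H2(1) k] H2_weak_deriv(1)[OF H2(2) k], of c d]
          has_weak_deriv_unique[OF has_weak_deriv_test_function[OF t[of n]]
            has_weak_deriv_lincomb[OF has_weak_deriv_test_function[OF \<phi>(1)[of n]]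
              has_weak_deriv_test_function[OF \<psi>(1)[of n]]], of k]
        by eventually_elim (simp add: algebra_simps)
    qed
    then show "(\<lambda>n. \<integral>x. (weak_deriv k (\<lambda>x. c * u x + d * v x) x
        - (deriv ^^ k) (\<lambda>x. c * \<phi> n x + d * \<psi> n x) x)\<^sup>2 \<partial>M01) \<longlonglongrightarrow> 0"
      using lim by simp
  qed
qed

lemma test_function_H20:
  assumes "test_function \<phi>" shows "\<phi> \<in> H20"
  unfolding H20_iff
proof (intro conjI exI[of _ "\<lambda>n. \<phi>"] allI ballI test_function_H2 assms)
  fix k :: nat assume k: "k \<in> {1, 2}"
  have "(\<integral>x. (weak_deriv k \<phi> x - (deriv ^^ k) \<phi> x)\<^sup>2 \<partial>M01) = (\<integral>x. 0 \<partial>M01)"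
  proof (rule integral_cong_AE)
    have "(\<lambda>x. weak_deriv k \<phi> x - (deriv ^^ k) \<phi> x) \<in> L2 {0<..<1}"
      by (intro L2_diff H2_weak_deriv k test_function_H2 test_function_L2 test_function_funpow_deriv assms)
    then show "(\<lambda>x. (weak_deriv k \<phi> x - (deriv ^^ k) \<phi> x)\<^sup>2) \<in> borel_measurable M01"
      by (auto simp: L2_def)
    show "AE x in M01. (weak_deriv k \<phi> x - (deriv ^^ k) \<phi> x)\<^sup>2 = 0"
      using weak_deriv_AE_eq[OF has_weak_deriv_test_function[OF assms, of k]]
      by eventually_elim simp
  qed simp
  then show "(\<lambda>n. \<integral>x. (weak_deriv k \<phi> x - (deriv ^^ k) \<phi> x)\<^sup>2 \<partial>M01) \<longlonglongrightarrow> 0" by simp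
qed simp

lemma test_function_integral_deriv:
  assumes "test_function \<phi>" "0 \<le> x" "x \<le> 1"
  shows "integral_from_0 (deriv \<phi>) x = \<phi> x"
  by (rule integral_from_0_derivative_eq)
     (use assms in \<open>auto intro: test_function_continuous_on test_function_has_real_derivative test_function_outside\<close>)

lemma test_function_integral_deriv_twice:
  assumes "test_function \<phi>" "0 \<le> x" "x \<le> 1"
  shows "integral_from_0 ((deriv ^^ 2) \<phi>) x = deriv \<phi> x"
    "integral_from_0 (integral_from_0 ((deriv ^^ 2) \<phi>)) x = \<phi> x"
proof -
  have *: "integral_from_0 ((deriv ^^ 2) \<phi>) x = deriv \<phi> x" if "0 \<le> x" "x \<le> 1" for x
    using test_function_integral_deriv[OF test_function_deriv[OF assms(1)] that]
    by (simp add: numeral_2_eq_2)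
  then show "integral_from_0 ((deriv ^^ 2) \<phi>) x = deriv \<phi> x" using assms by blast
  have "integral_from_0 (integral_from_0 ((deriv ^^ 2) \<phi>)) x = integral_from_0 (deriv \<phi>) x"
    unfolding integral_from_0_def[of _ x]
    by (rule Henstock_Kurzweil_Integration.integral_cong) (use * assms in auto)
  then show "integral_from_0 (integral_from_0 ((deriv ^^ 2) \<phi>)) x = \<phi> x"
    using test_function_integral_deriv[OF assms] by simp
qed

lemma integral_from_0_twice_diff:
  assumes "f \<in> L2 {0<..<1}" "g \<in> L2 {0<..<1}" "0 \<le> x" "x \<le> 1"
  shows "integral_from_0 (integral_from_0 (\<lambda>t. f t - g t)) x
    = integral_from_0 (integral_from_0 f) x - integral_from_0 (integral_from_0 g) x"
proof -
  have "integral_from_0 (integral_from_0 (\<lambda>t. f t - g t)) x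
      = integral_from_0 (\<lambda>t. 1 * integral_from_0 f t + (-1) * integral_from_0 g t) x"
    unfolding integral_from_0_def[of _ x]
    using integral_from_0_lincomb[OF L2_integrable_M01[OF assms(1)] L2_integrable_M01[OF assms(2)], of _ 1 "-1"] assms
    by (intro Henstock_Kurzweil_Integration.integral_cong) auto
  also have "\<dots> = 1 * integral_from_0 (integral_from_0 f) x + (-1) * integral_from_0 (integral_from_0 g) x"
    using assms by (intro integral_from_0_lincomb L2_integrable_M01 integral_from_0_L2) auto
  finally show ?thesis by simp
qed

text \<open>The double primitive of the second derivative is compared with the approximating test
  functions, for which everything is classical. The pointwise bounds for primitives turn mean
  convergence of second derivatives into uniform convergence of values and convergence of the slope
  at 1. So the representation survives the limit, together with \<open>u'(1) = 0\<close> and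
  \<open>u(1) = 0\<close>; the conditions at 0 are built into the primitives.\<close>

lemma H20_D:
  assumes u: "u \<in> H20"
  defines "g \<equiv> weak_deriv 2 u"
  shows "has_weak_deriv 2 u g" "g \<in> L2 {0<..<1}"
    "AE x in M01. u x = integral_from_0 (integral_from_0 g) x"
    "integral_from_0 g 1 = 0" "integral_from_0 (integral_from_0 g) 1 = 0"
proof -
  note H2 = H20_H2[OF u]
  show "has_weak_deriv 2 u g" and g: "g \<in> L2 {0<..<1}"
    unfolding g_def using H2_weak_deriv[OF H2, of 2] by auto
  obtain \<phi> where \<phi>: "\<And>n::nat. test_function (\<phi> n)" "(\<lambda>n. \<integral>x. (u x - \<phi> n x)\<^sup>2 \<partial>M01) \<longlonglongrightarrow> 0"
     "(\<lambda>n. \<integral>x. (g x - (deriv ^^ 2) (\<phi> n) x)\<^sup>2 \<partial>M01) \<longlonglongrightarrow> 0"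
    using u unfolding H20_iff g_def by blast
  have \<phi>2: "(deriv ^^ 2) (\<phi> n) \<in> L2 {0<..<1}" for n
    by (intro test_function_L2 test_function_funpow_deriv \<phi>)
  define N where "N n = (\<integral>x. (g x - (deriv ^^ 2) (\<phi> n) x)\<^sup>2 \<partial>M01)" for n
  have N0: "N \<longlonglongrightarrow> 0" using \<phi>(3) by (simp add: N_def[abs_def])
  have "(integral_from_0 g 1)\<^sup>2 \<le> N n" for n
  proof -
    have "integral_from_0 (\<lambda>t. 1 * g t + (-1) * (deriv ^^ 2) (\<phi> n) t) 1 = integral_from_0 g 1"
      using test_function_integral_deriv_twice(1)[OF \<phi>(1)[of n], of 1]
        test_function_outside[OF test_function_deriv[OF \<phi>(1)[of n]], of 1]
      by (subst integral_from_0_lincomb) (auto intro: L2_integrable_M01 g \<phi>2)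
    then show ?thesis
      using integral_from_0_square_le[OF L2_diff[OF g \<phi>2[of n]], of 1] by (simp add: N_def)
  qed
  then have "(integral_from_0 g 1)\<^sup>2 \<le> 0"
    by (intro LIMSEQ_le_const[OF N0]) auto
  then show "integral_from_0 g 1 = 0" by simp
  have J: "(integral_from_0 (integral_from_0 g) x - \<phi> n x)\<^sup>2 \<le> N n" if "0 \<le> x" "x \<le> 1" for x n
  proof -
    have "(integral_from_0 (integral_from_0 g) x - \<phi> n x)\<^sup>2 \<le> x ^ 3 * N n"
      using integral_from_0_twice_square_le[OF L2_diff[OF g \<phi>2[of n]] that]
      unfolding integral_from_0_twice_diff[OF g \<phi>2 that]
        test_function_integral_deriv_twice(2)[OF \<phi>(1) that] by (simp add: N_def)
    also have "\<dots> \<le> 1 * N n" using that by (intro mult_right_mono) (auto simp: power_le_one N_def)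
    finally show ?thesis by simp
  qed
  have "(integral_from_0 (integral_from_0 g) 1)\<^sup>2 \<le> N n" for n
    using J[of 1 n] test_function_outside[OF \<phi>(1)[of n], of 1] by simp
  then have "(integral_from_0 (integral_from_0 g) 1)\<^sup>2 \<le> 0"
    by (intro LIMSEQ_le_const[OF N0]) auto
  then show "integral_from_0 (integral_from_0 g) 1 = 0" by simp
  let ?v = "integral_from_0 (integral_from_0 g)"
  have v: "?v \<in> L2 {0<..<1}" by (intro integral_from_0_L2 L2_integrable_M01 g)
  have w: "(\<lambda>x. u x - ?v x) \<in> L2 {0<..<1}" by (intro L2_diff H2_L2 H2 v)
  have "(\<lambda>n. \<integral>x. (?v x - \<phi> n x)\<^sup>2 \<partial>M01) \<longlonglongrightarrow> 0"
  proof (rule tendsto_sandwich[OF _ _ tendsto_const N0])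
    have "(\<integral>x. (?v x - \<phi> n x)\<^sup>2 \<partial>M01) \<le> N n" for n
    proof -
      interpret M: finite_measure M01 by (rule finite_measure_M01)
      have "(\<integral>x. (?v x - \<phi> n x)\<^sup>2 \<partial>M01) \<le> (\<integral>x. N n \<partial>M01)"
        using L2_diff[OF v test_function_L2[OF \<phi>(1)[of n]]] J
        by (intro integral_mono) (auto simp: L2_def)
      also have "\<dots> = N n" by (simp add: measure_restrict_space)
      finally show ?thesis .
    qed
    then show "\<forall>\<^sub>F n in sequentially. (\<integral>x. (?v x - \<phi> n x)\<^sup>2 \<partial>M01) \<le> N n" by simp
  qed simp
  from L2_lincomb_tendsto_0[OF L2_diff[OF H2_L2[OF H2] test_function_L2[OF \<phi>(1)]]
      L2_diff[OF v test_function_L2[OF \<phi>(1)]] \<phi>(2) this, of 1 "-1"]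
  have "(\<integral>x. (u x - ?v x)\<^sup>2 \<partial>M01) = 0" by (simp add: LIMSEQ_const_iff)
  then have "AE x in M01. (u x - ?v x)\<^sup>2 = 0"
    using w by (subst (asm) integral_nonneg_eq_0_iff_AE) (auto simp: L2_def)
  then show "AE x in M01. u x = ?v x" by eventually_elim simp
qed

section \<open>Functions with a weighted fourth derivative\<close>

text \<open>The squared norm of \<open>1 / t\<close> on [x, 1] is the price of integrating
  \<open>f\<close> over that interval when only \<open>t * f t\<close> is controlled.\<close>

lemma integral_inverse_square_le:
  assumes "0 < x" "x < 1"
  shows "(\<lambda>t. indicator {x..1} t / t) \<in> L2 {0<..<1}"
    and "(\<integral>t. (indicator {x..1} t / t)\<^sup>2 \<partial>M01) \<le> 1 / x"
proof -
  have m: "(\<lambda>t. indicator {x..1} t / t :: real) \<in> borel_measurable M01"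
    by (rule borel_measurable_M01I) auto
  show L: "(\<lambda>t. indicator {x..1} t / t) \<in> L2 {0<..<1}"
    by (rule bounded_imp_L2[OF m, where B="1 / x"])
       (use assms in \<open>auto simp: indicator_def field_simps\<close>)
  have sq: "(indicator {x..1} t / t)\<^sup>2 = indicator {x..1} t * (1 / t\<^sup>2)" for t :: real
    by (auto simp: indicator_def power_divide)
  have "integrable M01 (\<lambda>t. indicator {x..1} t * (1 / t\<^sup>2))"
    using L unfolding L2_def sq[symmetric] by simp
  then have "(\<integral>t. (indicator {x..1} t / t)\<^sup>2 \<partial>M01) = integral {x..1} (\<lambda>t. 1 / t\<^sup>2)"
    unfolding sq using assms by (intro integral_indicator_M01) auto
  also have "((\<lambda>t. 1 / t\<^sup>2) has_integral (- 1 / 1 - (- 1 / x))) {x..1}"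
    using assms by (intro fundamental_theorem_of_calculus)
      (auto intro!: derivative_eq_intros simp: power2_eq_square
        simp flip: has_real_derivative_iff_has_vector_derivative)
  then have "integral {x..1} (\<lambda>t. 1 / t\<^sup>2) = 1 / x - 1" by (simp add: integral_unique)
  finally show "(\<integral>t. (indicator {x..1} t / t)\<^sup>2 \<partial>M01) \<le> 1 / x" by simp
qed

locale weighted_L2_function =
  fixes f :: "real \<Rightarrow> real"
  assumes f_measurable: "f \<in> borel_measurable M01" and weighted_L2: "(\<lambda>x. x * f x) \<in> L2 {0<..<1}"
begin

definition N where "N = (\<integral>x. (x * f x)\<^sup>2 \<partial>M01)"

lemma N_nonneg: "N \<ge> 0" by (simp add: N_def)

lemma integrable_tail:
  assumes "x \<in> {0<..<1}" shows "integrable M01 (\<lambda>t. indicator {x..1} t * f t)"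
proof -
  have "integrable M01 (\<lambda>t. (indicator {x..1} t / t) * (t * f t)) \<longleftrightarrow> integrable M01 (\<lambda>t. indicator {x..1} t * f t)"
    by (rule Bochner_Integration.integrable_cong) auto
  then show ?thesis
    using L2_mult_integrable[OF integral_inverse_square_le(1) weighted_L2, of x] assms by auto
qed

text \<open>Cauchy-Schwarz for the factorisation of \<open>f\<close> into \<open>1 / t\<close> and
  \<open>t * f t\<close>. The growth x^(-1/2) is mild enough for a second integration down to
  0.\<close>

lemma integral_to_1_square_le:
  assumes "x \<in> {0<..<1}" shows "(integral_to_1 f x)\<^sup>2 \<le> N / x"
proof -
  have "integral_to_1 f x = (\<integral>t. indicator {x..1} t * f t \<partial>M01)"
    unfolding integral_to_1_def using assms
    by (intro integral_indicator_M01[symmetric] integrable_tail) auto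
  also have "\<dots> = (\<integral>t. (indicator {x..1} t / t) * (t * f t) \<partial>M01)"
    by (rule Bochner_Integration.integral_cong) auto
  finally have "(integral_to_1 f x)\<^sup>2 \<le> (\<integral>t. (indicator {x..1} t / t)\<^sup>2 \<partial>M01) * N"
    using L2_Cauchy_Schwarz[OF integral_inverse_square_le(1) weighted_L2, of x] assms by (simp add: N_def)
  also have "\<dots> \<le> 1 / x * N"
    using assms N_nonneg by (intro mult_right_mono integral_inverse_square_le) auto
  finally show ?thesis by simp
qed

lemma continuous_on_integral_to_1: "continuous_on {0<..1} (integral_to_1 f)"
proof -
  have "continuous_on {c..1} (integral_to_1 f)" if c: "c \<in> {0<..<1}" for c
  proof -
    have "integrable M01 (\<lambda>t. if t \<in> {c..1} then f t else 0)"
      using integrable_tail[OF c] Bochner_Integration.integrable_cong[OF refl, of M01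
          "\<lambda>t. indicator {c..1} t * f t" "\<lambda>t. if t \<in> {c..1} then f t else 0"] by auto
    then have "(\<lambda>t. if t \<in> {c..1} then f t else 0) integrable_on {c..1}"
      using c by (intro M01_integrable_on_subinterval) auto
    then have "f integrable_on {c..1}"
      by (rule integrable_eq) auto
    then show ?thesis
      unfolding integral_to_1_def[abs_def] by (rule indefinite_integral_continuous_1')
  qed
  then have "continuous (at x within {0<..1}) (integral_to_1 f)" if "x \<in> {0<..1}" for x
  proof -
    define c where "c = x / 2"
    have c: "c \<in> {0<..<1}" "c < x" using that by (auto simp: c_def)
    have "continuous (at x within {c..1}) (integral_to_1 f)"
      using \<open>\<And>c. c \<in> {0<..<1} \<Longrightarrow> continuous_on {c..1} (integral_to_1 f)\<close>[OF c(1)] that c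
      by (auto simp: continuous_on_eq_continuous_within)
    moreover have "at x within {c..1} = at x within {0<..1}"
      using that c by (intro at_within_nhd[of _ "{c<..}"]) auto
    ultimately show ?thesis by simp
  qed
  then show ?thesis by (simp add: continuous_on_eq_continuous_within)
qed

lemma integral_to_1_measurable: "integral_to_1 f \<in> borel_measurable M01"
  by (rule continuous_imp_measurable_M01[OF continuous_on_subset[OF continuous_on_integral_to_1]]) auto

text \<open>Fubini against the constant 1: the double integral reduces to that of
  \<open>s * \<bar>f s\<bar>\<close>, which the weighted norm controls.\<close>

lemma integrable_integral_to_1: "integrable M01 (integral_to_1 f)"
proof -
  interpret M: finite_measure M01 by (rule finite_measure_M01)
  have "integrable M01 (\<lambda>x. integral_to_1 f x * 1)"
  proof (rule Fubini_triangle(1)[OF f_measurable])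
    have "integrable M01 (\<lambda>x. \<bar>x * f x\<bar>)"
      using L2_integrable_M01[OF weighted_L2] by (rule integrable_abs)
    moreover have "integrable M01 (\<lambda>x. \<bar>x * f x\<bar>)
        \<longleftrightarrow> integrable M01 (\<lambda>s. \<bar>f s\<bar> * integral_from_0 (\<lambda>t. \<bar>1\<bar>) s)"
      by (rule Bochner_Integration.integrable_cong[OF refl]) (simp add: integral_from_0_def abs_mult)
    ultimately show "integrable M01 (\<lambda>s. \<bar>f s\<bar> * integral_from_0 (\<lambda>t. \<bar>1\<bar>) s)" by blast
  qed (use integrable_tail in auto)
  then show ?thesis by simp
qed

lemma continuous_on_integral_to_1_twice: "continuous_on {0..1} (integral_to_1 (integral_to_1 f))"
  unfolding integral_to_1_def[of "integral_to_1 f", abs_def]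
  by (intro indefinite_integral_continuous_1' M01_integrable_on integrable_integral_to_1)

lemma integral_to_1_twice_has_derivative:
  assumes x: "x \<in> {0<..<1}"
  shows "(integral_to_1 (integral_to_1 f) has_real_derivative - integral_to_1 f x) (at x)"
proof -
  define c where "c = x / 2"
  have c: "0 < c" "c < x" using x by (auto simp: c_def)
  have cont: "continuous_on {c..1} (integral_to_1 f)"
    using c by (intro continuous_on_subset[OF continuous_on_integral_to_1]) auto
  have "((\<lambda>u. integral {c..u} (integral_to_1 f)) has_vector_derivative integral_to_1 f x) (at x within {c..1})"
    using x c by (intro integral_has_vector_derivative cont) auto
  moreover have "at x within {c..1} = at x" using x c by (intro at_within_interior) auto
  ultimately have "((\<lambda>u. integral {c..u} (integral_to_1 f)) has_real_derivative integral_to_1 f x) (at x)"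
    by (simp add: has_real_derivative_iff_has_vector_derivative)
  then have D: "((\<lambda>u. integral {c..1} (integral_to_1 f) - integral {c..u} (integral_to_1 f))
      has_real_derivative - integral_to_1 f x) (at x)"
    by (auto intro!: derivative_eq_intros)
  have "\<forall>\<^sub>F u in nhds x. u \<in> {c<..<1}"
    using x c by (intro eventually_nhds_in_open) auto
  then have ev: "\<forall>\<^sub>F u in nhds x. integral {c..1} (integral_to_1 f) - integral {c..u} (integral_to_1 f)
      = integral_to_1 (integral_to_1 f) u"
  proof eventually_elim
    case (elim u)
    have "integral {c..u} (integral_to_1 f) + integral {u..1} (integral_to_1 f) = integral {c..1} (integral_to_1 f)"
      using elim integrable_continuous_real[OF cont]
      by (intro Henstock_Kurzweil_Integration.integral_combine) auto
    then show ?case by (simp add: integral_to_1_def)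
  qed
  show ?thesis by (rule iffD1[OF DERIV_cong_ev[OF refl ev refl] D])
qed

text \<open>Two exchanges of the order of integration, that is, two integrations by parts. Tails
  vanish at 1 and primitives at 0, so no boundary term appears.\<close>

lemma integral_to_1_twice_duality:
  assumes q: "q \<in> L2 {0<..<1}"
  shows "integrable M01 (\<lambda>x. integral_to_1 (integral_to_1 f) x * q x)"
    "integrable M01 (\<lambda>x. f x * integral_from_0 (integral_from_0 q) x)"
    "(\<integral>x. integral_to_1 (integral_to_1 f) x * q x \<partial>M01)
      = (\<integral>x. f x * integral_from_0 (integral_from_0 q) x \<partial>M01)"
proof -
  let ?Q = "\<integral>x. (q x)\<^sup>2 \<partial>M01"
  note qi = L2_integrable_M01[OF q]
  have aq: "(\<lambda>x. \<bar>q x\<bar>) \<in> L2 {0<..<1}" using q by (auto simp: L2_def)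
  have Jq: "integral_from_0 q \<in> L2 {0<..<1}" by (rule integral_from_0_L2[OF qi])
  have Q: "?Q \<ge> 0" by simp
  have absJ: "\<bar>integral_from_0 p s\<bar> \<le> sqrt (s * ?Q)"
    if "p \<in> L2 {0<..<1}" "(\<integral>x. (p x)\<^sup>2 \<partial>M01) = ?Q" "s \<in> {0..1}" for p s
    using integral_from_0_square_le[OF that(1), of s] that by (intro real_le_rsqrt) auto
  \<comment> \<open>The tail is O(s^(-1/2)) and the primitive O(s^(1/2)), so the product is
    bounded.\<close>
  have I1: "integrable M01 (\<lambda>s. \<bar>integral_to_1 f s\<bar> * integral_from_0 (\<lambda>t. \<bar>q t\<bar>) s)"
  proof (rule integrable_M01_bounded[where B="sqrt (N * ?Q)"])
    show "(\<lambda>s. \<bar>integral_to_1 f s\<bar> * integral_from_0 (\<lambda>t. \<bar>q t\<bar>) s) \<in> borel_measurable M01"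
      using integral_to_1_measurable integral_from_0_L2[OF L2_integrable_M01[OF aq]] by (auto simp: L2_def)
    fix s :: real assume s: "s \<in> {0<..<1}"
    have "\<bar>integral_to_1 f s\<bar> \<le> sqrt (N / s)"
      using integral_to_1_square_le[OF s] by (intro real_le_rsqrt) auto
    moreover have "\<bar>integral_from_0 (\<lambda>t. \<bar>q t\<bar>) s\<bar> \<le> sqrt (s * ?Q)"
      using s by (intro absJ aq) auto
    ultimately have "\<bar>\<bar>integral_to_1 f s\<bar> * integral_from_0 (\<lambda>t. \<bar>q t\<bar>) s\<bar> \<le> sqrt (N / s) * sqrt (s * ?Q)"
      unfolding abs_mult by (intro mult_mono) (use s N_nonneg in auto)
    also have "\<dots> = sqrt (N * ?Q)" using s by (simp add: real_sqrt_mult[symmetric] del: real_sqrt_mult)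
    finally show "\<bar>\<bar>integral_to_1 f s\<bar> * integral_from_0 (\<lambda>t. \<bar>q t\<bar>) s\<bar> \<le> sqrt (N * ?Q)" .
  qed
  have i: "integrable M01 (\<lambda>t. indicator {x..1} t * integral_to_1 f t)" for x
    by (rule integrable_indicator_M01[OF integrable_integral_to_1])
  have aJq: "integrable M01 (\<lambda>t. \<bar>integral_from_0 q t\<bar>)"
    by (intro integrable_abs L2_integrable_M01 Jq)
  have JJ_le: "\<bar>integral_from_0 p s\<bar> \<le> sqrt ?Q * s"
    if p: "integrable M01 p" "\<And>t. \<bar>p t\<bar> = \<bar>integral_from_0 q t\<bar>" and s: "s \<in> {0..1}" for p s
  proof (rule integral_from_0_abs_le)
    fix t assume t: "0 \<le> t" "t \<le> s"
    then have "\<bar>integral_from_0 q t\<bar> \<le> sqrt (t * ?Q)" using s by (intro absJ q) auto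
    also have "\<dots> \<le> sqrt ?Q" using t s Q by (intro real_sqrt_le_mono mult_left_le_one_le) auto
    finally show "\<bar>p t\<bar> \<le> sqrt ?Q" using p(2) by simp
  qed (use p s in auto)
  have xf: "integrable M01 (\<lambda>s. sqrt ?Q * (s * f s))" using L2_integrable_M01[OF weighted_L2] by simp
  \<comment> \<open>The double primitive is O(s), the weight with which \<open>f\<close> becomes
    integrable.\<close>
  have I2: "integrable M01 (\<lambda>s. \<bar>f s\<bar> * integral_from_0 (\<lambda>t. \<bar>integral_from_0 q t\<bar>) s)"
  proof (rule Bochner_Integration.integrable_bound[OF xf])
    show "(\<lambda>s. \<bar>f s\<bar> * integral_from_0 (\<lambda>t. \<bar>integral_from_0 q t\<bar>) s) \<in> borel_measurable M01"
      using f_measurable integral_from_0_L2[OF aJq] by (auto simp: L2_def)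
    show "AE s in M01. norm (\<bar>f s\<bar> * integral_from_0 (\<lambda>t. \<bar>integral_from_0 q t\<bar>) s) \<le> norm (sqrt ?Q * (s * f s))"
    proof (rule AE_I2)
      fix s assume "s \<in> space M01"
      then have s: "s \<in> {0..1}" by auto
      have "\<bar>f s\<bar> * \<bar>integral_from_0 (\<lambda>t. \<bar>integral_from_0 q t\<bar>) s\<bar> \<le> \<bar>f s\<bar> * (sqrt ?Q * s)"
        by (intro mult_left_mono JJ_le aJq s) auto
      then show "norm (\<bar>f s\<bar> * integral_from_0 (\<lambda>t. \<bar>integral_from_0 q t\<bar>) s) \<le> norm (sqrt ?Q * (s * f s))"
        using s Q by (simp add: abs_mult mult_ac)
    qed
  qed
  show "integrable M01 (\<lambda>x. integral_to_1 (integral_to_1 f) x * q x)"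
    by (rule Fubini_triangle(1)[OF integral_to_1_measurable qi i I1])
  have "(\<integral>x. integral_to_1 (integral_to_1 f) x * q x \<partial>M01) = (\<integral>x. integral_to_1 f x * integral_from_0 q x \<partial>M01)"
    by (rule Fubini_triangle(2)[OF integral_to_1_measurable qi i I1])
  also have "\<dots> = (\<integral>x. f x * integral_from_0 (integral_from_0 q) x \<partial>M01)"
    by (rule Fubini_triangle(2)[OF f_measurable L2_integrable_M01[OF Jq] integrable_tail I2])
  finally show "(\<integral>x. integral_to_1 (integral_to_1 f) x * q x \<partial>M01)
      = (\<integral>x. f x * integral_from_0 (integral_from_0 q) x \<partial>M01)" .
  show "integrable M01 (\<lambda>x. f x * integral_from_0 (integral_from_0 q) x)"
  proof (rule Bochner_Integration.integrable_bound[OF xf])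
    show "(\<lambda>s. f s * integral_from_0 (integral_from_0 q) s) \<in> borel_measurable M01"
      using f_measurable integral_from_0_L2[OF L2_integrable_M01[OF Jq]] by (auto simp: L2_def)
    show "AE s in M01. norm (f s * integral_from_0 (integral_from_0 q) s) \<le> norm (sqrt ?Q * (s * f s))"
    proof (rule AE_I2)
      fix s assume "s \<in> space M01"
      then have s: "s \<in> {0..1}" by auto
      have "\<bar>f s\<bar> * \<bar>integral_from_0 (integral_from_0 q) s\<bar> \<le> \<bar>f s\<bar> * (sqrt ?Q * s)"
        by (intro mult_left_mono JJ_le L2_integrable_M01 Jq s) auto
      then show "norm (f s * integral_from_0 (integral_from_0 q) s) \<le> norm (sqrt ?Q * (s * f s))"
        using s Q by (simp add: abs_mult mult_ac)
    qed
  qed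
qed

end

section \<open>Orthogonality to affine functions and the representation of u''\<close>

lemma H20_moments:
  assumes "v \<in> H20"
  shows "(\<integral>x. weak_deriv 2 v x \<partial>M01) = 0" "(\<integral>x. x * weak_deriv 2 v x \<partial>M01) = 0"
proof -
  interpret M: finite_measure M01 by (rule finite_measure_M01)
  let ?g = "weak_deriv 2 v"
  note D = H20_D[OF assms]
  note gi = L2_integrable_M01[OF D(2)]
  have "(\<integral>x. ?g x \<partial>M01) = (\<integral>x. indicator {0..1} x * ?g x \<partial>M01)"
    by (rule Bochner_Integration.integral_cong) auto
  then show 1: "(\<integral>x. ?g x \<partial>M01) = 0"
    using integral_from_0_eq[OF gi, of 1] D(4) by simp
  have gL: "(\<lambda>t. \<bar>?g t\<bar>) \<in> L2 {0<..<1}" using D(2) by (auto simp: L2_def)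
  \<comment> \<open>The tail of the constant 1 is \<open>1 - x\<close>, so this identifies the
    integral of \<open>(1 - x) v''\<close> with \<open>v(1) = 0\<close>.\<close>
  have "(\<integral>x. integral_to_1 (\<lambda>_. 1) x * ?g x \<partial>M01) = (\<integral>s. 1 * integral_from_0 ?g s \<partial>M01)"
  proof (rule Fubini_triangle(2)[OF _ gi])
    show "integrable M01 (\<lambda>t. indicator {x..1} t * (1::real))" for x
      by (rule integrable_indicator_M01) simp
    show "integrable M01 (\<lambda>s. \<bar>1\<bar> * integral_from_0 (\<lambda>t. \<bar>?g t\<bar>) s)"
      using L2_integrable_M01[OF integral_from_0_L2[OF L2_integrable_M01[OF gL]]] by simp
  qed simp
  also have "\<dots> = (\<integral>s. indicator {0..1} s * integral_from_0 ?g s \<partial>M01)"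
    by (rule Bochner_Integration.integral_cong) auto
  also have "\<dots> = 0"
    using integral_from_0_eq[OF L2_integrable_M01[OF integral_from_0_L2[OF gi]], of 1] D(5) by simp
  also have "(\<integral>x. integral_to_1 (\<lambda>_. 1) x * ?g x \<partial>M01) = (\<integral>x. ?g x - x * ?g x \<partial>M01)"
    by (rule Bochner_Integration.integral_cong) (auto simp: integral_to_1_def algebra_simps)
  also have "\<dots> = (\<integral>x. ?g x \<partial>M01) - (\<integral>x. x * ?g x \<partial>M01)"
    using gi L2_mult_integrable[OF continuous_L2[of "\<lambda>x. x"] D(2)]
    by (intro Bochner_Integration.integral_diff) auto
  finally show "(\<integral>x. x * ?g x \<partial>M01) = 0" using 1 by simp
qed

text \<open>Clamped conditions at both ends amount to orthogonality of the second derivative to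
  affine functions. This removes the undetermined affine part of \<open>u''\<close> from the
  formulas below.\<close>

lemma H20_affine_orthogonal:
  assumes "v \<in> H20"
  shows "(\<integral>x. (A + B * x) * weak_deriv 2 v x \<partial>M01) = 0"
proof -
  let ?g = "weak_deriv 2 v"
  note D = H20_D[OF assms]
  have "(\<integral>x. (A + B * x) * ?g x \<partial>M01) = (\<integral>x. A * ?g x + B * (x * ?g x) \<partial>M01)"
    by (simp add: algebra_simps)
  also have "\<dots> = A * (\<integral>x. ?g x \<partial>M01) + B * (\<integral>x. x * ?g x \<partial>M01)"
    using L2_integrable_M01[OF D(2)] L2_mult_integrable[OF continuous_L2[of "\<lambda>x. x"] D(2)] by simp
  finally show ?thesis by (simp add: H20_moments[OF assms])
qed


lemma AE_M01_near_1:
  assumes "AE x in M01. P x" "b < 1"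
  obtains x where "x \<in> {b<..<1}" "0 < x" "P x"
proof -
  let ?b = "max b 0"
  have "\<exists>x\<in>{?b<..<1}. P x"
  proof (rule ccontr)
    assume n: "\<not> ?thesis"
    have "AE x in M01. x \<notin> {?b<..<1}"
      using assms(1) by eventually_elim (use n in blast)
    moreover have "{?b<..<1} \<in> sets M01" by (intro sets_M01I) auto
    ultimately have "{?b<..<1} \<in> null_sets M01" by (simp add: AE_iff_null_sets)
    then have "emeasure M01 {?b<..<1} = 0" by auto
    moreover have "emeasure M01 {?b<..<1} = emeasure lebesgue {?b<..<1}"
      by (rule emeasure_restrict_space) auto
    ultimately show False using assms(2) by (simp add: ennreal_eq_0_iff)
  qed
  then show ?thesis using that by auto
qed

text \<open>Two representatives agree almost everywhere, hence at points arbitrarily close to 1.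
  This makes \<open>second_deriv_at_1\<close> well defined.\<close>

lemma weak_deriv_left_limit_unique:
  assumes "has_weak_deriv n u w" "(w \<longlongrightarrow> c) (at_left 1)" "has_weak_deriv n u w'" "(w' \<longlongrightarrow> c') (at_left 1)"
  shows "c = c'"
proof (rule ccontr)
  assume "c \<noteq> c'"
  moreover have "((\<lambda>x. w x - w' x) \<longlongrightarrow> c - c') (at_left 1)" by (intro tendsto_diff assms)
  ultimately have "\<forall>\<^sub>F x in at_left 1. w x - w' x \<noteq> 0"
    by (intro tendsto_imp_eventually_ne) auto
  then obtain b where b: "b < 1" "\<And>x. b < x \<Longrightarrow> x < 1 \<Longrightarrow> w x - w' x \<noteq> 0"
    unfolding eventually_at_left_field by blast
  obtain x where "x \<in> {b<..<1}" "w x = w' x"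
    using AE_M01_near_1[OF has_weak_deriv_unique[OF assms(1,3)] b(1)] by blast
  then show False using b(2)[of x] by auto
qed

lemma second_deriv_at_1_eq:
  assumes "has_weak_deriv 2 u w" "(w \<longlongrightarrow> c) (at_left 1)"
  shows "second_deriv_at_1 u = c"
  unfolding second_deriv_at_1_def
  using assms weak_deriv_left_limit_unique by (intro the_equality) blast+

text \<open>Tested against second derivatives of test functions, \<open>u''\<close> and the twofold
  tail of \<open>w\<close> agree by duality, so the du Bois-Reymond lemma makes their difference
  affine.\<close>

lemma fourth_weak_deriv_representation:
  assumes u: "u \<in> H20" and w: "has_weak_deriv 4 u w" and xw: "(\<lambda>x. x * w x) \<in> L2 {0<..<1}"
  obtains A B where
    "AE x in M01. weak_deriv 2 u x = A + B * x + integral_to_1 (integral_to_1 w) x"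
proof -
  interpret weighted_L2_function w
    by unfold_locales (use w xw in \<open>auto simp: has_weak_deriv_def locally_integrable_measurable\<close>)
  note D = H20_D[OF u]
  have i: "locally_integrable (weak_deriv 2 u)" "locally_integrable (integral_to_1 (integral_to_1 w))"
    by (intro integrable_M01_imp_locally_integrable L2_integrable_M01 D(2)
        continuous_L2[OF continuous_on_integral_to_1_twice])+
  have "(\<integral>x. (1 * weak_deriv 2 u x + (-1) * integral_to_1 (integral_to_1 w) x) * (deriv ^^ 2) \<phi> x \<partial>M01) = 0"
    if \<phi>: "test_function \<phi>" for \<phi>
  proof -
    note \<phi>2 = test_function_funpow_deriv[OF \<phi>, of 2]
    have "(\<integral>x. integral_to_1 (integral_to_1 w) x * (deriv ^^ 2) \<phi> x \<partial>M01)
        = (\<integral>x. w x * integral_from_0 (integral_from_0 ((deriv ^^ 2) \<phi>)) x \<partial>M01)"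
      by (rule integral_to_1_twice_duality(3)[OF test_function_L2[OF \<phi>2]])
    also have "\<dots> = (\<integral>x. w x * \<phi> x \<partial>M01)"
      by (rule Bochner_Integration.integral_cong) (auto simp: test_function_integral_deriv_twice[OF \<phi>])
    also have "\<dots> = (\<integral>x. u x * (deriv ^^ 4) \<phi> x \<partial>M01)"
      using has_weak_deriv_integral[OF w \<phi>] by simp
    also have "(deriv ^^ 4) \<phi> = (deriv ^^ 2) ((deriv ^^ 2) \<phi>)"
      by (simp add: numeral_eq_Suc)
    also have "(\<integral>x. u x * (deriv ^^ 2) ((deriv ^^ 2) \<phi>) x \<partial>M01) = (\<integral>x. weak_deriv 2 u x * (deriv ^^ 2) \<phi> x \<partial>M01)"
      using has_weak_deriv_integral[OF D(1) \<phi>2] by simp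
    finally show ?thesis
      using i[THEN locally_integrable_times_test_function[OF _ \<phi>2]] by (simp add: left_diff_distrib)
  qed
  then obtain A B where "AE x in M01. 1 * weak_deriv 2 u x + (-1) * integral_to_1 (integral_to_1 w) x = A + B * x"
    using du_Bois_Reymond_second_order[OF locally_integrable_lincomb[OF i, of 1 "-1"]] by metis
  then show ?thesis by (intro that[of A B]) (auto elim!: eventually_mono)
qed

section \<open>Integration by parts for the fourth derivative\<close>

locale fourth_derivative =
  fixes u w :: "real \<Rightarrow> real" and A B :: real
  assumes u: "u \<in> H20" and w: "has_weak_deriv 4 u w" and xw: "(\<lambda>x. x * w x) \<in> L2 {0<..<1}"
    and rep: "AE x in M01. weak_deriv 2 u x = A + B * x + integral_to_1 (integral_to_1 w) x"
begin

sublocale weighted_L2_function w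
  by unfold_locales (use w xw in \<open>auto simp: has_weak_deriv_def locally_integrable_measurable\<close>)

text \<open>The continuous representative of \<open>u''\<close>. The tails vanish at 1, so its value
  there is \<open>A + B\<close> and \<open>G'\<close> takes the value \<open>B\<close>.\<close>

definition G where "G x = A + B * x + integral_to_1 (integral_to_1 w) x"

definition G' where "G' x = B - integral_to_1 w x"

lemma G_1: "G 1 = A + B" by (simp add: G_def)

lemma AE_G: "AE x in M01. weak_deriv 2 u x = G x"
  using rep by (simp add: G_def)

lemma continuous_on_G: "continuous_on {0..1} G"
  unfolding G_def[abs_def] by (intro continuous_intros continuous_on_integral_to_1_twice)

lemma G_has_derivative: "x \<in> {0<..<1} \<Longrightarrow> (G has_real_derivative G' x) (at x)"
  unfolding G_def[abs_def] G'_def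
  by (auto intro!: derivative_eq_intros integral_to_1_twice_has_derivative)

lemma G_L2: "G \<in> L2 {0<..<1}" by (rule continuous_L2[OF continuous_on_G])

lemma has_weak_deriv_G: "has_weak_deriv 2 u G"
  using AE_G H20_D(1)[OF u]
  by (intro has_weak_deriv_cong_AE[OF H20_D(1)[OF u]] integrable_M01_imp_locally_integrable
      L2_integrable_M01 G_L2 H2_L2 H20_H2 u) auto

lemma G_tendsto: "(G \<longlongrightarrow> G 1) (at_left 1)"
proof -
  have "(G \<longlongrightarrow> G 1) (at 1 within {0..1})"
    using continuous_on_G by (auto simp: continuous_on_def)
  then show ?thesis by (simp add: at_within_Icc_at_left)
qed

lemma second_deriv_at_1_eq_G: "second_deriv_at_1 u = G 1"
  by (rule second_deriv_at_1_eq[OF has_weak_deriv_G G_tendsto])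

text \<open>Let \<open>p\<close> be the double primitive of \<open>q\<close>. The integral of the
  affine part against \<open>q\<close> is then \<open>G(1) p'(1) - G'(1) p(1)\<close>: the boundary
  terms of the twofold integration by parts all sit at 1 and enter in this integrated form.\<close>

lemma duality:
  assumes q: "q \<in> L2 {0<..<1}"
  shows "(\<integral>x. w x * integral_from_0 (integral_from_0 q) x \<partial>M01)
    = (\<integral>x. G x * q x \<partial>M01) - (\<integral>x. (A + B * x) * q x \<partial>M01)"
proof -
  have "(\<integral>x. G x * q x \<partial>M01) - (\<integral>x. (A + B * x) * q x \<partial>M01) = (\<integral>x. G x * q x - (A + B * x) * q x \<partial>M01)"
    by (intro Bochner_Integration.integral_diff[symmetric] L2_mult_integrable q G_L2 continuous_L2 continuous_intros)
  also have "\<dots> = (\<integral>x. integral_to_1 (integral_to_1 w) x * q x \<partial>M01)"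
    by (rule Bochner_Integration.integral_cong) (auto simp: G_def algebra_simps)
  finally show ?thesis using integral_to_1_twice_duality(3)[OF q] by simp
qed

text \<open>In the duality the double primitive is \<open>v\<close> itself, which is clamped at 1,
  so orthogonality cancels the affine term.\<close>

lemma Green_formula:
  assumes v: "v \<in> H20"
  shows "(\<integral>x. w x * v x \<partial>M01) = (\<integral>x. weak_deriv 2 u x * weak_deriv 2 v x \<partial>M01)"
proof -
  note D = H20_D[OF v]
  let ?v = "integral_from_0 (integral_from_0 (weak_deriv 2 v))"
  have vm: "v \<in> borel_measurable M01" "?v \<in> borel_measurable M01"
    using H2_L2[OF H20_H2[OF v]] integral_from_0_L2[OF L2_integrable_M01[OF integral_from_0_L2[OF L2_integrable_M01[OF D(2)]]]]
    by (auto simp: L2_def)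
  have "(\<integral>x. w x * v x \<partial>M01) = (\<integral>x. w x * ?v x \<partial>M01)"
    using D(3) vm f_measurable by (intro integral_cong_AE) (auto elim!: eventually_mono)
  also have "\<dots> = (\<integral>x. G x * weak_deriv 2 v x \<partial>M01)"
    unfolding duality[OF D(2)] by (simp add: H20_affine_orthogonal[OF v])
  also have "\<dots> = (\<integral>x. weak_deriv 2 u x * weak_deriv 2 v x \<partial>M01)"
    using AE_G D(2) H20_D(2)[OF u] G_L2
    by (intro integral_cong_AE) (auto simp: L2_def elim!: eventually_mono)
  finally show ?thesis .
qed

lemma moments_G: "(\<integral>x. (C + E * x) * G x \<partial>M01) = 0"
proof -
  have "(\<integral>x. (C + E * x) * G x \<partial>M01) = (\<integral>x. (C + E * x) * weak_deriv 2 u x \<partial>M01)"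
    using AE_G H20_D(2)[OF u] G_L2 borel_measurable_M01I[of "\<lambda>x. C + E * x"]
    by (intro integral_cong_AE) (auto simp: L2_def elim!: eventually_mono)
  then show ?thesis by (simp add: H20_affine_orthogonal[OF u])
qed

text \<open>The cubic has an affine second derivative \<open>q\<close>. Hence the integral of
  \<open>G q\<close> vanishes by \<open>moments_G\<close>, and of the duality only the boundary term
  is left.\<close>

lemma trace_formula: "second_deriv_at_1 u = (\<integral>x. w x * (x\<^sup>2 - x ^ 3) \<partial>M01)"
proof -
  interpret M: finite_measure M01 by (rule finite_measure_M01)
  define q :: "real \<Rightarrow> real" where "q x = 2 - 6 * x" for x
  have q: "q \<in> L2 {0<..<1}" unfolding q_def by (intro continuous_L2 continuous_intros)
  have J: "integral_from_0 q x = 2 * x - 3 * x\<^sup>2" if "x \<in> {0..1}" for x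
    by (rule integral_from_0_derivative_eq)
       (use that in \<open>auto simp: q_def intro!: continuous_intros derivative_eq_intros\<close>)
  have "integral_from_0 (integral_from_0 q) x = x\<^sup>2 - x ^ 3" if x: "x \<in> {0..1}" for x
    by (rule integral_from_0_derivative_eq)
       (use x J in \<open>auto intro!: continuous_intros derivative_eq_intros simp: power2_eq_square\<close>)
  then have "(\<integral>x. w x * (x\<^sup>2 - x ^ 3) \<partial>M01) = (\<integral>x. w x * integral_from_0 (integral_from_0 q) x \<partial>M01)"
    by (intro Bochner_Integration.integral_cong) auto
  also have "\<dots> = (\<integral>x. (2 + (-6) * x) * G x \<partial>M01) - (\<integral>x. (A + B * x) * q x \<partial>M01)"
    unfolding duality[OF q] by (simp add: q_def mult.commute)
  also have "(\<integral>x. (2 + (-6) * x) * G x \<partial>M01) = 0" by (rule moments_G)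
  also have "(\<integral>x. (A + B * x) * q x \<partial>M01) = - A - B"
  proof (rule integral_M01_eqI)
    show "integrable M01 (\<lambda>x. (A + B * x) * q x)"
      unfolding q_def by (intro L2_integrable_M01 continuous_L2 continuous_intros)
    have "((\<lambda>x. (A + B * x) * q x) has_integral
        ((\<lambda>x. 2 * A * x + (B - 3 * A) * x\<^sup>2 - 2 * B * x ^ 3) 1
          - (\<lambda>x. 2 * A * x + (B - 3 * A) * x\<^sup>2 - 2 * B * x ^ 3) 0)) {0..1}"
      by (rule fundamental_theorem_of_calculus)
         (auto simp: q_def algebra_simps power2_eq_square
           simp flip: has_real_derivative_iff_has_vector_derivative intro!: derivative_eq_intros)
    then show "((\<lambda>x. (A + B * x) * q x) has_integral - A - B) {0..1}" by (simp add: algebra_simps)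
  qed
  finally show ?thesis by (simp add: second_deriv_at_1_eq_G G_1)
qed

text \<open>Duality with \<open>p = x u'\<close>, whose second derivative is
  \<open>q = 2 u'' + x u'''\<close>. Two exact derivatives evaluate the right-hand side: the
  integral of \<open>G q\<close> is 3/2 of that of \<open>G^2\<close> plus
  \<open>G(1)^2 / 2\<close>, and the affine term is \<open>G(1)^2\<close>.\<close>

lemma Pohozaev_identity:
  "(\<integral>x. w x * (x * integral_from_0 (weak_deriv 2 u) x) \<partial>M01)
    = 3 / 2 * (\<integral>x. (weak_deriv 2 u x)\<^sup>2 \<partial>M01) - 1 / 2 * (second_deriv_at_1 u)\<^sup>2"
proof -
  let ?l = "\<lambda>x. A + B * x"
  \<comment> \<open>\<open>u'''\<close> may be unbounded at 0, but the bound
    \<open>sqrt (N / x)\<close> on the tail keeps \<open>x u'''\<close> bounded, so \<open>q\<close>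
    is square integrable.\<close>
  have xG': "x * \<bar>G' x\<bar> \<le> \<bar>B\<bar> + sqrt N" if x: "x \<in> {0<..<1}" for x
  proof -
    have "x * \<bar>integral_to_1 w x\<bar> \<le> x * sqrt (N / x)"
      using integral_to_1_square_le[OF x] x by (intro mult_left_mono real_le_rsqrt) auto
    also have "\<dots> = sqrt x * sqrt x * (sqrt N / sqrt x)" using x by (simp add: real_sqrt_divide)
    also have "\<dots> = sqrt x * sqrt N"
      using x by (subst mult.assoc) (simp del: real_sqrt_mult_self)
    also have "\<dots> \<le> 1 * sqrt N" using x by (intro mult_right_mono) (auto simp: N_nonneg)
    finally have 1: "x * \<bar>integral_to_1 w x\<bar> \<le> sqrt N" by simp
    have "x * \<bar>B\<bar> \<le> 1 * \<bar>B\<bar>" using x by (intro mult_right_mono) auto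
    moreover have "x * \<bar>G' x\<bar> \<le> x * (\<bar>B\<bar> + \<bar>integral_to_1 w x\<bar>)"
      using x unfolding G'_def by (intro mult_left_mono) auto
    ultimately show ?thesis using 1 by (simp add: distrib_left)
  qed
  have xG'm: "(\<lambda>x. x * G' x) \<in> borel_measurable M01"
    unfolding G'_def
    by (intro borel_measurable_times borel_measurable_diff borel_measurable_const
        integral_to_1_measurable borel_measurable_M01I) simp
  have xG'_L2: "(\<lambda>x. x * G' x) \<in> L2 {0<..<1}"
    by (rule bounded_imp_L2[OF xG'm, where B="\<bar>B\<bar> + sqrt N"]) (use xG' in \<open>auto simp: abs_mult\<close>)
  define q where "q x = 2 * G x + 1 * (x * G' x)" for x
  have q: "q \<in> L2 {0<..<1}" unfolding q_def by (intro L2_lincomb G_L2 xG'_L2)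
  have JG: "(integral_from_0 G has_real_derivative G x) (at x)" if "x \<in> {0<..<1}" for x
    by (rule integral_from_0_has_derivative[OF continuous_on_G that])
  have cJG: "continuous_on {0..1} (integral_from_0 G)"
    by (rule continuous_on_integral_from_0[OF L2_integrable_M01[OF G_L2]])
  have J: "integral_from_0 q x = integral_from_0 G x + x * G x" if "x \<in> {0..1}" for x
    by (rule integral_from_0_derivative_eq)
       (use that in \<open>auto simp: q_def intro!: continuous_intros derivative_eq_intros cJG continuous_on_G
         JG G_has_derivative\<close>)
  have JJ: "integral_from_0 (integral_from_0 q) x = x * integral_from_0 G x" if x: "x \<in> {0..1}" for x
    by (rule integral_from_0_derivative_eq)
       (use x J in \<open>auto intro!: continuous_intros derivative_eq_intros cJG JG\<close>)
  have "(\<integral>x. w x * (x * integral_from_0 (weak_deriv 2 u) x) \<partial>M01)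
      = (\<integral>x. w x * integral_from_0 (integral_from_0 q) x \<partial>M01)"
    using JJ integral_from_0_cong_AE[OF L2_integrable_M01[OF H20_D(2)[OF u]] L2_integrable_M01[OF G_L2] AE_G]
    by (intro Bochner_Integration.integral_cong) auto
  also have "\<dots> = (\<integral>x. G x * q x \<partial>M01) - (\<integral>x. ?l x * q x \<partial>M01)" by (rule duality[OF q])
  also have "(\<integral>x. ?l x * q x \<partial>M01) = (G 1)\<^sup>2"
  proof -
    have il: "integrable M01 (\<lambda>x. ?l x * q x)"
      by (intro L2_mult_integrable q continuous_L2 continuous_intros)
    have ix: "integrable M01 (\<lambda>x. (A + 0 * x) * G x)"
      by (intro L2_mult_integrable G_L2 continuous_L2 continuous_intros)
    \<comment> \<open>\<open>l q - A G\<close> is the derivative of \<open>l x G\<close>; the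
      subtracted term integrates to 0 by \<open>moments_G\<close>.\<close>
    have "((\<lambda>x. ?l x * q x - (A + 0 * x) * G x) has_integral (?l 1 * (1 * G 1) - ?l 0 * (0 * G 0))) {0..1}"
      by (rule fundamental_theorem_of_calculus_interior)
         (auto simp: q_def algebra_simps intro!: continuous_intros continuous_on_G derivative_eq_intros G_has_derivative
           simp flip: has_real_derivative_iff_has_vector_derivative)
    then have "(\<integral>x. ?l x * q x - (A + 0 * x) * G x \<partial>M01) = (A + B) * G 1"
      by (intro integral_M01_eqI Bochner_Integration.integrable_diff il ix) simp
    then have "(\<integral>x. ?l x * q x \<partial>M01) - (\<integral>x. (A + 0 * x) * G x \<partial>M01) = (A + B) * G 1"
      using il ix by simp
    then show ?thesis using moments_G[of 1 0] by (simp add: G_1 power2_eq_square)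
  qed
  also have "(\<integral>x. G x * q x \<partial>M01) = 3 / 2 * (\<integral>x. (G x)\<^sup>2 \<partial>M01) + 1 / 2 * (G 1)\<^sup>2"
  proof -
    have iq: "integrable M01 (\<lambda>x. G x * q x)" by (intro L2_mult_integrable q G_L2)
    have iG: "integrable M01 (\<lambda>x. 3 / 2 * (G x)\<^sup>2)" using G_L2 by (auto simp: L2_def)
    \<comment> \<open>The integrand is the derivative of \<open>x G^2 / 2\<close>, which vanishes at
      0.\<close>
    have "((\<lambda>x. G x * q x - 3 / 2 * (G x)\<^sup>2) has_integral (1 / 2 * (1 * (G 1)\<^sup>2) - 1 / 2 * (0 * (G 0)\<^sup>2))) {0..1}"
      by (rule fundamental_theorem_of_calculus_interior)
         (auto simp: q_def algebra_simps power2_eq_square intro!: continuous_intros continuous_on_G derivative_eq_intros G_has_derivative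
           simp flip: has_real_derivative_iff_has_vector_derivative)
    then have "(\<integral>x. G x * q x - 3 / 2 * (G x)\<^sup>2 \<partial>M01) = 1 / 2 * (G 1)\<^sup>2"
      by (intro integral_M01_eqI Bochner_Integration.integrable_diff iq iG) simp
    then show ?thesis using iq iG by simp
  qed
  also have "(\<integral>x. (G x)\<^sup>2 \<partial>M01) = (\<integral>x. (weak_deriv 2 u x)\<^sup>2 \<partial>M01)"
    using AE_G H20_D(2)[OF u] G_L2 by (intro integral_cong_AE) (auto simp: L2_def elim!: eventually_mono)
  finally show ?thesis by (simp add: second_deriv_at_1_eq_G)
qed

end

section \<open>The energy space\<close>

text \<open>What both degeneracy classes provide, with two-sided derivatives in the open interval
  and the supremum turned into a pointwise inequality.\<close>

locale degenerate_coefficient =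
  fixes a :: "real \<Rightarrow> real" and K :: real
  assumes a_continuous: "continuous_on {0..1} a"
    and a_pos: "x \<in> {0<..1} \<Longrightarrow> a x > 0"
    and a_deriv: "x \<in> {0<..<1} \<Longrightarrow> (a has_real_derivative deriv01 a x) (at x)"
    and deriv01_continuous: "continuous_on {0<..<1} (deriv01 a)"
    and a_quotient: "x \<in> {0<..<1} \<Longrightarrow> x * \<bar>deriv01 a x\<bar> \<le> K * a x"
    and K: "0 \<le> K" "K < 2"

lemma degenerate_coefficientI:
  assumes "weakly_degenerate a \<or> strongly_degenerate a"
  shows "degenerate_coefficient a (degeneracy_const a)"
proof
  have C1: "C1_on01 {0<..1} a"
    using assms continuous_on_subset[of "{0..1}" "deriv01 a" "{0<..1}"]
    unfolding weakly_degenerate_def strongly_degenerate_def C1_on01_def by force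
  then have diff: "a differentiable (at x within {0..1})" if "x \<in> {0<..1}" for x
    using that by (auto simp: C1_on01_def)
  show "continuous_on {0..1} a"
    using assms differentiable_imp_continuous_within
    unfolding weakly_degenerate_def strongly_degenerate_def C1_on01_def continuous_on_eq_continuous_within
    by blast
  show pos: "a x > 0" if "x \<in> {0<..1}" for x
    using assms that unfolding weakly_degenerate_def strongly_degenerate_def by blast
  show "(a has_real_derivative deriv01 a x) (at x)" if "x \<in> {0<..<1}" for x
  proof -
    have "(a has_vector_derivative deriv01 a x) (at x within {0..1})"
      using diff[of x] that unfolding deriv01_def by (intro vector_derivative_works[THEN iffD1]) auto
    moreover have "at x within {0..1} = at x" using that by (intro at_within_interior) auto
    ultimately show ?thesis by (simp add: has_real_derivative_iff_has_vector_derivative)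
  qed
  show "continuous_on {0<..<1} (deriv01 a)"
    using C1 unfolding C1_on01_def by (auto intro: continuous_on_subset)
  have bdd: "bdd_above (degeneracy_quotient a ` {0<..1})"
    using assms unfolding weakly_degenerate_def strongly_degenerate_def by (elim disjE conjE)
  show "x * \<bar>deriv01 a x\<bar> \<le> degeneracy_const a * a x" if "x \<in> {0<..<1}" for x
  proof -
    have "degeneracy_quotient a x \<le> degeneracy_const a"
      unfolding degeneracy_const_def using that by (intro cSUP_upper bdd) auto
    then show ?thesis using pos[of x] that by (simp add: degeneracy_quotient_def divide_le_eq)
  qed
  show "0 \<le> degeneracy_const a" "degeneracy_const a < 2"
    using assms unfolding weakly_degenerate_def strongly_degenerate_def by auto
qed

context degenerate_coefficient
begin

lemma a_pos': "x \<in> {0<..<1} \<Longrightarrow> a x > 0"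
  using a_pos by auto

lemma a1_pos: "a 1 > 0" using a_pos by simp

text \<open>\<open>x^2 / a\<close> is nondecreasing on (0, 1], because
  \<open>x a' \<le> K a \<le> 2 a\<close>. The factors \<open>1 / a 1\<close> in the estimates
  originate here.\<close>

lemma square_le_a: assumes "x \<in> {0<..1}" shows "a 1 * x\<^sup>2 \<le> a x"
proof -
  have "(\<lambda>t. t\<^sup>2 / a t) x \<le> (\<lambda>t. t\<^sup>2 / a t) 1"
  proof (rule DERIV_nonneg_imp_increasing_open[where f="\<lambda>t. t\<^sup>2 / a t"])
    fix t assume "x < t" "t < 1"
    then have t: "t \<in> {0<..<1}" using assms by auto
    have "t * deriv01 a t \<le> 2 * a t"
    proof -
      have "t * deriv01 a t \<le> t * \<bar>deriv01 a t\<bar>" using t by (intro mult_left_mono) auto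
      also have "\<dots> \<le> K * a t" by (rule a_quotient[OF t])
      also have "\<dots> \<le> 2 * a t" using K a_pos'[OF t] by (intro mult_right_mono) auto
      finally show ?thesis .
    qed
    then have "0 \<le> t * (2 * a t - t * deriv01 a t) / (a t)\<^sup>2" using t by (intro divide_nonneg_nonneg mult_nonneg_nonneg) auto
    moreover have "((\<lambda>t. t\<^sup>2 / a t) has_real_derivative t * (2 * a t - t * deriv01 a t) / (a t)\<^sup>2) (at t)"
      using a_pos'[OF t] by (auto intro!: derivative_eq_intros a_deriv t simp: power2_eq_square field_simps)
    ultimately show "\<exists>y. ((\<lambda>t. t\<^sup>2 / a t) has_real_derivative y) (at t) \<and> 0 \<le> y" by blast
  next
    show "continuous_on {x..1} (\<lambda>t. t\<^sup>2 / a t)"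
    proof (intro continuous_intros continuous_on_subset[OF a_continuous] ballI)
      fix t assume "t \<in> {x..1}" then show "a t \<noteq> 0" using a_pos[of t] assms by auto
    qed (use assms in auto)
  qed (use assms in auto)
  then show ?thesis using a_pos[OF assms] a1_pos by (simp add: field_simps)
qed

lemma a_measurable: "a \<in> borel_measurable M01"
  by (rule continuous_imp_measurable_M01[OF continuous_on_subset[OF a_continuous]]) auto

text \<open>Multiplication by \<open>a^(-1/2)\<close> is an isometry from the weighted space into
  \<open>L2\<close>, through which the unweighted theory transfers.\<close>

definition wt :: "(real \<Rightarrow> real) \<Rightarrow> real \<Rightarrow> real" where "wt v x = v x / sqrt (a x)"

lemma wt_mult: "x \<in> {0<..<1} \<Longrightarrow> wt u x * wt v x = u x * v x / a x"
  using a_pos'[of x] by (simp add: wt_def)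

lemma wt_square: "x \<in> {0<..<1} \<Longrightarrow> (wt v x)\<^sup>2 = (v x)\<^sup>2 / a x"
  using wt_mult[of x v v] by (simp add: power2_eq_square)

lemma wt_lincomb: "wt (\<lambda>x. c * u x + d * v x) = (\<lambda>x. c * wt u x + d * wt v x)"
  by (auto simp: wt_def add_divide_distrib)

lemma integral_wt_mult: "(\<integral>x. wt u x * wt v x \<partial>M01) = (\<integral>x. u x * v x / a x \<partial>M01)"
  by (rule Bochner_Integration.integral_cong) (auto simp: wt_mult)

lemma integral_wt_square: "(\<integral>x. (wt v x)\<^sup>2 \<partial>M01) = (\<integral>x. (v x)\<^sup>2 / a x \<partial>M01)"
  by (rule Bochner_Integration.integral_cong) (auto simp: wt_square)

text \<open>Boundedness of \<open>a\<close> gives back the square integrability of \<open>v\<close>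
  from that of \<open>wt v\<close>.\<close>

lemma L2_inv_iff: "v \<in> L2_inv a \<longleftrightarrow> v \<in> borel_measurable M01 \<and> wt v \<in> L2 {0<..<1}"
proof
  assume v: "v \<in> L2_inv a"
  then have m: "v \<in> borel_measurable M01" by (auto simp: L2_inv_def L2_def)
  have "integrable M01 (\<lambda>x. (wt v x)\<^sup>2) \<longleftrightarrow> integrable M01 (\<lambda>x. (v x)\<^sup>2 / a x)"
    by (rule Bochner_Integration.integrable_cong) (auto simp: wt_square)
  then show "v \<in> borel_measurable M01 \<and> wt v \<in> L2 {0<..<1}"
    using v m a_measurable by (auto simp: L2_inv_def L2_def wt_def[abs_def])
next
  assume v: "v \<in> borel_measurable M01 \<and> wt v \<in> L2 {0<..<1}"
  have "integrable M01 (\<lambda>x. (wt v x)\<^sup>2) \<longleftrightarrow> integrable M01 (\<lambda>x. (v x)\<^sup>2 / a x)"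
    by (rule Bochner_Integration.integrable_cong) (auto simp: wt_square)
  then have 1: "integrable M01 (\<lambda>x. (v x)\<^sup>2 / a x)" using v by (auto simp: L2_def)
  obtain B where B: "\<And>x. x \<in> {0..1} \<Longrightarrow> \<bar>a x\<bar> \<le> B"
    using continuous_bounded_M01[OF a_continuous] by blast
  have "v \<in> L2 {0<..<1}"
  proof (rule L2_bound)
    show "(\<lambda>x. sqrt B * wt v x + 0 * wt v x) \<in> L2 {0<..<1}" using v by (intro L2_lincomb) auto
    show "AE x in M01. \<bar>v x\<bar> \<le> \<bar>sqrt B * wt v x + 0 * wt v x\<bar>"
    proof (rule AE_I2)
      fix x assume x: "x \<in> space M01"
      then have "\<bar>v x\<bar> = sqrt (a x) * \<bar>wt v x\<bar>" using a_pos'[of x] by (simp add: wt_def)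
      also have "\<dots> \<le> sqrt B * \<bar>wt v x\<bar>" using B[of x] x by (intro mult_right_mono) auto
      also have "\<dots> \<le> \<bar>sqrt B * wt v x + 0 * wt v x\<bar>" by (simp add: abs_mult mult_right_mono)
      finally show "\<bar>v x\<bar> \<le> \<bar>sqrt B * wt v x + 0 * wt v x\<bar>" .
    qed
  qed (use v in auto)
  then show "v \<in> L2_inv a" using 1 by (auto simp: L2_inv_def)
qed

lemma L2_inv_wt: "v \<in> L2_inv a \<Longrightarrow> wt v \<in> L2 {0<..<1}"
  and L2_inv_measurable: "v \<in> L2_inv a \<Longrightarrow> v \<in> borel_measurable M01"
  by (simp_all add: L2_inv_iff)

lemma L2_inv_lincomb:
  "u \<in> L2_inv a \<Longrightarrow> v \<in> L2_inv a \<Longrightarrow> (\<lambda>x. c * u x + d * v x) \<in> L2_inv a"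
  unfolding L2_inv_iff wt_lincomb by (auto intro: L2_lincomb)

lemma L2_inv_cong_AE:
  assumes "u \<in> L2_inv a" "v \<in> borel_measurable M01" "AE x in M01. u x = v x"
  shows "v \<in> L2_inv a"
  unfolding L2_inv_iff
proof (intro conjI assms L2_cong_AE[OF L2_inv_wt[OF assms(1)]])
  show "wt v \<in> borel_measurable M01" using assms a_measurable by (simp add: wt_def[abs_def])
  show "AE x in M01. wt u x = wt v x" using assms(3) by eventually_elim (simp add: wt_def)
qed

lemma L2_inv_mult_integrable:
  assumes "u \<in> L2_inv a" "v \<in> L2_inv a" shows "integrable M01 (\<lambda>x. u x * v x / a x)"
proof -
  have "integrable M01 (\<lambda>x. wt u x * wt v x) \<longleftrightarrow> integrable M01 (\<lambda>x. u x * v x / a x)"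
    by (rule Bochner_Integration.integrable_cong) (auto simp: wt_mult)
  then show ?thesis using L2_mult_integrable[OF L2_inv_wt L2_inv_wt, OF assms] by blast
qed

text \<open>For functions of size O(x) the quotient \<open>p^2 / a\<close> is bounded by
  \<open>square_le_a\<close>, and the bound \<open>C / a 1\<close> is integrated over an interval of
  length 1.\<close>

lemma L2_inv_linear_bound:
  assumes m: "p \<in> borel_measurable M01" and b: "\<And>x. x \<in> {0<..<1} \<Longrightarrow> (p x)\<^sup>2 \<le> C * x\<^sup>2" and "C \<ge> 0"
  shows "p \<in> L2_inv a" "(\<integral>x. (p x)\<^sup>2 / a x \<partial>M01) \<le> C / a 1"
proof -
  interpret M: finite_measure M01 by (rule finite_measure_M01)
  have *: "(p x)\<^sup>2 / a x \<le> C / a 1" if x: "x \<in> {0<..<1}" for x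
  proof -
    have "(p x)\<^sup>2 / a x \<le> C * x\<^sup>2 / a x" using b[OF x] a_pos'[OF x] by (intro divide_right_mono) auto
    also have "\<dots> \<le> C * x\<^sup>2 / (a 1 * x\<^sup>2)"
      using square_le_a[of x] x assms(3) a1_pos a_pos'[OF x] by (intro divide_left_mono mult_pos_pos mult_nonneg_nonneg) auto
    also have "\<dots> = C / a 1" using x by simp
    finally show ?thesis .
  qed
  have wm: "wt p \<in> borel_measurable M01" using m a_measurable by (simp add: wt_def[abs_def])
  have w: "wt p \<in> L2 {0<..<1}"
  proof (rule bounded_imp_L2[OF wm])
    fix x :: real assume x: "x \<in> {0<..<1}"
    show "\<bar>wt p x\<bar> \<le> sqrt (C / a 1)"
      using *[OF x] by (intro real_le_rsqrt) (simp add: wt_square[OF x])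
  qed
  then show p: "p \<in> L2_inv a" using m by (simp add: L2_inv_iff)
  have "(\<integral>x. (p x)\<^sup>2 / a x \<partial>M01) \<le> (\<integral>x. C / a 1 \<partial>M01)"
    using L2_inv_mult_integrable[OF p p] * by (intro integral_mono) (auto simp: power2_eq_square)
  also have "\<dots> = C / a 1" by (simp add: measure_restrict_space)
  finally show "(\<integral>x. (p x)\<^sup>2 / a x \<partial>M01) \<le> C / a 1" .
qed

text \<open>The double primitive decays like x^(3/2), faster than the linear rate that the weight
  tolerates.\<close>

lemma H20_L2_inv:
  assumes "u \<in> H20"
  shows "u \<in> L2_inv a"
proof -
  note D = H20_D[OF assms]
  let ?g = "weak_deriv 2 u"
  let ?v = "integral_from_0 (integral_from_0 ?g)"
  have vm: "?v \<in> borel_measurable M01"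
    using integral_from_0_L2[OF L2_integrable_M01[OF integral_from_0_L2[OF L2_integrable_M01[OF D(2)]]]]
    by (auto simp: L2_def)
  have "?v \<in> L2_inv a"
  proof (rule L2_inv_linear_bound(1)[OF vm])
    fix x :: real assume x: "x \<in> {0<..<1}"
    have "(?v x)\<^sup>2 \<le> x ^ 3 * (\<integral>t. (?g t)\<^sup>2 \<partial>M01)"
      using x by (intro integral_from_0_twice_square_le D) auto
    also have "\<dots> \<le> x\<^sup>2 * (\<integral>t. (?g t)\<^sup>2 \<partial>M01)"
      using x by (intro mult_right_mono power_decreasing) auto
    finally show "(?v x)\<^sup>2 \<le> (\<integral>t. (?g t)\<^sup>2 \<partial>M01) * x\<^sup>2" by (simp add: mult.commute)
  qed simp
  then show ?thesis
    by (rule L2_inv_cong_AE) (use D(3) H2_L2[OF H20_H2[OF assms]] in \<open>auto simp: L2_def elim!: eventually_mono\<close>)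
qed

lemma H2_inv_eq_H20: "H2_inv a = H20"
  using H20_L2_inv by (auto simp: H2_inv_def)

lemma H0_iff: "U \<in> H0 a \<longleftrightarrow> fst U \<in> H20 \<and> snd U \<in> L2_inv a"
  by (cases U) (simp add: H0_def H2_inv_eq_H20)

lemma lincomb_H0: "U \<in> H0 a \<Longrightarrow> V \<in> H0 a \<Longrightarrow> lincomb c U d V \<in> H0 a"
  unfolding H0_iff lincomb_def by (simp add: H20_lincomb L2_inv_lincomb)

section \<open>The energy inner product and bounded forms\<close>

definition ip :: "state \<Rightarrow> state \<Rightarrow> real" where
  "ip U V = (\<integral>x. weak_deriv 2 (fst U) x * weak_deriv 2 (fst V) x \<partial>M01) + (\<integral>x. snd U x * snd V x / a x \<partial>M01)"

lemma H0_norm_eq: "H0_norm a U = sqrt (ip U U)"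
  by (simp add: H0_norm_def ip_def power2_eq_square)

lemma ip_commute: "ip U V = ip V U"
  by (simp add: ip_def mult.commute)

lemma H20_lincomb_weak_deriv_AE:
  "u \<in> H20 \<Longrightarrow> v \<in> H20 \<Longrightarrow>
    AE x in M01. weak_deriv 2 (\<lambda>x. c * u x + d * v x) x = c * weak_deriv 2 u x + d * weak_deriv 2 v x"
  by (intro weak_deriv_lincomb_AE H20_D)

lemma integral_weak_deriv_lincomb:
  assumes "u \<in> H20" "v \<in> H20" "h \<in> L2 {0<..<1}"
  shows "(\<integral>x. weak_deriv 2 (\<lambda>x. c * u x + d * v x) x * h x \<partial>M01)
    = c * (\<integral>x. weak_deriv 2 u x * h x \<partial>M01) + d * (\<integral>x. weak_deriv 2 v x * h x \<partial>M01)"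
proof -
  note D = assms(1,2)[THEN H20_D(2)] H20_D(2)[OF H20_lincomb[OF assms(1,2), of c d]]
  have "(\<integral>x. weak_deriv 2 (\<lambda>x. c * u x + d * v x) x * h x \<partial>M01)
      = (\<integral>x. c * (weak_deriv 2 u x * h x) + d * (weak_deriv 2 v x * h x) \<partial>M01)"
  proof (rule integral_cong_AE)
    show "AE x in M01. weak_deriv 2 (\<lambda>x. c * u x + d * v x) x * h x
        = c * (weak_deriv 2 u x * h x) + d * (weak_deriv 2 v x * h x)"
      using H20_lincomb_weak_deriv_AE[OF assms(1,2), of c d] by eventually_elim (simp add: algebra_simps)
  qed (use D assms(3) in \<open>auto simp: L2_def\<close>)
  then show ?thesis using D[THEN L2_mult_integrable[OF _ assms(3)]] by simp
qed

lemma integral_weighted_lincomb: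
  assumes "u \<in> L2_inv a" "v \<in> L2_inv a" "h \<in> L2_inv a"
  shows "(\<integral>x. (c * u x + d * v x) * h x / a x \<partial>M01)
    = c * (\<integral>x. u x * h x / a x \<partial>M01) + d * (\<integral>x. v x * h x / a x \<partial>M01)"
proof -
  have "(\<integral>x. (c * u x + d * v x) * h x / a x \<partial>M01) = (\<integral>x. c * (u x * h x / a x) + d * (v x * h x / a x) \<partial>M01)"
    by (simp add: distrib_right add_divide_distrib mult.assoc)
  also have "\<dots> = (\<integral>x. c * (u x * h x / a x) \<partial>M01) + (\<integral>x. d * (v x * h x / a x) \<partial>M01)"
    by (intro Bochner_Integration.integral_add integrable_mult_right L2_inv_mult_integrable assms)
  finally show ?thesis by (simp only: integral_mult_right_zero)
qed

lemma ip_lincomb: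
  assumes "U \<in> H0 a" "V \<in> H0 a" "W \<in> H0 a"
  shows "ip (lincomb c U d V) W = c * ip U W + d * ip V W"
  using assms integral_weak_deriv_lincomb[of "fst U" "fst V" "weak_deriv 2 (fst W)" c d]
    integral_weighted_lincomb[of "snd U" "snd V" "snd W" c d]
  unfolding ip_def H0_iff lincomb_def by (simp add: H20_D algebra_simps)

lemma ip_nonneg: "ip U U \<ge> 0"
proof -
  have "(\<integral>x. snd U x * snd U x / a x \<partial>M01) \<ge> 0"
    unfolding integral_wt_mult[symmetric] by (rule integral_nonneg_AE) simp
  then show ?thesis by (simp add: ip_def)
qed

lemma H0_norm_nonneg: "H0_norm a U \<ge> 0"
  by (simp add: H0_norm_eq ip_nonneg)

lemma H0_norm_square: "(H0_norm a U)\<^sup>2 = ip U U"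
  by (simp add: H0_norm_eq ip_nonneg)

lemma ip_lincomb_right:
  "U \<in> H0 a \<Longrightarrow> V \<in> H0 a \<Longrightarrow> W \<in> H0 a \<Longrightarrow> ip W (lincomb c U d V) = c * ip W U + d * ip W V"
  by (metis ip_commute ip_lincomb)

lemma ip_Cauchy_Schwarz:
  assumes "U \<in> H0 a" "V \<in> H0 a" shows "\<bar>ip U V\<bar> \<le> H0_norm a U * H0_norm a V"
proof -
  have "(ip U V)\<^sup>2 \<le> ip U U * ip V V"
  proof (rule discriminant_nonpos[OF _ ip_nonneg])
    fix t
    have "0 \<le> ip (lincomb 1 U (- t) V) (lincomb 1 U (- t) V)" by (rule ip_nonneg)
    also have "\<dots> = ip U U - 2 * t * ip U V + t\<^sup>2 * ip V V"
      using assms by (simp add: ip_lincomb ip_lincomb_right lincomb_H0 ip_commute[of V U] power2_eq_square algebra_simps)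
    finally show "0 \<le> ip U U - 2 * t * ip U V + t\<^sup>2 * ip V V" .
  qed
  then show ?thesis
    unfolding H0_norm_eq real_sqrt_mult[symmetric] by (intro real_le_rsqrt) simp
qed

lemma H0_norm_lincomb_le:
  assumes "U \<in> H0 a" "V \<in> H0 a"
  shows "H0_norm a (lincomb c U d V) \<le> \<bar>c\<bar> * H0_norm a U + \<bar>d\<bar> * H0_norm a V"
proof -
  have "ip (lincomb c U d V) (lincomb c U d V) = c\<^sup>2 * ip U U + 2 * (c * d * ip U V) + d\<^sup>2 * ip V V"
    using assms by (simp add: ip_lincomb ip_lincomb_right lincomb_H0 ip_commute[of V U] power2_eq_square algebra_simps)
  also have "\<dots> \<le> c\<^sup>2 * ip U U + 2 * (\<bar>c * d\<bar> * (H0_norm a U * H0_norm a V)) + d\<^sup>2 * ip V V"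
  proof -
    have "c * d * ip U V \<le> \<bar>c * d\<bar> * \<bar>ip U V\<bar>" by (metis abs_ge_self abs_mult)
    also have "\<dots> \<le> \<bar>c * d\<bar> * (H0_norm a U * H0_norm a V)"
      by (intro mult_left_mono ip_Cauchy_Schwarz assms) auto
    finally show ?thesis by simp
  qed
  also have "\<dots> = (\<bar>c\<bar> * H0_norm a U + \<bar>d\<bar> * H0_norm a V)\<^sup>2"
    by (simp add: power2_sum power_mult_distrib H0_norm_square abs_mult mult_ac)
  finally show ?thesis
    unfolding H0_norm_eq[of "lincomb c U d V"] by (intro real_le_lsqrt add_nonneg_nonneg mult_nonneg_nonneg H0_norm_nonneg) auto
qed

text \<open>Covers the energy and the virial at once, so that continuity and the product rule along
  orbits are proved a single time. Boundedness by the energy norm also makes the values insensitive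
  to changes of distance 0.\<close>

definition bounded_form :: "(state \<Rightarrow> state \<Rightarrow> real) \<Rightarrow> real \<Rightarrow> bool" where
  "bounded_form B C \<longleftrightarrow> C \<ge> 0 \<and>
    (\<forall>U\<in>H0 a. \<forall>V\<in>H0 a. \<forall>W\<in>H0 a. \<forall>c d. B (lincomb c U d V) W = c * B U W + d * B V W \<and>
        B W (lincomb c U d V) = c * B W U + d * B W V) \<and>
    (\<forall>U\<in>H0 a. \<forall>V\<in>H0 a. \<bar>B U V\<bar> \<le> C * H0_norm a U * H0_norm a V)"

lemma bounded_form_ip: "bounded_form ip 1"
  unfolding bounded_form_def using ip_Cauchy_Schwarz ip_lincomb ip_lincomb_right by auto

lemma bounded_formD:
  assumes "bounded_form B C"
  shows "C \<ge> 0"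
    "U \<in> H0 a \<Longrightarrow> V \<in> H0 a \<Longrightarrow> W \<in> H0 a \<Longrightarrow> B (lincomb c U d V) W = c * B U W + d * B V W"
    "U \<in> H0 a \<Longrightarrow> V \<in> H0 a \<Longrightarrow> W \<in> H0 a \<Longrightarrow> B W (lincomb c U d V) = c * B W U + d * B W V"
    "U \<in> H0 a \<Longrightarrow> V \<in> H0 a \<Longrightarrow> \<bar>B U V\<bar> \<le> C * H0_norm a U * H0_norm a V"
  using assms unfolding bounded_form_def by blast+

lemma bounded_form_diff_le:
  assumes "bounded_form B C" "U \<in> H0 a" "V \<in> H0 a" "W \<in> H0 a"
  shows "\<bar>B U W - B V W\<bar> \<le> C * H0_dist a U V * H0_norm a W"
    "\<bar>B W U - B W V\<bar> \<le> C * H0_norm a W * H0_dist a U V"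
  using bounded_formD(4)[OF assms(1) lincomb_H0[OF assms(2,3), of 1 "-1"] assms(4)]
    bounded_formD(4)[OF assms(1) assms(4) lincomb_H0[OF assms(2,3), of 1 "-1"]]
    bounded_formD(2,3)[OF assms(1) assms(2-4), of 1 "-1"]
  by (simp_all add: H0_dist_def)

text \<open>This is \<open>x u' - u / 2\<close>, written through \<open>u''\<close> so that it is
  defined at every point whichever representative of \<open>u\<close> is given.\<close>

definition multiplier :: "(real \<Rightarrow> real) \<Rightarrow> real \<Rightarrow> real" where
  "multiplier u x = x * integral_from_0 (weak_deriv 2 u) x - 1 / 2 * integral_from_0 (integral_from_0 (weak_deriv 2 u)) x"

text \<open>Both \<open>\<bar>x u'\<bar>\<close> and \<open>\<bar>u\<bar>\<close> are at most
  \<open>x\<close> times the norm of \<open>u''\<close>; hence the factor 3/2, squared 9/4.\<close>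

lemma multiplier_bound:
  assumes u: "u \<in> H20"
  shows "multiplier u \<in> L2_inv a"
    "(\<integral>x. (multiplier u x)\<^sup>2 / a x \<partial>M01) \<le> 9 / 4 * (\<integral>x. (weak_deriv 2 u x)\<^sup>2 \<partial>M01) / a 1"
proof -
  note D = H20_D[OF u]
  let ?g = "weak_deriv 2 u"
  let ?N = "\<integral>t. (?g t)\<^sup>2 \<partial>M01"
  note J = integral_from_0_L2[OF L2_integrable_M01[OF D(2)]]
  note JJ = integral_from_0_L2[OF L2_integrable_M01[OF J]]
  have m: "multiplier u \<in> borel_measurable M01"
    unfolding multiplier_def[abs_def]
    by (intro borel_measurable_diff borel_measurable_times borel_measurable_const ident_measurable_M01
        L2_measurable[OF J] L2_measurable[OF JJ])
  have b: "(multiplier u x)\<^sup>2 \<le> 9 / 4 * ?N * x\<^sup>2" if x: "x \<in> {0<..<1}" for x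
  proof -
    define s where "s = x * sqrt ?N"
    have s: "s \<ge> 0" using x by (simp add: s_def)
    have "(integral_from_0 ?g x)\<^sup>2 \<le> x * ?N" using x by (intro integral_from_0_square_le D) auto
    also have "\<dots> \<le> ?N" using x by (intro mult_left_le_one_le) auto
    finally have "\<bar>integral_from_0 ?g x\<bar> \<le> sqrt ?N" by (intro real_le_rsqrt) simp
    then have 1: "\<bar>x * integral_from_0 ?g x\<bar> \<le> s" unfolding s_def abs_mult using x by (intro mult_mono) auto
    have "(integral_from_0 (integral_from_0 ?g) x)\<^sup>2 \<le> x ^ 3 * ?N"
      using x by (intro integral_from_0_twice_square_le D) auto
    also have "\<dots> \<le> x\<^sup>2 * ?N" using x by (intro mult_right_mono power_decreasing) auto
    finally have "\<bar>integral_from_0 (integral_from_0 ?g) x\<bar> \<le> sqrt (x\<^sup>2 * ?N)" by (intro real_le_rsqrt) simp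
    then have 2: "\<bar>integral_from_0 (integral_from_0 ?g) x\<bar> \<le> s" using x by (simp add: s_def real_sqrt_mult)
    have "\<bar>multiplier u x\<bar> \<le> 3 / 2 * s" using 1 2 unfolding multiplier_def by linarith
    then have "(multiplier u x)\<^sup>2 \<le> (3 / 2 * s)\<^sup>2" using s by (simp add: abs_le_square_iff[symmetric])
    also have "\<dots> = 9 / 4 * ?N * x\<^sup>2" by (simp add: s_def power_mult_distrib power_divide)
    finally show ?thesis .
  qed
  have N: "0 \<le> 9 / 4 * ?N" by simp
  show "multiplier u \<in> L2_inv a" "(\<integral>x. (multiplier u x)\<^sup>2 / a x \<partial>M01) \<le> 9 / 4 * ?N / a 1"
    using L2_inv_linear_bound[OF m b N] by blast+
qed

lemma multiplier_lincomb:
  assumes "u \<in> H20" "v \<in> H20" "x \<in> {0..1}"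
  shows "multiplier (\<lambda>x. c * u x + d * v x) x = c * multiplier u x + d * multiplier v x"
proof -
  note D = assms(1,2)[THEN H20_D(2)] H20_D(2)[OF H20_lincomb[OF assms(1,2), of c d]]
  note i = D[THEN L2_integrable_M01]
  have 1: "integral_from_0 (weak_deriv 2 (\<lambda>x. c * u x + d * v x)) t
      = c * integral_from_0 (weak_deriv 2 u) t + d * integral_from_0 (weak_deriv 2 v) t" if "t \<le> 1" for t
    using integral_from_0_cong_AE[OF i(3) _ H20_lincomb_weak_deriv_AE[OF assms(1,2)] that]
      integral_from_0_lincomb[OF i(1,2) that] i by simp
  have "integral_from_0 (integral_from_0 (weak_deriv 2 (\<lambda>x. c * u x + d * v x))) x
      = integral_from_0 (\<lambda>t. c * integral_from_0 (weak_deriv 2 u) t + d * integral_from_0 (weak_deriv 2 v) t) x"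
    unfolding integral_from_0_def[of _ x] using assms(3) 1
    by (intro Henstock_Kurzweil_Integration.integral_cong) auto
  also have "\<dots> = c * integral_from_0 (integral_from_0 (weak_deriv 2 u)) x
       + d * integral_from_0 (integral_from_0 (weak_deriv 2 v)) x"
    using assms(3) by (intro integral_from_0_lincomb L2_integrable_M01 integral_from_0_L2 i) auto
  finally show ?thesis using 1[of x] assms(3) unfolding multiplier_def by (simp add: algebra_simps)
qed

text \<open>The functional \<Phi> in polarised form: velocity from the first state, displacement
  from the second. As a bilinear form it can be differentiated along orbits by the product
  rule.\<close>

definition virial :: "state \<Rightarrow> state \<Rightarrow> real" where
  "virial U V = (\<integral>x. snd U x * multiplier (fst V) x / a x \<partial>M01)"

lemma virial_le:
  assumes "U \<in> H0 a" "V \<in> H0 a"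
  shows "\<bar>virial U V\<bar> \<le> sqrt (\<integral>x. (snd U x)\<^sup>2 / a x \<partial>M01) * sqrt (9 / 4 / a 1 * (\<integral>x. (weak_deriv 2 (fst V) x)\<^sup>2 \<partial>M01))"
proof -
  have U: "snd U \<in> L2_inv a" and V: "fst V \<in> H20" using assms by (auto simp: H0_iff)
  have "(virial U V)\<^sup>2 \<le> (\<integral>x. (snd U x)\<^sup>2 / a x \<partial>M01) * (\<integral>x. (multiplier (fst V) x)\<^sup>2 / a x \<partial>M01)"
    using L2_Cauchy_Schwarz[OF L2_inv_wt[OF U] L2_inv_wt[OF multiplier_bound(1)[OF V]]]
    by (simp add: integral_wt_mult integral_wt_square virial_def)
  also have "\<dots> \<le> (\<integral>x. (snd U x)\<^sup>2 / a x \<partial>M01) * (9 / 4 / a 1 * (\<integral>x. (weak_deriv 2 (fst V) x)\<^sup>2 \<partial>M01))"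
    using multiplier_bound(2)[OF V] by (intro mult_left_mono) (auto simp: integral_wt_square[symmetric])
  finally show ?thesis unfolding real_sqrt_mult[symmetric] by (intro real_le_rsqrt) simp
qed

lemma ip_self: "ip U U = (\<integral>x. (weak_deriv 2 (fst U) x)\<^sup>2 \<partial>M01) + (\<integral>x. (snd U x)\<^sup>2 / a x \<partial>M01)"
  by (simp add: ip_def power2_eq_square)

lemma weighted_square_nonneg: "(\<integral>x. (v x)\<^sup>2 / a x \<partial>M01) \<ge> 0"
  by (simp flip: integral_wt_square)

text \<open>The arithmetic-geometric mean inequality splits the product evenly; 9/4 is then enlarged
  to 4 to meet the constant of the theorem.\<close>

lemma virial_self_le:
  assumes "U \<in> H0 a"
  shows "\<bar>virial U U\<bar> \<le> 1 / 2 * max 1 (4 / a 1) * ip U U"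
proof -
  let ?v = "\<integral>x. (snd U x)\<^sup>2 / a x \<partial>M01" and ?g = "\<integral>x. (weak_deriv 2 (fst U) x)\<^sup>2 \<partial>M01"
  have g: "?g \<ge> 0" by simp
  have "\<bar>virial U U\<bar> \<le> sqrt ?v * sqrt (9 / 4 / a 1 * ?g)" by (rule virial_le[OF assms assms])
  also have "\<dots> \<le> 1 / 2 * (?v + 9 / 4 / a 1 * ?g)"
    using sum_squares_bound[of "sqrt ?v" "sqrt (9 / 4 / a 1 * ?g)"] weighted_square_nonneg[of "snd U"] a1_pos by simp
  also have "\<dots> \<le> 1 / 2 * (max 1 (4 / a 1) * ?v + max 1 (4 / a 1) * ?g)"
  proof -
    have "1 * ?v \<le> max 1 (4 / a 1) * ?v" using weighted_square_nonneg by (intro mult_right_mono) auto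
    moreover have "9 / 4 / a 1 \<le> 4 / a 1" using a1_pos by (intro divide_right_mono) auto
    then have "9 / 4 / a 1 * ?g \<le> max 1 (4 / a 1) * ?g" by (intro mult_right_mono) auto
    ultimately show ?thesis by simp
  qed
  finally show ?thesis by (simp add: ip_self algebra_simps)
qed

lemma bounded_form_virial: "bounded_form virial (sqrt (9 / 4 / a 1))"
  unfolding bounded_form_def
proof (intro conjI ballI allI)
  fix U V W :: state and c d :: real
  assume H: "U \<in> H0 a" "V \<in> H0 a" "W \<in> H0 a"
  then have H': "fst U \<in> H20" "snd U \<in> L2_inv a" "fst V \<in> H20" "snd V \<in> L2_inv a" "fst W \<in> H20" "snd W \<in> L2_inv a"
    by (auto simp: H0_iff)
  show "virial (lincomb c U d V) W = c * virial U W + d * virial V W"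
    using integral_weighted_lincomb[OF H'(2,4) multiplier_bound(1)[OF H'(5)], of c d]
    by (simp add: virial_def lincomb_def)
  have "virial W (lincomb c U d V) = (\<integral>x. (c * multiplier (fst U) x + d * multiplier (fst V) x) * snd W x / a x \<partial>M01)"
    unfolding virial_def lincomb_def
    by (rule Bochner_Integration.integral_cong) (auto simp: multiplier_lincomb[OF H'(1,3)] algebra_simps)
  also have "\<dots> = c * virial W U + d * virial W V"
    using integral_weighted_lincomb[OF multiplier_bound(1)[OF H'(1)] multiplier_bound(1)[OF H'(3)] H'(6), of c d]
    by (simp add: virial_def mult.commute)
  finally show "virial W (lincomb c U d V) = c * virial W U + d * virial W V" .
next
  fix U V assume H: "U \<in> H0 a" "V \<in> H0 a"
  have "\<bar>virial U V\<bar> \<le> sqrt (\<integral>x. (snd U x)\<^sup>2 / a x \<partial>M01) * (sqrt (9 / 4 / a 1) * sqrt (\<integral>x. (weak_deriv 2 (fst V) x)\<^sup>2 \<partial>M01))"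
    using virial_le[OF H] by (simp only: real_sqrt_mult)
  also have "\<dots> \<le> H0_norm a U * (sqrt (9 / 4 / a 1) * H0_norm a V)"
    using a1_pos H0_norm_nonneg weighted_square_nonneg
    by (intro mult_mono mult_left_mono mult_nonneg_nonneg) (auto simp: H0_norm_def)
  finally show "\<bar>virial U V\<bar> \<le> sqrt (9 / 4 / a 1) * H0_norm a U * H0_norm a V" by (simp add: mult_ac)
qed (use a1_pos in simp)

definition weighted_kinetic :: "(real \<Rightarrow> real) \<Rightarrow> real" where
  "weighted_kinetic v = (\<integral>x. (2 - x * deriv01 a x / a x) * ((v x)\<^sup>2 / a x) \<partial>M01)"

lemma log_derivative_bound: "x \<in> {0<..<1} \<Longrightarrow> \<bar>x * deriv01 a x / a x\<bar> \<le> K"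
  using a_quotient[of x] a_pos'[of x] by (simp add: abs_mult divide_le_eq)

lemma log_derivative_measurable: "(\<lambda>x. x * deriv01 a x / a x) \<in> borel_measurable M01"
  by (intro borel_measurable_divide borel_measurable_times ident_measurable_M01 a_measurable
      continuous_imp_measurable_M01[OF deriv01_continuous])

lemma weighted_kinetic_integrable:
  assumes "v \<in> L2_inv a"
  shows "integrable M01 (\<lambda>x. (2 - x * deriv01 a x / a x) * ((v x)\<^sup>2 / a x))"
proof (rule Bochner_Integration.integrable_bound)
  show "integrable M01 (\<lambda>x. (2 + K) * (v x * v x / a x))" by (intro integrable_mult_right L2_inv_mult_integrable assms)
  show "(\<lambda>x. (2 - x * deriv01 a x / a x) * ((v x)\<^sup>2 / a x)) \<in> borel_measurable M01"
    using log_derivative_measurable a_measurable L2_inv_measurable[OF assms] by auto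
  show "AE x in M01. norm ((2 - x * deriv01 a x / a x) * ((v x)\<^sup>2 / a x)) \<le> norm ((2 + K) * (v x * v x / a x))"
  proof (rule AE_I2)
    fix x assume "x \<in> space M01"
    then have x: "x \<in> {0<..<1}" by simp
    have "\<bar>2 - x * deriv01 a x / a x\<bar> \<le> \<bar>2 + K\<bar>" using log_derivative_bound[OF x] K by linarith
    then show "norm ((2 - x * deriv01 a x / a x) * ((v x)\<^sup>2 / a x)) \<le> norm ((2 + K) * (v x * v x / a x))"
      unfolding real_norm_def abs_mult power2_eq_square by (intro mult_right_mono) auto
  qed
qed

lemma weighted_kinetic_bounds:
  assumes "v \<in> L2_inv a"
  shows "(2 - K) * (\<integral>x. (v x)\<^sup>2 / a x \<partial>M01) \<le> weighted_kinetic v"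
    "weighted_kinetic v \<le> (2 + K) * (\<integral>x. (v x)\<^sup>2 / a x \<partial>M01)"
proof -
  have i: "integrable M01 (\<lambda>x. (v x)\<^sup>2 / a x)" using L2_inv_mult_integrable[OF assms assms] by (simp add: power2_eq_square)
  have "(\<integral>x. (2 - K) * ((v x)\<^sup>2 / a x) \<partial>M01) \<le> weighted_kinetic v"
    unfolding weighted_kinetic_def
  proof (rule integral_mono[OF _ weighted_kinetic_integrable[OF assms]])
    fix x assume "x \<in> space M01"
    then have x: "x \<in> {0<..<1}" by simp
    show "(2 - K) * ((v x)\<^sup>2 / a x) \<le> (2 - x * deriv01 a x / a x) * ((v x)\<^sup>2 / a x)"
      using abs_le_D1[OF log_derivative_bound[OF x]] abs_le_D2[OF log_derivative_bound[OF x]] a_pos'[OF x]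
      by (intro mult_right_mono) auto
  qed (intro integrable_mult_right i)
  then show "(2 - K) * (\<integral>x. (v x)\<^sup>2 / a x \<partial>M01) \<le> weighted_kinetic v"
    by (simp only: integral_mult_right_zero)
  have "weighted_kinetic v \<le> (\<integral>x. (2 + K) * ((v x)\<^sup>2 / a x) \<partial>M01)"
    unfolding weighted_kinetic_def
  proof (rule integral_mono[OF weighted_kinetic_integrable[OF assms]])
    fix x assume "x \<in> space M01"
    then have x: "x \<in> {0<..<1}" by simp
    show "(2 - x * deriv01 a x / a x) * ((v x)\<^sup>2 / a x) \<le> (2 + K) * ((v x)\<^sup>2 / a x)"
      using abs_le_D1[OF log_derivative_bound[OF x]] abs_le_D2[OF log_derivative_bound[OF x]] a_pos'[OF x]
      by (intro mult_right_mono) auto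
  qed (intro integrable_mult_right i)
  then show "weighted_kinetic v \<le> (2 + K) * (\<integral>x. (v x)\<^sup>2 / a x \<partial>M01)"
    by (simp only: integral_mult_right_zero)
qed

text \<open>The integrand plus half the weighted kinetic density is the derivative of
  \<open>h = x v^2 / (2 a)\<close>. This function vanishes at both ends: at 1 because
  \<open>v(1) = 0\<close>, at 0 because \<open>v^2 / a\<close> stays bounded.\<close>

lemma virial_velocity_identity:
  assumes v: "v \<in> H20"
  shows "(\<integral>x. v x * multiplier v x / a x \<partial>M01) = - 1 / 2 * weighted_kinetic v"
proof -
  note D = H20_D[OF v]
  let ?g = "weak_deriv 2 v"
  let ?N = "\<integral>t. (?g t)\<^sup>2 \<partial>M01"
  \<comment> \<open>The representative of \<open>v\<close> that can be differentiated pointwise; the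
    result returns to \<open>v\<close> at the end, almost everywhere.\<close>
  define V where "V = integral_from_0 (integral_from_0 ?g)"
  have J: "continuous_on {0..1} (integral_from_0 ?g)" by (rule continuous_on_integral_from_0[OF L2_integrable_M01[OF D(2)]])
  have cV: "continuous_on {0..1} V" unfolding V_def
    by (rule continuous_on_integral_from_0[OF L2_integrable_M01[OF continuous_L2[OF J]]])
  have dV: "(V has_real_derivative integral_from_0 ?g x) (at x)" if "x \<in> {0<..<1}" for x
    unfolding V_def by (rule integral_from_0_has_derivative[OF J that])
  have V: "V \<in> L2_inv a"
    by (rule L2_inv_cong_AE[OF H20_L2_inv[OF v]])
       (use D(3) continuous_L2[OF cV] in \<open>auto simp: V_def L2_def elim!: eventually_mono\<close>)
  have V1: "V 1 = 0" using D(5) by (simp add: V_def)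
  define h where "h x = 1 / 2 * x * (V x)\<^sup>2 / a x" for x
  have h_le: "\<bar>h x\<bar> \<le> x * (?N / a 1)" if x: "x \<in> {0..1}" for x
  proof (cases "x = 0")
    case False
    then have x: "x \<in> {0<..1}" using x by auto
    have "(V x)\<^sup>2 \<le> x ^ 3 * ?N" unfolding V_def using x by (intro integral_from_0_twice_square_le D) auto
    also have "\<dots> \<le> x\<^sup>2 * ?N" using x by (intro mult_right_mono power_decreasing) auto
    finally have "(V x)\<^sup>2 / a x \<le> x\<^sup>2 * ?N / a x" using a_pos[OF x] by (intro divide_right_mono) auto
    also have "\<dots> \<le> x\<^sup>2 * ?N / (a 1 * x\<^sup>2)"
      using square_le_a[OF x] x a1_pos a_pos[OF x] by (intro divide_left_mono mult_pos_pos mult_nonneg_nonneg) auto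
    also have "\<dots> = ?N / a 1" using x by simp
    finally have 1: "(V x)\<^sup>2 / a x \<le> ?N / a 1" .
    have "\<bar>h x\<bar> = 1 / 2 * x * ((V x)\<^sup>2 / a x)" using x a_pos[OF x] by (simp add: h_def abs_mult)
    also have "\<dots> \<le> x * (?N / a 1)" using x a_pos[OF x] by (intro mult_mono 1) auto
    finally show ?thesis .
  qed (simp add: h_def)
  have ch: "continuous_on {0..1} h"
    unfolding continuous_on_eq_continuous_within
  proof
    fix x :: real assume x: "x \<in> {0..1}"
    show "continuous (at x within {0..1}) h"
    proof (cases "x = 0")
      case True
      have "(h \<longlongrightarrow> 0) (at 0 within {0..1})"
      proof (rule Lim_null_comparison)
        show "\<forall>\<^sub>F x in at 0 within {0..1}. norm (h x) \<le> x * (?N / a 1)"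
          using h_le by (auto simp: eventually_at_filter)
        have "((\<lambda>x. x * (?N / a 1)) \<longlongrightarrow> 0 * (?N / a 1)) (at 0 within {0..1})" by (intro tendsto_intros)
        then show "((\<lambda>x. x * (?N / a 1)) \<longlongrightarrow> 0) (at 0 within {0..1})" by simp
      qed
      then show ?thesis using True by (simp add: continuous_within h_def)
    next
      case False
      have "continuous (at x within {0..1}) a" "continuous (at x within {0..1}) V"
        using a_continuous cV x by (auto simp: continuous_on_eq_continuous_within)
      then show ?thesis unfolding h_def[abs_def] using False x a_pos[of x] by (intro continuous_intros) auto
    qed
  qed
  have dh: "(h has_real_derivative V x * multiplier v x / a x + 1 / 2 * ((2 - x * deriv01 a x / a x) * ((V x)\<^sup>2 / a x))) (at x)"
    if x: "x \<in> {0<..<1}" for x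
  proof -
    have ax: "a x \<noteq> 0" using a_pos'[OF x] by simp
    have "(h has_real_derivative
      ((1 / 2 * (V x)\<^sup>2 + 1 / 2 * x * (2 * V x * integral_from_0 ?g x)) * a x - (1 / 2 * x * (V x)\<^sup>2) * deriv01 a x) / (a x * a x)) (at x)"
      unfolding h_def[abs_def]
      by (rule DERIV_divide[OF _ a_deriv[OF x] ax])
         (auto intro!: derivative_eq_intros dV[OF x])
    also have "((1 / 2 * (V x)\<^sup>2 + 1 / 2 * x * (2 * V x * integral_from_0 ?g x)) * a x - (1 / 2 * x * (V x)\<^sup>2) * deriv01 a x) / (a x * a x)
        = V x * multiplier v x / a x + 1 / 2 * ((2 - x * deriv01 a x / a x) * ((V x)\<^sup>2 / a x))"
    proof -
      have e1: "V x * multiplier v x / a x = (V x * multiplier v x * a x) / (a x * a x)"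
        using ax by simp
      have e2: "1 / 2 * ((2 - x * deriv01 a x / a x) * ((V x)\<^sup>2 / a x))
          = (1 / 2 * (2 * a x - x * deriv01 a x) * (V x)\<^sup>2) / (a x * a x)"
        using ax by (simp add: field_simps)
      show ?thesis unfolding e1 e2 add_divide_distrib[symmetric]
        by (rule arg_cong2[where f="(/)", OF _ refl])
           (simp add: multiplier_def V_def[symmetric] algebra_simps power2_eq_square)
    qed
    finally show ?thesis .
  qed
  have "((\<lambda>x. V x * multiplier v x / a x + 1 / 2 * ((2 - x * deriv01 a x / a x) * ((V x)\<^sup>2 / a x))) has_integral h 1 - h 0) {0..1}"
    by (rule fundamental_theorem_of_calculus_interior)
       (use ch dh in \<open>auto simp flip: has_real_derivative_iff_has_vector_derivative\<close>)
  note hi = this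
  note I = L2_inv_mult_integrable[OF V multiplier_bound(1)[OF v]]
    integrable_mult_right[OF weighted_kinetic_integrable[OF V], of "1 / 2"]
  have "h 1 - h 0 = (\<integral>x. V x * multiplier v x / a x \<partial>M01)
      + (\<integral>x. 1 / 2 * ((2 - x * deriv01 a x / a x) * ((V x)\<^sup>2 / a x)) \<partial>M01)"
    by (rule integral_M01_eqI[OF Bochner_Integration.integrable_add[OF I] hi,
          unfolded Bochner_Integration.integral_add[OF I], symmetric])
  also have "(\<integral>x. 1 / 2 * ((2 - x * deriv01 a x / a x) * ((V x)\<^sup>2 / a x)) \<partial>M01) = 1 / 2 * weighted_kinetic V"
    by (simp only: integral_mult_right_zero weighted_kinetic_def)
  finally have 1: "(\<integral>x. V x * multiplier v x / a x \<partial>M01) = - 1 / 2 * weighted_kinetic V"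
    by (simp add: h_def V1)
  have ae: "AE x in M01. v x = V x" using D(3) by (simp add: V_def)
  have "(\<integral>x. v x * multiplier v x / a x \<partial>M01) = (\<integral>x. V x * multiplier v x / a x \<partial>M01)"
    using ae L2_inv_mult_integrable[OF V multiplier_bound(1)[OF v]] L2_inv_mult_integrable[OF H20_L2_inv[OF v] multiplier_bound(1)[OF v]]
    by (intro integral_cong_AE) (auto elim!: eventually_mono)
  moreover have "weighted_kinetic v = weighted_kinetic V"
    unfolding weighted_kinetic_def
    using ae weighted_kinetic_integrable[OF V] weighted_kinetic_integrable[OF H20_L2_inv[OF v]]
    by (intro integral_cong_AE) (auto elim!: eventually_mono)
  ultimately show ?thesis using 1 by simp
qed

end

section \<open>The domain of the operator\<close>

context degenerate_coefficient
begin

lemma wt_mult_a: assumes "x \<in> {0<..<1}" shows "wt (\<lambda>x. a x * w x) x = sqrt (a x) * w x"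
proof -
  have "wt (\<lambda>x. a x * w x) x = (a x / sqrt (a x)) * w x" by (simp add: wt_def)
  also have "a x / sqrt (a x) = sqrt (a x)" by (rule real_div_sqrt[OF less_imp_le[OF a_pos'[OF assms]]])
  finally show ?thesis .
qed

text \<open>The weight \<open>x\<close> on the fourth derivative \<open>w\<close> arises because
  \<open>a w\<close> in the weighted space means \<open>sqrt a * w\<close> in \<open>L2\<close>,
  while \<open>x \<le> sqrt (a x / a 1)\<close> by \<open>square_le_a\<close>.\<close>

lemma domA_D:
  assumes "u \<in> domA a"
  shows "u \<in> H20" "has_weak_deriv 4 u (weak_deriv 4 u)" "opA a u \<in> L2_inv a"
    "(\<lambda>x. x * weak_deriv 4 u x) \<in> L2 {0<..<1}"
proof -
  obtain w where w: "has_weak_deriv 4 u w" "(\<lambda>x. a x * w x) \<in> L2_inv a" and u: "u \<in> H20"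
    using assms by (auto simp: domA_def H2_inv_eq_H20)
  show "u \<in> H20" by fact
  show D: "has_weak_deriv 4 u (weak_deriv 4 u)" by (rule has_weak_deriv_weak_deriv[OF w(1)])
  have m: "weak_deriv 4 u \<in> borel_measurable M01"
    using D by (auto simp: has_weak_deriv_def intro: locally_integrable_measurable)
  show A: "opA a u \<in> L2_inv a"
    by (rule L2_inv_cong_AE[OF w(2)])
       (use m a_measurable weak_deriv_AE_eq[OF w(1)] in \<open>auto simp: opA_def elim!: eventually_mono\<close>)
  show "(\<lambda>x. x * weak_deriv 4 u x) \<in> L2 {0<..<1}"
  proof (rule L2_bound)
    show "(\<lambda>x. 1 / sqrt (a 1) * wt (opA a u) x + 0 * wt (opA a u) x) \<in> L2 {0<..<1}"
      by (intro L2_lincomb L2_inv_wt A)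
    show "(\<lambda>x. x * weak_deriv 4 u x) \<in> borel_measurable M01"
      by (intro borel_measurable_times ident_measurable_M01 m)
    show "AE x in M01. \<bar>x * weak_deriv 4 u x\<bar> \<le> \<bar>1 / sqrt (a 1) * wt (opA a u) x + 0 * wt (opA a u) x\<bar>"
    proof (rule AE_I2)
      fix x assume "x \<in> space M01"
      then have x: "x \<in> {0<..<1}" by simp
      have "sqrt (a 1) * x \<le> sqrt (a x)"
        using square_le_a[of x] x real_sqrt_le_mono[of "a 1 * x\<^sup>2" "a x"] by (simp add: real_sqrt_mult)
      then have "x \<le> sqrt (a x) / sqrt (a 1)" using a1_pos by (simp add: field_simps)
      then have "\<bar>x * weak_deriv 4 u x\<bar> \<le> sqrt (a x) / sqrt (a 1) * \<bar>weak_deriv 4 u x\<bar>"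
        using x unfolding abs_mult by (intro mult_right_mono) auto
      also have "\<dots> = \<bar>1 / sqrt (a 1) * wt (opA a u) x + 0 * wt (opA a u) x\<bar>"
        using a_pos'[OF x] a1_pos by (simp add: wt_mult_a[OF x] opA_def abs_mult)
      finally show "\<bar>x * weak_deriv 4 u x\<bar> \<le> \<bar>1 / sqrt (a 1) * wt (opA a u) x + 0 * wt (opA a u) x\<bar>" .
    qed
  qed
qed

lemma wave_dom_iff: "U \<in> wave_dom a \<longleftrightarrow> fst U \<in> domA a \<and> snd U \<in> H20"
  by (cases U) (simp add: wave_dom_def H2_inv_eq_H20)

lemma wave_dom_H0: "U \<in> wave_dom a \<Longrightarrow> U \<in> H0 a"
  by (simp add: wave_dom_iff H0_iff domA_D H20_L2_inv)

lemma wave_op_H0: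
  assumes "U \<in> wave_dom a" shows "wave_op a U \<in> H0 a"
  using assms L2_inv_lincomb[OF domA_D(3) domA_D(3), of "fst U" "fst U" "-1" 0]
  by (simp add: wave_dom_iff H0_iff wave_op_def)

lemma domA_lincomb:
  assumes "u \<in> domA a" "v \<in> domA a" shows "(\<lambda>x. c * u x + d * v x) \<in> domA a"
proof -
  note D = domA_D[OF assms(1)] domA_D[OF assms(2)]
  have "(\<lambda>x. a x * (c * weak_deriv 4 u x + d * weak_deriv 4 v x)) = (\<lambda>x. c * opA a u x + d * opA a v x)"
    by (auto simp: opA_def algebra_simps)
  then show ?thesis
    using has_weak_deriv_lincomb[OF D(2,6), of c d] L2_inv_lincomb[OF D(3,7), of c d] H20_lincomb[OF D(1,5), of c d]
    unfolding domA_def H2_inv_eq_H20 by auto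
qed

lemma wave_dom_lincomb: "U \<in> wave_dom a \<Longrightarrow> V \<in> wave_dom a \<Longrightarrow> lincomb c U d V \<in> wave_dom a"
  by (simp add: wave_dom_iff lincomb_def domA_lincomb H20_lincomb)

lemma domA_fourth_derivative:
  assumes "u \<in> domA a"
  obtains A B where "fourth_derivative u (weak_deriv 4 u) A B"
proof -
  obtain A B where "AE x in M01. weak_deriv 2 u x = A + B * x + integral_to_1 (integral_to_1 (weak_deriv 4 u)) x"
    using fourth_weak_deriv_representation[OF domA_D(1,2,4)[OF assms]] by blast
  then show ?thesis by (rule that[OF fourth_derivative.intro[OF domA_D(1,2,4)[OF assms]]])
qed

lemma opA_pairing: "x \<in> {0<..<1} \<Longrightarrow> opA a u x * p x / a x = weak_deriv 4 u x * p x"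
  using a_pos'[of x] by (simp add: opA_def)

lemma integral_opA_pairing:
  "(\<integral>x. opA a u x * p x / a x \<partial>M01) = (\<integral>x. weak_deriv 4 u x * p x \<partial>M01)"
  by (rule Bochner_Integration.integral_cong) (simp_all add: opA_pairing)

text \<open>Green's formula makes the elastic and kinetic contributions cancel: energy conservation
  in infinitesimal form.\<close>

lemma wave_op_skew:
  assumes "U \<in> wave_dom a" shows "ip U (wave_op a U) = 0"
proof -
  have U: "fst U \<in> domA a" "snd U \<in> H20" using assms by (auto simp: wave_dom_iff)
  obtain A B where "fourth_derivative (fst U) (weak_deriv 4 (fst U)) A B"
    using domA_fourth_derivative[OF U(1)] by blast
  from fourth_derivative.Green_formula[OF this U(2)]
  have "(\<integral>x. opA a (fst U) x * snd U x / a x \<partial>M01) = (\<integral>x. weak_deriv 2 (fst U) x * weak_deriv 2 (snd U) x \<partial>M01)"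
    by (simp add: integral_opA_pairing)
  then show ?thesis by (simp add: ip_def wave_op_def mult.commute)
qed

text \<open>Of the multiplier, the part \<open>x u'\<close> contributes 3/2 of the elastic integral
  by Pohozaev's identity, and \<open>- u / 2\<close> takes back 1/2 of it. With the velocity part
  added, this is the time derivative of the virial along an orbit.\<close>

lemma virial_identity:
  assumes "U \<in> wave_dom a"
  shows "virial (wave_op a U) U + virial U (wave_op a U)
    = 1 / 2 * (second_deriv_at_1 (fst U))\<^sup>2 - (\<integral>x. (weak_deriv 2 (fst U) x)\<^sup>2 \<partial>M01) - 1 / 2 * weighted_kinetic (snd U)"
proof -
  have U: "fst U \<in> domA a" "snd U \<in> H20" using assms by (auto simp: wave_dom_iff)
  let ?u = "fst U" and ?w = "weak_deriv 4 (fst U)" and ?g = "weak_deriv 2 (fst U)"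
  note D = domA_D[OF U(1)]
  obtain A B where fd: "fourth_derivative ?u ?w A B" using domA_fourth_derivative[OF U(1)] by blast
  interpret fourth_derivative ?u ?w A B by (rule fd)
  note g = H20_D(2)[OF D(1)]
  let ?JJ = "integral_from_0 (integral_from_0 ?g)"
  have JJ: "(\<integral>x. ?w x * ?JJ x \<partial>M01) = (\<integral>x. (?g x)\<^sup>2 \<partial>M01)"
  proof -
    have "(\<integral>x. ?w x * ?JJ x \<partial>M01) = (\<integral>x. G x * ?g x \<partial>M01)"
      unfolding duality[OF g] by (simp add: H20_affine_orthogonal[OF D(1)])
    also have "\<dots> = (\<integral>x. (?g x)\<^sup>2 \<partial>M01)"
      using AE_G L2_measurable[OF g] L2_measurable[OF G_L2]
      by (intro integral_cong_AE) (auto simp: power2_eq_square elim!: eventually_mono)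
    finally show ?thesis .
  qed
  have i1: "integrable M01 (\<lambda>x. ?w x * ?JJ x)" by (rule integral_to_1_twice_duality(2)[OF g])
  have "integrable M01 (\<lambda>x. opA a ?u x * multiplier ?u x / a x)"
    by (rule L2_inv_mult_integrable[OF D(3) multiplier_bound(1)[OF D(1)]])
  moreover have "integrable M01 (\<lambda>x. opA a ?u x * multiplier ?u x / a x) \<longleftrightarrow> integrable M01 (\<lambda>x. ?w x * multiplier ?u x)"
    by (rule Bochner_Integration.integrable_cong) (simp_all add: opA_pairing)
  ultimately have i2: "integrable M01 (\<lambda>x. ?w x * multiplier ?u x)" by blast
  have "(\<integral>x. ?w x * (x * integral_from_0 ?g x) \<partial>M01) = (\<integral>x. ?w x * multiplier ?u x + 1 / 2 * (?w x * ?JJ x) \<partial>M01)"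
    by (rule Bochner_Integration.integral_cong) (auto simp: multiplier_def algebra_simps)
  also have "\<dots> = (\<integral>x. ?w x * multiplier ?u x \<partial>M01) + (\<integral>x. 1 / 2 * (?w x * ?JJ x) \<partial>M01)"
    by (intro Bochner_Integration.integral_add integrable_mult_right i1 i2)
  also have "(\<integral>x. 1 / 2 * (?w x * ?JJ x) \<partial>M01) = 1 / 2 * (\<integral>x. (?g x)\<^sup>2 \<partial>M01)"
    by (simp only: integral_mult_right_zero JJ)
  finally have "virial (wave_op a U) U = 1 / 2 * (second_deriv_at_1 ?u)\<^sup>2 - (\<integral>x. (?g x)\<^sup>2 \<partial>M01)"
    using Pohozaev_identity by (simp add: virial_def wave_op_def integral_opA_pairing)
  moreover have "virial U (wave_op a U) = - 1 / 2 * weighted_kinetic (snd U)"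
    using virial_velocity_identity[OF U(2)] by (simp add: virial_def wave_op_def)
  ultimately show ?thesis by simp
qed

text \<open>The cubic vanishes to second order at 0 and has value 0 and slope \<open>-1\<close> at 1, so Green's formula
  against it isolates the trace at 1.\<close>

definition trace_state :: state where "trace_state = ((\<lambda>x. 0), (\<lambda>x. x\<^sup>2 - x ^ 3))"

lemma test_function_0: "test_function (\<lambda>x. 0)"
  using test_function_mult[OF test_function_bump[of "1/3" "1/2"] smooth_const[of 0]] by simp

lemma weak_deriv_0_AE: "AE x in M01. weak_deriv 2 (\<lambda>x. 0) x = 0"
  using weak_deriv_AE_eq[OF has_weak_deriv_test_function[OF test_function_0, of 2]]
  by (simp add: numeral_2_eq_2)

lemma trace_state_H0: "trace_state \<in> H0 a"
proof -
  have "(\<lambda>x. x\<^sup>2 - x ^ 3) \<in> L2_inv a"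
  proof (rule L2_inv_linear_bound(1)[where C=1])
    show "(\<lambda>x. x\<^sup>2 - x ^ 3) \<in> borel_measurable M01" by (rule borel_measurable_M01I) simp
    fix x :: real assume x: "x \<in> {0<..<1}"
    have "x\<^sup>2 - x ^ 3 = x * (x * (1 - x))" by (simp add: power2_eq_square power3_eq_cube algebra_simps)
    moreover have "0 \<le> x * (x * (1 - x))" using x by simp
    moreover have "x * (x * (1 - x)) \<le> x * 1" using x by (intro mult_left_mono mult_le_one) auto
    ultimately have "\<bar>x\<^sup>2 - x ^ 3\<bar> \<le> \<bar>x\<bar>" using x by simp
    then show "(x\<^sup>2 - x ^ 3)\<^sup>2 \<le> 1 * x\<^sup>2" by (simp add: abs_le_square_iff)
  qed simp
  then show ?thesis by (simp add: H0_iff trace_state_def test_function_H20 test_function_0)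
qed

text \<open>Turns the trace, defined by a limit at 1, into a functional of
  \<open>wave_op a U\<close> that is bounded for the energy norm and can be followed along
  orbits.\<close>

lemma trace_eq_ip:
  assumes "U \<in> wave_dom a"
  shows "second_deriv_at_1 (fst U) = - ip (wave_op a U) trace_state"
proof -
  have U: "fst U \<in> domA a" "snd U \<in> H20" using assms by (auto simp: wave_dom_iff)
  obtain A B where fd: "fourth_derivative (fst U) (weak_deriv 4 (fst U)) A B"
    using domA_fourth_derivative[OF U(1)] by blast
  have "(\<integral>x. weak_deriv 2 (snd U) x * weak_deriv 2 (\<lambda>x. 0) x \<partial>M01) = (\<integral>x. 0 \<partial>M01)"
    using weak_deriv_0_AE L2_measurable[OF H20_D(2)[OF U(2)]]
      L2_measurable[OF H20_D(2)[OF test_function_H20[OF test_function_0]]]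
    by (intro integral_cong_AE) (auto elim!: eventually_mono)
  then show ?thesis
    using fourth_derivative.trace_formula[OF fd]
    by (simp add: ip_def wave_op_def trace_state_def integral_opA_pairing)
qed

lemma second_deriv_at_1_limit:
  assumes "u \<in> domA a"
  obtains w where "has_weak_deriv 2 u w" "(w \<longlongrightarrow> second_deriv_at_1 u) (at_left 1)"
proof -
  obtain A B where fd: "fourth_derivative u (weak_deriv 4 u) A B"
    using domA_fourth_derivative[OF assms] by blast
  interpret fourth_derivative u "weak_deriv 4 u" A B by (rule fd)
  show ?thesis using that[OF has_weak_deriv_G G_tendsto[folded second_deriv_at_1_eq_G]] .
qed

lemma second_deriv_at_1_lincomb:
  assumes "u \<in> domA a" "v \<in> domA a"
  shows "second_deriv_at_1 (\<lambda>x. c * u x + d * v x) = c * second_deriv_at_1 u + d * second_deriv_at_1 v"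
proof -
  obtain w where w: "has_weak_deriv 2 u w" "(w \<longlongrightarrow> second_deriv_at_1 u) (at_left 1)"
    using second_deriv_at_1_limit[OF assms(1)] by blast
  obtain w' where w': "has_weak_deriv 2 v w'" "(w' \<longlongrightarrow> second_deriv_at_1 v) (at_left 1)"
    using second_deriv_at_1_limit[OF assms(2)] by blast
  show ?thesis
    by (rule second_deriv_at_1_eq[OF has_weak_deriv_lincomb[OF w(1) w'(1)]]) (intro tendsto_intros w w')
qed

lemma second_deriv_at_1_cong_AE:
  assumes "u \<in> domA a" "v \<in> H20" "AE x in M01. u x = v x"
  shows "second_deriv_at_1 v = second_deriv_at_1 u"
proof -
  obtain w where w: "has_weak_deriv 2 u w" "(w \<longlongrightarrow> second_deriv_at_1 u) (at_left 1)"
    using second_deriv_at_1_limit[OF assms(1)] by blast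
  have "has_weak_deriv 2 v w"
  proof (rule has_weak_deriv_cong_AE[OF w(1) _ _ assms(3)])
    show "locally_integrable v"
      by (intro integrable_M01_imp_locally_integrable L2_integrable_M01 H2_L2 H20_H2 assms)
  qed (use w(1) in \<open>auto simp: has_weak_deriv_def\<close>)
  then show ?thesis using w(2) by (rule second_deriv_at_1_eq)
qed

text \<open>The second derivative of the difference has norm 0, and so does its double primitive.
  This is how equality up to distance 0 reaches the traces.\<close>

lemma H0_dist_0_AE:
  assumes "U \<in> H0 a" "V \<in> H0 a" "H0_dist a U V = 0"
  shows "AE x in M01. fst U x = fst V x"
proof -
  let ?u = "\<lambda>x. 1 * fst U x + (-1) * fst V x"
  have u: "?u \<in> H20" using assms by (intro H20_lincomb) (auto simp: H0_iff)
  note D = H20_D[OF u]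
  have "ip (lincomb 1 U (-1) V) (lincomb 1 U (-1) V) = 0"
    using assms(3) by (simp add: H0_dist_def H0_norm_eq)
  moreover have "0 \<le> (\<integral>x. (weak_deriv 2 ?u x)\<^sup>2 \<partial>M01)" by simp
  ultimately have "(\<integral>x. (weak_deriv 2 ?u x)\<^sup>2 \<partial>M01) = 0"
    using weighted_square_nonneg[of "snd (lincomb 1 U (-1) V)"]
    unfolding ip_self by (simp add: lincomb_def add_nonneg_eq_0_iff)
  then have "(integral_from_0 (integral_from_0 (weak_deriv 2 ?u)) x)\<^sup>2 \<le> 0" if "x \<in> {0<..<1}" for x
    using integral_from_0_twice_square_le[OF D(2), of x] that by simp
  then have "AE x in M01. integral_from_0 (integral_from_0 (weak_deriv 2 ?u)) x = 0"
    by (intro AE_I2) simp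
  with D(3) show ?thesis by eventually_elim simp
qed

section \<open>Density of the domain\<close>

lemma test_function_domA:
  assumes "test_function \<phi>" shows "\<phi> \<in> domA a"
proof -
  let ?w = "(deriv ^^ 4) \<phi>"
  have w: "test_function ?w" by (rule test_function_funpow_deriv[OF assms])
  obtain B where B: "\<And>x. \<bar>?w x\<bar> \<le> B" "B \<ge> 0" using test_function_bounded[OF w] by blast
  obtain Ba where Ba: "\<And>x. x \<in> {0..1} \<Longrightarrow> \<bar>a x\<bar> \<le> Ba" using continuous_bounded_M01[OF a_continuous] by blast
  have m: "(\<lambda>x. a x * ?w x) \<in> borel_measurable M01"
    by (intro borel_measurable_times a_measurable test_function_measurable w)
  have "wt (\<lambda>x. a x * ?w x) \<in> L2 {0<..<1}"
  proof (rule bounded_imp_L2[where B="sqrt Ba * B"])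
    show "wt (\<lambda>x. a x * ?w x) \<in> borel_measurable M01"
      using m a_measurable by (simp add: wt_def[abs_def])
    fix x :: real assume x: "x \<in> {0<..<1}"
    have "\<bar>wt (\<lambda>x. a x * ?w x) x\<bar> = sqrt (a x) * \<bar>?w x\<bar>"
      using a_pos'[OF x] by (simp add: wt_mult_a[OF x] abs_mult)
    also have "\<dots> \<le> sqrt Ba * B"
      using Ba[of x] x B by (intro mult_mono) auto
    finally show "\<bar>wt (\<lambda>x. a x * ?w x) x\<bar> \<le> sqrt Ba * B" .
  qed
  then have "(\<lambda>x. a x * ?w x) \<in> L2_inv a" using m by (simp add: L2_inv_iff)
  then show ?thesis
    using has_weak_deriv_test_function[OF assms, of 4] test_function_H20[OF assms]
    unfolding domA_def H2_inv_eq_H20 by blast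
qed

text \<open>On the fixed interval (c, d) the weight is at most \<open>1 / (a 1 * c^2)\<close>, so
  dominated convergence with a constant majorant applies.\<close>

lemma test_functions_dense_bounded:
  assumes f: "f \<in> borel_measurable M01" "\<And>x. \<bar>f x\<bar> \<le> B" and cd: "0 < c" "d < 1" and e: "e > 0"
  obtains \<psi> where "test_function \<psi>" "(\<integral>x. (indicator {c<..<d} x * f x - \<psi> x)\<^sup>2 / a x \<partial>M01) < e"
proof -
  interpret M: finite_measure M01 by (rule finite_measure_M01)
  obtain \<psi> :: "nat \<Rightarrow> real \<Rightarrow> real" where \<psi>: "\<And>n. test_function (\<psi> n)"
    "\<And>n x. x \<notin> {c<..<d} \<Longrightarrow> \<psi> n x = 0" "\<And>n x. \<bar>\<psi> n x\<bar> \<le> B + 1"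
    "AE x in M01. (\<lambda>n. \<psi> n x) \<longlonglongrightarrow> indicator {c<..<d} x * f x"
    using test_function_approximation[OF f cd] by blast
  let ?g = "\<lambda>x. indicator {c<..<d} x * f x"
  have B: "B \<ge> 0" using f(2)[of 0] by linarith
  have im: "(indicator {c<..<d} :: real \<Rightarrow> real) \<in> borel_measurable M01"
    by (rule borel_measurable_M01I) simp
  have gm: "?g \<in> borel_measurable M01" by (intro borel_measurable_times im f)
  have m: "(\<lambda>x. (?g x - \<psi> n x)\<^sup>2 / a x) \<in> borel_measurable M01" for n
    by (intro borel_measurable_divide borel_measurable_power borel_measurable_diff gm a_measurable
        test_function_measurable \<psi>)
  have "(\<lambda>n. \<integral>x. (?g x - \<psi> n x)\<^sup>2 / a x \<partial>M01) \<longlonglongrightarrow> (\<integral>x. 0 \<partial>M01)"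
  proof (rule integral_dominated_convergence[where w="\<lambda>x. (2 * B + 1)\<^sup>2 / (a 1 * c\<^sup>2)"])
    show "AE x in M01. (\<lambda>n. (?g x - \<psi> n x)\<^sup>2 / a x) \<longlonglongrightarrow> 0"
      using \<psi>(4)
    proof eventually_elim
      case (elim x)
      have "(\<lambda>n. (?g x - \<psi> n x)\<^sup>2 / a x) \<longlonglongrightarrow> (?g x - ?g x)\<^sup>2 / a x"
        unfolding divide_inverse by (intro tendsto_intros elim)
      then show ?case by simp
    qed
    show "AE x in M01. norm ((?g x - \<psi> n x)\<^sup>2 / a x) \<le> (2 * B + 1)\<^sup>2 / (a 1 * c\<^sup>2)" for n
    proof (rule AE_I2)
      fix x assume "x \<in> space M01"
      then have x: "x \<in> {0<..<1}" by simp
      show "norm ((?g x - \<psi> n x)\<^sup>2 / a x) \<le> (2 * B + 1)\<^sup>2 / (a 1 * c\<^sup>2)"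
      proof (cases "x \<in> {c<..<d}")
        case True
        have "\<bar>f x - \<psi> n x\<bar> \<le> 2 * B + 1" using f(2)[of x] \<psi>(3)[of n x] by linarith
        then have "(?g x - \<psi> n x)\<^sup>2 \<le> (2 * B + 1)\<^sup>2"
          using True B by (simp add: abs_le_square_iff[symmetric])
        moreover have "a 1 * c\<^sup>2 \<le> a x"
        proof -
          have "a 1 * c\<^sup>2 \<le> a 1 * x\<^sup>2" using True cd a1_pos by (intro mult_left_mono power_mono) auto
          also have "\<dots> \<le> a x" using square_le_a[of x] x by simp
          finally show ?thesis .
        qed
        ultimately have "(?g x - \<psi> n x)\<^sup>2 / a x \<le> (2 * B + 1)\<^sup>2 / (a 1 * c\<^sup>2)"
          using a1_pos cd by (intro frac_le) auto
        then show ?thesis using a_pos'[OF x] by simp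
      next
        case False
        then show ?thesis using \<psi>(2)[OF False] a1_pos by simp
      qed
    qed
  qed (use m in auto)
  then have "\<forall>\<^sub>F n in sequentially. (\<integral>x. (?g x - \<psi> n x)\<^sup>2 / a x \<partial>M01) < e"
    using e by (intro order_tendstoD(2)) auto
  then obtain n where "(\<integral>x. (?g x - \<psi> n x)\<^sup>2 / a x \<partial>M01) < e" by (auto simp: eventually_sequentially)
  then show ?thesis using that \<psi>(1) by blast
qed

text \<open>Truncating the values and cutting off both ends leaves an error of at most
  \<open>\<bar>v\<bar>\<close>, so dominated convergence reduces the claim to the bounded
  case.\<close>

lemma test_functions_dense_L2_inv:
  assumes v: "v \<in> L2_inv a" and e: "e > 0"
  obtains \<psi> where "test_function \<psi>" "(\<integral>x. (v x - \<psi> x)\<^sup>2 / a x \<partial>M01) < e"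
proof -
  note vm = L2_inv_measurable[OF v]
  define c where "c n = inverse (real (Suc n))" for n
  define f where "f n x = max (- real n) (min (real n) (v x))" for n x
  let ?g = "\<lambda>n x. indicator {c n<..<1 - c n} x * f n x"
  have fm: "f n \<in> borel_measurable M01" for n
    unfolding f_def[abs_def] by (intro borel_measurable_max borel_measurable_min borel_measurable_const vm)
  have im: "(indicator {c n<..<1 - c n} :: real \<Rightarrow> real) \<in> borel_measurable M01" for n
    by (rule borel_measurable_M01I) simp
  have gm: "?g n \<in> borel_measurable M01" for n by (intro borel_measurable_times im fm)
  have iv: "integrable M01 (\<lambda>x. (v x)\<^sup>2 / a x)" using L2_inv_mult_integrable[OF v v] by (simp add: power2_eq_square)
  have le: "\<bar>v x - ?g n x\<bar> \<le> \<bar>v x\<bar>" for n x by (auto simp: f_def indicator_def)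
  have "(\<lambda>n. \<integral>x. (v x - ?g n x)\<^sup>2 / a x \<partial>M01) \<longlonglongrightarrow> (\<integral>x. 0 \<partial>M01)"
  proof (rule integral_dominated_convergence[where w="\<lambda>x. (v x)\<^sup>2 / a x"])
    show "(\<lambda>x. (v x - ?g n x)\<^sup>2 / a x) \<in> borel_measurable M01" for n
      by (intro borel_measurable_divide borel_measurable_power borel_measurable_diff gm a_measurable vm)
    show "AE x in M01. (\<lambda>n. (v x - ?g n x)\<^sup>2 / a x) \<longlonglongrightarrow> 0"
    proof (rule AE_I2)
      fix x assume "x \<in> space M01"
      then have x: "0 < x" "x < 1" by auto
      have "\<forall>\<^sub>F n in sequentially. c n < min x (1 - x)"
        unfolding c_def using order_tendstoD(2)[OF LIMSEQ_inverse_real_of_nat, of "min x (1 - x)"] x by simp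
      moreover have "\<forall>\<^sub>F n in sequentially. real n \<ge> \<bar>v x\<bar>"
        using eventually_ge_at_top[of "nat \<lceil>\<bar>v x\<bar>\<rceil>"] by eventually_elim linarith
      ultimately have "\<forall>\<^sub>F n in sequentially. (v x - ?g n x)\<^sup>2 / a x = 0"
        by eventually_elim (auto simp: f_def)
      then show "(\<lambda>n. (v x - ?g n x)\<^sup>2 / a x) \<longlonglongrightarrow> 0" by (rule tendsto_eventually)
    qed
    show "AE x in M01. norm ((v x - ?g n x)\<^sup>2 / a x) \<le> (v x)\<^sup>2 / a x" for n
    proof (rule AE_I2)
      fix x assume "x \<in> space M01"
      then have "a x > 0" using a_pos' by simp
      then show "norm ((v x - ?g n x)\<^sup>2 / a x) \<le> (v x)\<^sup>2 / a x"
        using le[of x n] by (simp add: divide_right_mono abs_le_square_iff)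
    qed
  qed (use iv in auto)
  \<comment> \<open>The bounds concern squared norms: two errors of norm below
    \<open>sqrt e / 2\<close> add up to less than \<open>sqrt e\<close>.\<close>
  then have "\<forall>\<^sub>F n in sequentially. (\<integral>x. (v x - ?g n x)\<^sup>2 / a x \<partial>M01) < e / 4"
    using e by (intro order_tendstoD(2)) auto
  then obtain n where n: "(\<integral>x. (v x - ?g n x)\<^sup>2 / a x \<partial>M01) < e / 4" by (auto simp: eventually_sequentially)
  have "\<bar>f n x\<bar> \<le> real n" for x by (auto simp: f_def)
  from test_functions_dense_bounded[OF fm this, of "c n" "1 - c n" "e / 4"]
  obtain \<psi> where \<psi>: "test_function \<psi>" "(\<integral>x. (?g n x - \<psi> x)\<^sup>2 / a x \<partial>M01) < e / 4"
    using e by (auto simp: c_def)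
  have \<psi>a: "\<psi> \<in> L2_inv a" by (rule H20_L2_inv[OF test_function_H20[OF \<psi>(1)]])
  have g: "?g n \<in> L2_inv a"
  proof -
    have "wt (?g n) \<in> L2 {0<..<1}"
    proof (rule L2_bound[OF L2_inv_wt[OF v]])
      show "wt (?g n) \<in> borel_measurable M01"
        unfolding wt_def[abs_def]
        by (intro borel_measurable_divide gm measurable_compose[OF a_measurable borel_measurable_sqrt])
      show "AE x in M01. \<bar>wt (?g n) x\<bar> \<le> \<bar>wt v x\<bar>"
        by (intro AE_I2) (auto simp: wt_def f_def indicator_def abs_divide intro!: divide_right_mono)
    qed
    then show ?thesis using gm by (simp add: L2_inv_iff)
  qed
  note L = L2_inv_lincomb[OF v g, of 1 "-1"] L2_inv_lincomb[OF g \<psi>a, of 1 "-1"]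
  have "sqrt (\<integral>x. (v x - \<psi> x)\<^sup>2 / a x \<partial>M01)
      = sqrt (\<integral>x. (wt (\<lambda>x. 1 * v x + (-1) * ?g n x) x + wt (\<lambda>x. 1 * ?g n x + (-1) * \<psi> x) x)\<^sup>2 \<partial>M01)"
  proof -
    have *: "wt (\<lambda>x. v x - \<psi> x) = (\<lambda>x. wt (\<lambda>x. 1 * v x + (-1) * ?g n x) x + wt (\<lambda>x. 1 * ?g n x + (-1) * \<psi> x) x)"
      by (rule ext) (simp add: wt_def add_divide_distrib[symmetric])
    show ?thesis unfolding integral_wt_square[symmetric, of "\<lambda>x. v x - \<psi> x"] * by (rule refl)
  qed
  also have "\<dots> \<le> sqrt (\<integral>x. (wt (\<lambda>x. 1 * v x + (-1) * ?g n x) x)\<^sup>2 \<partial>M01) + sqrt (\<integral>x. (wt (\<lambda>x. 1 * ?g n x + (-1) * \<psi> x) x)\<^sup>2 \<partial>M01)"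
    by (intro L2_triangle L2_inv_wt L)
  also have "\<dots> = sqrt (\<integral>x. (v x - ?g n x)\<^sup>2 / a x \<partial>M01) + sqrt (\<integral>x. (?g n x - \<psi> x)\<^sup>2 / a x \<partial>M01)"
    unfolding integral_wt_square by simp
  also have "\<dots> < sqrt (e / 4) + sqrt (e / 4)"
    using n \<psi>(2) by (intro add_strict_mono real_sqrt_less_mono)
  also have "\<dots> = sqrt e" using e by (simp add: real_sqrt_divide)
  finally show ?thesis using that \<psi>(1) by simp
qed

text \<open>Test functions serve for both components: those defining \<open>H20\<close> for the
  displacement, those of the density lemma for the velocity. Their fourth derivatives are bounded,
  which places them in \<open>domA\<close>.\<close>

lemma approximating_data_exists:
  assumes "U0 \<in> H0 a" shows "\<exists>U. approximating_data a U0 U"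
proof -
  have U: "fst U0 \<in> H20" "snd U0 \<in> L2_inv a" using assms by (auto simp: H0_iff)
  obtain \<phi> where \<phi>: "\<And>n::nat. test_function (\<phi> n)"
     "(\<lambda>n. \<integral>x. (weak_deriv 2 (fst U0) x - (deriv ^^ 2) (\<phi> n) x)\<^sup>2 \<partial>M01) \<longlonglongrightarrow> 0"
    using U(1) unfolding H20_iff by blast
  have "\<exists>\<psi>. test_function \<psi> \<and> (\<integral>x. (snd U0 x - \<psi> x)\<^sup>2 / a x \<partial>M01) < inverse (real (Suc n))" for n
    using test_functions_dense_L2_inv[OF U(2), of "inverse (real (Suc n))"] by (metis inverse_positive_iff_positive of_nat_0_less_iff zero_less_Suc)
  then obtain \<psi> where \<psi>: "\<And>n. test_function (\<psi> n)"
    "\<And>n. (\<integral>x. (snd U0 x - \<psi> n x)\<^sup>2 / a x \<partial>M01) < inverse (real (Suc n))" by metis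
  have \<psi>0: "(\<lambda>n. \<integral>x. (snd U0 x - \<psi> n x)\<^sup>2 / a x \<partial>M01) \<longlonglongrightarrow> 0"
  proof (rule tendsto_sandwich[OF _ _ tendsto_const LIMSEQ_inverse_real_of_nat])
    show "\<forall>\<^sub>F n in sequentially. 0 \<le> (\<integral>x. (snd U0 x - \<psi> n x)\<^sup>2 / a x \<partial>M01)"
      by (intro always_eventually allI weighted_square_nonneg)
    show "\<forall>\<^sub>F n in sequentially. (\<integral>x. (snd U0 x - \<psi> n x)\<^sup>2 / a x \<partial>M01) \<le> inverse (real (Suc n))"
      by (intro always_eventually allI less_imp_le \<psi>(2))
  qed
  have eq: "H0_dist a (\<phi> n, \<psi> n) U0 = sqrt ((\<integral>x. (weak_deriv 2 (fst U0) x - (deriv ^^ 2) (\<phi> n) x)\<^sup>2 \<partial>M01)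
      + (\<integral>x. (snd U0 x - \<psi> n x)\<^sup>2 / a x \<partial>M01))" for n
  proof -
    have "(\<integral>x. (weak_deriv 2 (\<lambda>x. 1 * \<phi> n x + (-1) * fst U0 x) x)\<^sup>2 \<partial>M01)
        = (\<integral>x. (weak_deriv 2 (fst U0) x - (deriv ^^ 2) (\<phi> n) x)\<^sup>2 \<partial>M01)"
    proof (rule integral_cong_AE)
      note \<phi>H = test_function_H20[OF \<phi>(1)[of n]]
      show "(\<lambda>x. (weak_deriv 2 (\<lambda>x. 1 * \<phi> n x + (-1) * fst U0 x) x)\<^sup>2) \<in> borel_measurable M01"
        by (intro borel_measurable_power L2_measurable H20_D(2) H20_lincomb \<phi>H U)
      show "(\<lambda>x. (weak_deriv 2 (fst U0) x - (deriv ^^ 2) (\<phi> n) x)\<^sup>2) \<in> borel_measurable M01"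
        by (intro borel_measurable_power borel_measurable_diff L2_measurable[OF H20_D(2)[OF U(1)]]
            test_function_measurable test_function_funpow_deriv \<phi>)
      show "AE x in M01. (weak_deriv 2 (\<lambda>x. 1 * \<phi> n x + (-1) * fst U0 x) x)\<^sup>2 = (weak_deriv 2 (fst U0) x - (deriv ^^ 2) (\<phi> n) x)\<^sup>2"
        using weak_deriv_lincomb_AE[OF has_weak_deriv_test_function[OF \<phi>(1)[of n], of 2] H20_D(1)[OF U(1)], of 1 "-1"]
        by eventually_elim (simp add: power2_commute)
    qed
    moreover have "(\<integral>x. (1 * \<psi> n x + (-1) * snd U0 x)\<^sup>2 / a x \<partial>M01) = (\<integral>x. (snd U0 x - \<psi> n x)\<^sup>2 / a x \<partial>M01)"
      by (simp add: power2_commute)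
    ultimately show ?thesis by (simp add: H0_dist_def H0_norm_def lincomb_def)
  qed
  have "approximating_data a U0 (\<lambda>n. (\<phi> n, \<psi> n))"
    unfolding approximating_data_def
  proof
    show "\<forall>n. (\<phi> n, \<psi> n) \<in> wave_dom a"
      using \<phi>(1) \<psi>(1) by (auto simp: wave_dom_iff test_function_domA test_function_H20)
    have "(\<lambda>n. H0_dist a (\<phi> n, \<psi> n) U0) \<longlonglongrightarrow> sqrt (0 + 0)"
      unfolding eq by (intro tendsto_intros \<phi>(2) \<psi>0)
    then show "(\<lambda>n. H0_dist a (\<phi> n, \<psi> n) U0) \<longlonglongrightarrow> 0" by simp
  qed
  then show ?thesis by blast
qed

end

section \<open>Observability\<close>

context degenerate_coefficient
begin

section \<open>Distances in the energy space\<close>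

lemma H0_dist_triangle:
  assumes "U \<in> H0 a" "V \<in> H0 a" "W \<in> H0 a"
  shows "H0_dist a U W \<le> H0_dist a U V + H0_dist a V W"
proof -
  have "lincomb 1 U (-1) W = lincomb 1 (lincomb 1 U (-1) V) 1 (lincomb 1 V (-1) W)"
    by (simp add: lincomb_def)
  then show ?thesis
    using H0_norm_lincomb_le[OF lincomb_H0[OF assms(1,2)] lincomb_H0[OF assms(2,3)], of 1 1 "-1" 1 1 "-1"]
    by (simp add: H0_dist_def)
qed

lemma H0_dist_commute:
  assumes "U \<in> H0 a" "V \<in> H0 a" shows "H0_dist a U V = H0_dist a V U"
proof -
  have *: "H0_dist a U V \<le> H0_dist a V U" if "U \<in> H0 a" "V \<in> H0 a" for U V
  proof -
    have "lincomb 1 U (-1) V = lincomb (-1) (lincomb 1 V (-1) U) 0 U" by (simp add: lincomb_def)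
    then show ?thesis
      using H0_norm_lincomb_le[OF lincomb_H0[OF that(2,1)] that(1), of "-1" 1 "-1" 0] by (simp add: H0_dist_def)
  qed
  show ?thesis using *[OF assms] *[OF assms(2,1)] by simp
qed

lemma H0_dist_nonneg: "H0_dist a U V \<ge> 0"
  by (simp add: H0_dist_def H0_norm_nonneg)

lemma H0_dist_self: assumes "U \<in> H0 a" shows "H0_dist a U U = 0"
proof -
  have "lincomb 1 U (-1) U = lincomb 0 U 0 U" by (simp add: lincomb_def)
  then show ?thesis
    using H0_norm_lincomb_le[OF assms assms, of 0 0] H0_dist_nonneg[of U U] by (simp add: H0_dist_def)
qed

lemma H0_dist_lincomb_le:
  assumes "U \<in> H0 a" "V \<in> H0 a" "U' \<in> H0 a" "V' \<in> H0 a"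
  shows "H0_dist a (lincomb c U d V) (lincomb c U' d V') \<le> \<bar>c\<bar> * H0_dist a U U' + \<bar>d\<bar> * H0_dist a V V'"
proof -
  have "lincomb 1 (lincomb c U d V) (-1) (lincomb c U' d V') = lincomb c (lincomb 1 U (-1) U') d (lincomb 1 V (-1) V')"
    by (simp add: lincomb_def algebra_simps)
  then show ?thesis
    using H0_norm_lincomb_le[OF lincomb_H0[OF assms(1,3)] lincomb_H0[OF assms(2,4)], of c 1 "-1" d 1 "-1"]
    by (simp add: H0_dist_def)
qed

lemma H0_norm_le_dist:
  assumes "U \<in> H0 a" "V \<in> H0 a" shows "H0_norm a U \<le> H0_norm a V + H0_dist a U V"
proof -
  have "U = lincomb 1 V 1 (lincomb 1 U (-1) V)" by (simp add: lincomb_def)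
  then show ?thesis
    using H0_norm_lincomb_le[OF assms(2) lincomb_H0[OF assms(1,2), of 1 "-1"], of 1 1]
    by (metis H0_dist_def abs_1 mult_1)
qed

text \<open>The device by which equality up to distance 0 is used like an equality.\<close>

lemma bounded_form_cong:
  assumes "bounded_form B C" "U \<in> H0 a" "V \<in> H0 a" "W \<in> H0 a" "H0_dist a U V = 0"
  shows "B U W = B V W" "B W U = B W V"
  using bounded_form_diff_le[OF assms(1-4)] assms(5) by simp_all

end

text \<open>Carries one-sided limits at time 0 to two-sided limits at time t.\<close>

lemma filterlim_abs_diff_at_right_0: "filterlim (\<lambda>r. \<bar>r - t\<bar>) (at_right 0) (at (t::real) within A)"
  unfolding filterlim_at
proof
  have "((\<lambda>r. \<bar>r - t\<bar>) \<longlongrightarrow> \<bar>t - t\<bar>) (at t within A)" by (intro tendsto_intros)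
  then show "((\<lambda>r. \<bar>r - t\<bar>) \<longlongrightarrow> 0) (at t within A)" by simp
qed (auto simp: eventually_at_filter)

section \<open>Orbits of the semigroup\<close>

locale wave_semigroup = degenerate_coefficient +
  fixes S :: "real \<Rightarrow> state \<Rightarrow> state"
  assumes contraction: "contraction_semigroup a S" and generated: "generated_by_wave_op a S"
begin

lemma S_H0: "t \<ge> 0 \<Longrightarrow> U \<in> H0 a \<Longrightarrow> S t U \<in> H0 a"
  and S_norm_le: "t \<ge> 0 \<Longrightarrow> U \<in> H0 a \<Longrightarrow> H0_norm a (S t U) \<le> H0_norm a U"
  and S_lincomb: "t \<ge> 0 \<Longrightarrow> U \<in> H0 a \<Longrightarrow> V \<in> H0 a \<Longrightarrow>
    H0_dist a (S t (lincomb c U d V)) (lincomb c (S t U) d (S t V)) = 0"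
  and S_0: "U \<in> H0 a \<Longrightarrow> H0_dist a (S 0 U) U = 0"
  and S_add: "s \<ge> 0 \<Longrightarrow> t \<ge> 0 \<Longrightarrow> U \<in> H0 a \<Longrightarrow> H0_dist a (S (s + t) U) (S s (S t U)) = 0"
  and S_continuous_0: "U \<in> H0 a \<Longrightarrow> ((\<lambda>t. H0_dist a (S t U) U) \<longlongrightarrow> 0) (at_right 0)"
  using contraction unfolding contraction_semigroup_def by blast+

lemma S_dist_le:
  assumes "t \<ge> 0" "U \<in> H0 a" "V \<in> H0 a"
  shows "H0_dist a (S t U) (S t V) \<le> H0_dist a U V"
proof -
  note H = S_H0[OF assms(1,2)] S_H0[OF assms(1,3)] lincomb_H0[OF assms(2,3), of 1 "-1"]
  have "H0_dist a (S t U) (S t V) = H0_norm a (lincomb 1 (S t U) (-1) (S t V))" by (simp add: H0_dist_def)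
  also have "\<dots> \<le> H0_norm a (S t (lincomb 1 U (-1) V)) + H0_dist a (lincomb 1 (S t U) (-1) (S t V)) (S t (lincomb 1 U (-1) V))"
    by (intro H0_norm_le_dist lincomb_H0 H S_H0[OF assms(1)])
  also have "H0_dist a (lincomb 1 (S t U) (-1) (S t V)) (S t (lincomb 1 U (-1) V)) = 0"
    using S_lincomb[OF assms, of 1 "-1"] H0_dist_commute[OF lincomb_H0[OF H(1,2)] S_H0[OF assms(1) H(3)]] by simp
  also have "H0_norm a (S t (lincomb 1 U (-1) V)) \<le> H0_norm a (lincomb 1 U (-1) V)" by (rule S_norm_le[OF assms(1) H(3)])
  finally show ?thesis by (simp add: H0_dist_def)
qed

lemma S_diff_le:
  assumes "s \<ge> 0" "k \<ge> 0" "U \<in> H0 a"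
  shows "H0_dist a (S (s + k) U) (S s U) \<le> H0_dist a (S k U) U"
proof -
  have "H0_dist a (S (s + k) U) (S s U) \<le> H0_dist a (S (s + k) U) (S s (S k U)) + H0_dist a (S s (S k U)) (S s U)"
    using assms by (intro H0_dist_triangle S_H0) auto
  also have "\<dots> \<le> 0 + H0_dist a (S k U) U"
    using assms by (intro add_mono S_dist_le S_H0) (auto simp: S_add)
  finally show ?thesis by simp
qed

text \<open>The earlier of the two times is split off by the semigroup law and discarded by
  contractivity.\<close>

lemma S_modulus:
  assumes "r \<ge> 0" "t \<ge> 0" "U \<in> H0 a"
  shows "H0_dist a (S r U) (S t U) \<le> H0_dist a (S \<bar>r - t\<bar> U) U"
proof (cases "t \<le> r")
  case True
  then show ?thesis using S_diff_le[of t "r - t" U] assms by simp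
next
  case False
  then show ?thesis
    using S_diff_le[of r "t - r" U] assms H0_dist_commute[of "S r U" "S t U"] by (simp add: S_H0)
qed

lemma S_modulus_tendsto:
  assumes "U \<in> H0 a" shows "((\<lambda>r. H0_dist a (S \<bar>r - t\<bar> U) U) \<longlongrightarrow> 0) (at t within A)"
  by (rule filterlim_compose[OF S_continuous_0[OF assms] filterlim_abs_diff_at_right_0])

lemma form_continuous_on:
  assumes B: "bounded_form B C" and U: "U \<in> H0 a"
  shows "continuous_on {0..} (\<lambda>t. B (S t U) (S t U))"
  unfolding continuous_on_def
proof
  fix t :: real assume "t \<in> {0..}"
  then have t: "t \<ge> 0" by simp
  let ?e = "\<lambda>r. H0_dist a (S \<bar>r - t\<bar> U) U"
  note C = bounded_formD(1)[OF B]
  have "((\<lambda>r. B (S r U) (S r U) - B (S t U) (S t U)) \<longlongrightarrow> 0) (at t within {0..})"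
  proof (rule Lim_null_comparison)
    have "((\<lambda>r. C * ?e r * H0_norm a U + C * H0_norm a U * ?e r)
        \<longlongrightarrow> C * 0 * H0_norm a U + C * H0_norm a U * 0) (at t within {0..})"
      by (intro tendsto_intros S_modulus_tendsto U)
    then show "((\<lambda>r. C * ?e r * H0_norm a U + C * H0_norm a U * ?e r) \<longlongrightarrow> 0) (at t within {0..})"
      by simp
    have "norm (B (S r U) (S r U) - B (S t U) (S t U)) \<le> C * ?e r * H0_norm a U + C * H0_norm a U * ?e r"
      if r: "r \<ge> 0" for r
    proof -
      note H = S_H0[OF r U] S_H0[OF t U]
      have "\<bar>B (S r U) (S r U) - B (S t U) (S r U)\<bar> \<le> C * H0_dist a (S r U) (S t U) * H0_norm a (S r U)"
        by (rule bounded_form_diff_le(1)[OF B H H(1)])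
      also have "\<dots> \<le> C * ?e r * H0_norm a U"
        using C by (intro mult_mono S_modulus S_norm_le mult_nonneg_nonneg H0_dist_nonneg H0_norm_nonneg r t U) auto
      finally have 1: "\<bar>B (S r U) (S r U) - B (S t U) (S r U)\<bar> \<le> C * ?e r * H0_norm a U" .
      have "\<bar>B (S t U) (S r U) - B (S t U) (S t U)\<bar> \<le> C * H0_norm a (S t U) * H0_dist a (S r U) (S t U)"
        by (rule bounded_form_diff_le(2)[OF B H H(2)])
      also have "\<dots> \<le> C * H0_norm a U * ?e r"
        using C by (intro mult_mono S_modulus S_norm_le mult_nonneg_nonneg H0_dist_nonneg H0_norm_nonneg r t U) auto
      finally show ?thesis unfolding real_norm_def using 1 by linarith
    qed
    then show "\<forall>\<^sub>F r in at t within {0..}. norm (B (S r U) (S r U) - B (S t U) (S t U))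
        \<le> C * ?e r * H0_norm a U + C * H0_norm a U * ?e r"
      by (auto simp: eventually_at_filter)
  qed
  then show "((\<lambda>t. B (S t U) (S t U)) \<longlongrightarrow> B (S t U) (S t U)) (at t within {0..})"
    by (simp add: LIM_zero_iff)
qed

lemma ip_continuous_on:
  assumes U: "U \<in> H0 a" and P: "P \<in> H0 a"
  shows "continuous_on {0..} (\<lambda>t. ip (S t U) P)"
  unfolding continuous_on_def
proof
  fix t :: real assume "t \<in> {0..}"
  then have t: "t \<ge> 0" by simp
  let ?e = "\<lambda>r. H0_dist a (S \<bar>r - t\<bar> U) U"
  have "((\<lambda>r. ip (S r U) P - ip (S t U) P) \<longlongrightarrow> 0) (at t within {0..})"
  proof (rule Lim_null_comparison)
    have "((\<lambda>r. ?e r * H0_norm a P) \<longlongrightarrow> 0 * H0_norm a P) (at t within {0..})"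
      by (intro tendsto_intros S_modulus_tendsto U)
    then show "((\<lambda>r. ?e r * H0_norm a P) \<longlongrightarrow> 0) (at t within {0..})" by simp
    have "norm (ip (S r U) P - ip (S t U) P) \<le> ?e r * H0_norm a P" if r: "r \<ge> 0" for r
    proof -
      have "\<bar>ip (S r U) P - ip (S t U) P\<bar> \<le> 1 * H0_dist a (S r U) (S t U) * H0_norm a P"
        by (intro bounded_form_diff_le(1)[OF bounded_form_ip] S_H0 r t U P)
      also have "\<dots> \<le> 1 * ?e r * H0_norm a P"
        by (intro mult_mono S_modulus mult_nonneg_nonneg H0_dist_nonneg H0_norm_nonneg r t U) auto
      finally show ?thesis by simp
    qed
    then show "\<forall>\<^sub>F r in at t within {0..}. norm (ip (S r U) P - ip (S t U) P) \<le> ?e r * H0_norm a P"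
      by (auto simp: eventually_at_filter)
  qed
  then show "((\<lambda>t. ip (S t U) P) \<longlongrightarrow> ip (S t U) P) (at t within {0..})"
    by (simp add: LIM_zero_iff)
qed

definition quotient_error :: "state \<Rightarrow> real \<Rightarrow> real" where
  "quotient_error U k = H0_dist a (lincomb (1 / k) (S k U) (- 1 / k) U) (wave_op a U)"

lemma quotient_error_tendsto:
  assumes "U \<in> wave_dom a" shows "((\<lambda>k. quotient_error U k) \<longlongrightarrow> 0) (at_right 0)"
  unfolding quotient_error_def
  using generated assms wave_dom_H0[OF assms] wave_op_H0[OF assms] H0_dist_self[OF wave_op_H0[OF assms]]
  unfolding generated_by_wave_op_def by blast

text \<open>\<open>S s\<close> commutes with the difference quotient and does not expand distances,
  so the error at time 0 bounds the error at every \<open>s\<close>. Left derivatives depend on this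
  uniformity.\<close>

lemma quotient_dist_le:
  assumes U: "U \<in> wave_dom a" and s: "s \<ge> 0" and k: "k > 0"
  shows "H0_dist a (lincomb (1 / k) (S (s + k) U) (- 1 / k) (S s U)) (S s (wave_op a U)) \<le> quotient_error U k"
proof -
  note H = wave_dom_H0[OF U] wave_op_H0[OF U]
  have k0: "k \<ge> 0" "s + k \<ge> 0" using s k by auto
  note HS = S_H0[OF k0(1) H(1)] S_H0[OF s H(1)] S_H0[OF k0(2) H(1)] S_H0[OF s S_H0[OF k0(1) H(1)]]
  let ?D = "lincomb (1 / k) (S k U) (- 1 / k) U"
  have D: "?D \<in> H0 a" by (intro lincomb_H0 HS H)
  let ?L = "lincomb (1 / k) (S (s + k) U) (- 1 / k) (S s U)"
  let ?L' = "lincomb (1 / k) (S s (S k U)) (- 1 / k) (S s U)"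
  have L: "?L \<in> H0 a" "?L' \<in> H0 a" by (intro lincomb_H0 HS)+
  have "H0_dist a ?L ?L' \<le> \<bar>1 / k\<bar> * H0_dist a (S (s + k) U) (S s (S k U)) + \<bar>- 1 / k\<bar> * H0_dist a (S s U) (S s U)"
    by (intro H0_dist_lincomb_le HS)
  also have "\<dots> = 0" using S_add[OF s k0(1) H(1)] H0_dist_self[OF HS(2)] by simp
  finally have 1: "H0_dist a ?L ?L' \<le> 0" .
  have 2: "H0_dist a ?L' (S s ?D) = 0"
    using S_lincomb[OF s HS(1) H(1), of "1 / k" "- 1 / k"] H0_dist_commute[OF L(2) S_H0[OF s D]] by simp
  have 3: "H0_dist a (S s ?D) (S s (wave_op a U)) \<le> quotient_error U k"
    unfolding quotient_error_def by (intro S_dist_le s D H)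
  have "H0_dist a ?L (S s (wave_op a U)) \<le> H0_dist a ?L ?L' + H0_dist a ?L' (S s (wave_op a U))"
    by (intro H0_dist_triangle L S_H0[OF s H(2)])
  also have "H0_dist a ?L' (S s (wave_op a U)) \<le> H0_dist a ?L' (S s ?D) + H0_dist a (S s ?D) (S s (wave_op a U))"
    by (intro H0_dist_triangle L S_H0[OF s H(2)] S_H0[OF s D])
  finally show ?thesis using 1 2 3 by simp
qed

text \<open>The generator is prescribed as a graph: once the quotients at \<open>S t U\<close> are
  seen to converge to \<open>S t (wave_op a U)\<close>, membership in the domain and commutation
  follow together.\<close>

lemma S_wave_dom:
  assumes U: "U \<in> wave_dom a" and t: "t \<ge> 0"
  shows "S t U \<in> wave_dom a" "H0_dist a (wave_op a (S t U)) (S t (wave_op a U)) = 0"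
proof -
  note H = S_H0[OF t wave_dom_H0[OF U]] S_H0[OF t wave_op_H0[OF U]]
  have "((\<lambda>k. H0_dist a (lincomb (1 / k) (S k (S t U)) (- 1 / k) (S t U)) (S t (wave_op a U))) \<longlongrightarrow> 0) (at_right 0)"
  proof (rule Lim_null_comparison[OF _ quotient_error_tendsto[OF U]])
    have "H0_dist a (lincomb (1 / k) (S k (S t U)) (- 1 / k) (S t U)) (S t (wave_op a U)) \<le> quotient_error U k"
      if k: "k > 0" for k
    proof -
      have k0: "k \<ge> 0" "t + k \<ge> 0" using k t by auto
      note HS = S_H0[OF k0(1) H(1)] S_H0[OF k0(2) wave_dom_H0[OF U]]
      let ?L = "lincomb (1 / k) (S k (S t U)) (- 1 / k) (S t U)"
      let ?L' = "lincomb (1 / k) (S (t + k) U) (- 1 / k) (S t U)"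
      have L: "?L \<in> H0 a" "?L' \<in> H0 a" by (intro lincomb_H0 HS H)+
      have "H0_dist a ?L ?L' \<le> \<bar>1 / k\<bar> * H0_dist a (S k (S t U)) (S (t + k) U) + \<bar>- 1 / k\<bar> * H0_dist a (S t U) (S t U)"
        by (intro H0_dist_lincomb_le HS H)
      also have "\<dots> = 0"
        using S_add[OF k0(1) t wave_dom_H0[OF U]] H0_dist_commute[OF HS] H0_dist_self[OF H(1)] by (simp add: add.commute)
      finally show ?thesis
        using H0_dist_triangle[OF L H(2)] quotient_dist_le[OF U t k] by simp
    qed
    then show "\<forall>\<^sub>F k in at_right 0. norm (H0_dist a (lincomb (1 / k) (S k (S t U)) (- 1 / k) (S t U)) (S t (wave_op a U)))
        \<le> quotient_error U k"
      by (auto simp: eventually_at_filter H0_dist_nonneg)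
  qed
  then show "S t U \<in> wave_dom a" "H0_dist a (wave_op a (S t U)) (S t (wave_op a U)) = 0"
    using generated H unfolding generated_by_wave_op_def by blast+
qed

text \<open>The generator only provides right derivatives; since \<open>S\<close> is contractive, the difference
  quotients converge uniformly along the orbit, hence also from the left.\<close>

lemma form_has_derivative:
  assumes B: "bounded_form B C" and U: "U \<in> wave_dom a" and t: "t > 0"
  shows "((\<lambda>t. B (S t U) (S t U)) has_real_derivative
    B (wave_op a (S t U)) (S t U) + B (S t U) (wave_op a (S t U))) (at t)"
proof -
  let ?F = "wave_op a U"
  note H = wave_dom_H0[OF U] wave_op_H0[OF U]
  have t0: "t \<ge> 0" using t by simp
  note C = bounded_formD(1)[OF B]
  note HT = S_H0[OF t0 H(1)] S_H0[OF t0 H(2)]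
  let ?Q = "\<lambda>t. B (S t U) (S t U)"
  let ?q = "B (S t ?F) (S t U) + B (S t U) (S t ?F)"
  let ?e = "\<lambda>k. H0_dist a (S k U) U"
  \<comment> \<open>The first summand is the error of a quotient based at the earlier of the two
    times, the second the change of the derivative between them.\<close>
  let ?\<delta> = "\<lambda>k. quotient_error U k + H0_dist a (S k ?F) ?F"
  let ?b = "\<lambda>k. C * (H0_norm a ?F + ?\<delta> k) * ?e k + 2 * (C * ?\<delta> k * H0_norm a U)"
  have \<delta>: "?\<delta> k \<ge> 0" for k by (simp add: quotient_error_def H0_dist_nonneg)
  have bound: "\<bar>(?Q r - ?Q t) / (r - t) - ?q\<bar> \<le> ?b \<bar>r - t\<bar>" if r: "r \<ge> 0" "r \<noteq> t" for r
  proof -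
    note HR = S_H0[OF r(1) H(1)]
    define k where "k = \<bar>r - t\<bar>"
    have k: "k > 0" "k \<ge> 0" using r by (auto simp: k_def)
    define D where "D = lincomb (1 / (r - t)) (S r U) (- 1 / (r - t)) (S t U)"
    have D: "D \<in> H0 a" unfolding D_def by (intro lincomb_H0 HR HT)
    have DF: "H0_dist a D (S t ?F) \<le> ?\<delta> k"
    proof (cases "t < r")
      case True
      then have "D = lincomb (1 / k) (S (t + k) U) (- 1 / k) (S t U)" by (simp add: D_def k_def)
      then show ?thesis using quotient_dist_le[OF U t0 k(1)] H0_dist_nonneg[of "S k ?F" ?F] by simp
    next
      case False
      \<comment> \<open>For \<open>r < t\<close> the quotient is the forward one based at
        \<open>r\<close>; its limit \<open>S r ?F\<close> is then moved to
        \<open>S t ?F\<close>.\<close>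
      then have *: "t = r + k" "r - t = - k" using r by (auto simp: k_def)
      have "D = lincomb (1 / k) (S (r + k) U) (- 1 / k) (S r U)"
        unfolding D_def *(2) *(1)[symmetric] by (simp add: lincomb_def add.commute)
      then have "H0_dist a D (S r ?F) \<le> quotient_error U k" using quotient_dist_le[OF U r(1) k(1)] by simp
      moreover have "H0_dist a (S r ?F) (S t ?F) \<le> H0_dist a (S k ?F) ?F"
        using S_modulus[OF r(1) t0 H(2)] by (simp add: k_def)
      ultimately show ?thesis
        using H0_dist_triangle[OF D S_H0[OF r(1) H(2)] HT(2)] by simp
    qed
    have Dn: "H0_norm a D \<le> H0_norm a ?F + ?\<delta> k"
      using H0_norm_le_dist[OF D HT(2)] DF S_norm_le[OF t0 H(2)] by simp
    have "(?Q r - ?Q t) / (r - t) = B D (S r U) + B (S t U) D"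
      unfolding D_def bounded_formD(2)[OF B HR HT(1) HR] bounded_formD(3)[OF B HR HT(1) HT(1)]
      by (simp add: diff_divide_distrib)
    then have "(?Q r - ?Q t) / (r - t) - ?q
        = (B D (S r U) - B D (S t U)) + (B D (S t U) - B (S t ?F) (S t U)) + (B (S t U) D - B (S t U) (S t ?F))"
      by simp
    moreover have "\<bar>B D (S r U) - B D (S t U)\<bar> \<le> C * (H0_norm a ?F + ?\<delta> k) * ?e k"
    proof -
      have "\<bar>B D (S r U) - B D (S t U)\<bar> \<le> C * H0_norm a D * H0_dist a (S r U) (S t U)"
        by (rule bounded_form_diff_le(2)[OF B HR HT(1) D])
      also have "\<dots> \<le> C * (H0_norm a ?F + ?\<delta> k) * ?e k"
        using C \<delta>[of k] H0_norm_nonneg[of ?F] S_modulus[OF r(1) t0 H(1)]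
        by (intro mult_mono Dn mult_nonneg_nonneg H0_norm_nonneg H0_dist_nonneg) (auto simp: k_def)
      finally show ?thesis .
    qed
    moreover have "\<bar>B D (S t U) - B (S t ?F) (S t U)\<bar> \<le> C * ?\<delta> k * H0_norm a U"
    proof -
      have "\<bar>B D (S t U) - B (S t ?F) (S t U)\<bar> \<le> C * H0_dist a D (S t ?F) * H0_norm a (S t U)"
        by (rule bounded_form_diff_le(1)[OF B D HT(2) HT(1)])
      also have "\<dots> \<le> C * ?\<delta> k * H0_norm a U"
        using C \<delta>[of k] by (intro mult_mono DF mult_nonneg_nonneg H0_norm_nonneg H0_dist_nonneg S_norm_le t0 H) auto
      finally show ?thesis .
    qed
    moreover have "\<bar>B (S t U) D - B (S t U) (S t ?F)\<bar> \<le> C * ?\<delta> k * H0_norm a U"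
    proof -
      have "\<bar>B (S t U) D - B (S t U) (S t ?F)\<bar> \<le> C * H0_norm a (S t U) * H0_dist a D (S t ?F)"
        by (rule bounded_form_diff_le(2)[OF B D HT(2) HT(1)])
      also have "\<dots> \<le> C * H0_norm a U * ?\<delta> k"
        using C \<delta>[of k] by (intro mult_mono DF mult_nonneg_nonneg H0_norm_nonneg H0_dist_nonneg S_norm_le t0 H) auto
      finally show ?thesis by (simp add: mult_ac)
    qed
    ultimately show ?thesis unfolding k_def[symmetric] by linarith
  qed
  have \<delta>0: "(?\<delta> \<longlongrightarrow> 0) (at_right 0)"
    using tendsto_add[OF quotient_error_tendsto[OF U] S_continuous_0[OF H(2)]] by simp
  have "(?b \<longlongrightarrow> C * (H0_norm a ?F + 0) * 0 + 2 * (C * 0 * H0_norm a U)) (at_right 0)"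
    by (intro tendsto_intros \<delta>0 S_continuous_0 H)
  then have b0: "(?b \<longlongrightarrow> 0) (at_right 0)" by simp
  have "((\<lambda>r. (?Q r - ?Q t) / (r - t) - ?q) \<longlongrightarrow> 0) (at t)"
  proof (rule Lim_null_comparison[OF _ filterlim_compose[OF b0 filterlim_abs_diff_at_right_0]])
    have "\<forall>\<^sub>F r in at t. r \<in> {0<..}" using t by (intro eventually_at_in_open') auto
    moreover have "\<forall>\<^sub>F r in at t. r \<noteq> t" by (simp add: eventually_at_filter)
    ultimately show "\<forall>\<^sub>F r in at t. norm ((?Q r - ?Q t) / (r - t) - ?q) \<le> ?b \<bar>r - t\<bar>"
      by eventually_elim (use bound in auto)
  qed
  then have "(?Q has_real_derivative ?q) (at t)"
    by (simp add: LIM_zero_iff has_field_derivative_iff)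
  moreover have "?q = B (wave_op a (S t U)) (S t U) + B (S t U) (wave_op a (S t U))"
    using bounded_form_cong[OF B wave_op_H0[OF S_wave_dom(1)[OF U t0]] HT(2) HT(1) S_wave_dom(2)[OF U t0]] by simp
  ultimately show ?thesis by simp
qed

lemma energy_conservation:
  assumes U: "U \<in> wave_dom a" and t: "t \<ge> 0"
  shows "ip (S t U) (S t U) = ip U U"
proof -
  have "ip (S t U) (S t U) = ip (S 0 U) (S 0 U)"
  proof (cases "t = 0")
    case False
    then have t: "0 < t" using t by simp
    show ?thesis
    proof (rule DERIV_isconst_end[of 0 t "\<lambda>t. ip (S t U) (S t U)", OF t])
      show "continuous_on {0..t} (\<lambda>t. ip (S t U) (S t U))"
        by (rule continuous_on_subset[OF form_continuous_on[OF bounded_form_ip wave_dom_H0[OF U]]]) auto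
      fix r assume "0 < r" "r < t"
      then show "((\<lambda>t. ip (S t U) (S t U)) has_real_derivative 0) (at r)"
        using form_has_derivative[OF bounded_form_ip U, of r] wave_op_skew[OF S_wave_dom(1)[OF U, of r]]
        by (simp add: ip_commute[of "wave_op a (S r U)"])
    qed
  qed simp
  \<comment> \<open>\<open>S 0 U\<close> equals \<open>U\<close> up to distance 0, so the form has
    to absorb the difference.\<close>
  also have "\<dots> = ip U U"
    using bounded_form_cong[OF bounded_form_ip S_H0[OF order_refl wave_dom_H0[OF U]] wave_dom_H0[OF U] _ S_0[OF wave_dom_H0[OF U]]]
      wave_dom_H0[OF U] S_H0[OF order_refl wave_dom_H0[OF U]] by simp
  finally show ?thesis .
qed

section \<open>Traces of classical solutions\<close>

lemma classical_trace_eq: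
  assumes U: "U \<in> wave_dom a" and t: "t \<ge> 0"
  shows "classical_trace S U t = - ip (S t (wave_op a U)) trace_state"
  unfolding classical_trace_def trace_eq_ip[OF S_wave_dom(1)[OF assms]]
  using bounded_form_cong(1)[OF bounded_form_ip wave_op_H0[OF S_wave_dom(1)[OF assms]]
      S_H0[OF t wave_op_H0[OF U]] trace_state_H0 S_wave_dom(2)[OF assms]] by simp

text \<open>Once \<open>S t\<close> has been moved past the generator, the trace is a pairing of a
  fixed state with an orbit that is continuous in the energy space. Measurability and integrability
  of the trace in time rest on this.\<close>

lemma classical_trace_continuous_on:
  assumes U: "U \<in> wave_dom a" shows "continuous_on {0..} (classical_trace S U)"
proof -
  have "continuous_on {0..} (\<lambda>t. - ip (S t (wave_op a U)) trace_state)"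
    by (intro continuous_intros ip_continuous_on wave_op_H0 U trace_state_H0)
  then show ?thesis by (rule continuous_on_eq) (simp add: classical_trace_eq[OF U])
qed

text \<open>The elastic coefficient 2 and the kinetic coefficient \<open>2 - x a' / a\<close> both
  lie between \<open>2 - K\<close> and 4, and the sum of the two energies is constant in
  time.\<close>

lemma virial_derivative_bounds:
  assumes U: "U \<in> wave_dom a" and t: "t > 0"
  obtains y where "((\<lambda>t. virial (S t U) (S t U)) has_real_derivative y) (at t)"
    "2 * y \<le> (classical_trace S U t)\<^sup>2 - (2 - K) * ip U U"
    "2 * y \<ge> (classical_trace S U t)\<^sup>2 - 4 * ip U U"
proof -
  have t0: "t \<ge> 0" using t by simp
  note D = S_wave_dom(1)[OF U t0]
  let ?g = "\<integral>x. (weak_deriv 2 (fst (S t U)) x)\<^sup>2 \<partial>M01" and ?v = "\<integral>x. (snd (S t U) x)\<^sup>2 / a x \<partial>M01"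
  have v: "snd (S t U) \<in> L2_inv a" using wave_dom_H0[OF D] by (simp add: H0_iff)
  have E: "ip U U = ?g + ?v" using energy_conservation[OF U t0] by (simp add: ip_self)
  note wk = weighted_kinetic_bounds[OF v]
  have g: "?g \<ge> 0" by simp
  let ?y = "1 / 2 * (classical_trace S U t)\<^sup>2 - ?g - 1 / 2 * weighted_kinetic (snd (S t U))"
  have "((\<lambda>t. virial (S t U) (S t U)) has_real_derivative ?y) (at t)"
    using form_has_derivative[OF bounded_form_virial U t] unfolding virial_identity[OF D] classical_trace_def .
  moreover have "(2 - K) * ?g \<le> 2 * ?g" using K by (intro mult_right_mono g) auto
  then have "2 * ?y \<le> (classical_trace S U t)\<^sup>2 - (2 - K) * ip U U" using wk(1) E by (simp add: algebra_simps)
  moreover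
  have "(2 + K) * ?v \<le> 4 * ?v" using K by (intro mult_right_mono weighted_square_nonneg) auto
  note kv = this
  have "w \<le> m \<Longrightarrow> m \<le> 4 * v \<Longrightarrow> 0 \<le> g \<Longrightarrow> \<tau> - 4 * (g + v) \<le> 2 * (1 / 2 * \<tau> - g - 1 / 2 * w)"
    for w m v g \<tau> :: real by argo
  from this[OF wk(2) kv g] have "2 * ?y \<ge> (classical_trace S U t)\<^sup>2 - 4 * ip U U" unfolding E .
  ultimately show ?thesis by (rule that)
qed

lemma classical_trace_L2:
  assumes U: "U \<in> wave_dom a" and T: "T > 0"
  shows "classical_trace S U \<in> L2 {0<..<T}"
    "(\<integral>t. (classical_trace S U t)\<^sup>2 \<partial>lebesgue_on {0<..<T}) = integral {0..T} (\<lambda>t. (classical_trace S U t)\<^sup>2)"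
proof -
  have c: "continuous_on {0..T} (\<lambda>t. (classical_trace S U t)\<^sup>2)"
    by (intro continuous_intros continuous_on_subset[OF classical_trace_continuous_on[OF U]]) auto
  have "integrable (lebesgue_on {0<..<T}) (\<lambda>t. (classical_trace S U t)\<^sup>2)"
  proof -
    have "(\<lambda>t. (classical_trace S U t)\<^sup>2) absolutely_integrable_on {0..T}"
      by (rule absolutely_integrable_continuous_real[OF c])
    then have "(\<lambda>t. (classical_trace S U t)\<^sup>2) absolutely_integrable_on {0<..<T}"
      by (rule set_integrable_subset) auto
    then show ?thesis by (rule absolutely_integrable_imp_integrable) auto
  qed
  moreover have "classical_trace S U \<in> borel_measurable (lebesgue_on {0<..<T})"
    by (rule continuous_imp_measurable_on_sets_lebesgue[OF continuous_on_subset[OF classical_trace_continuous_on[OF U]]]) auto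
  ultimately show "classical_trace S U \<in> L2 {0<..<T}"
    "(\<integral>t. (classical_trace S U t)\<^sup>2 \<partial>lebesgue_on {0<..<T}) = integral {0..T} (\<lambda>t. (classical_trace S U t)\<^sup>2)"
    by (simp_all add: L2_def lebesgue_integral_eq_integral integral_open_interval_real)
qed

text \<open>Auxiliary functions with a nonnegative derivative take the place of an integration of
  \<Phi>', of which only pointwise bounds enter. The two end values of \<open>2 * \<Phi>\<close>
  contribute at most \<open>M * ip U U\<close> each, hence \<open>2 * M\<close>.\<close>

lemma observability_classical:
  assumes U: "U \<in> wave_dom a" and T: "T > 0"
  defines "M \<equiv> max 1 (4 / a 1)"
  defines "I \<equiv> (\<integral>t. (classical_trace S U t)\<^sup>2 \<partial>lebesgue_on {0<..<T})"
  shows "((2 - K) * T - 2 * M) * ip U U \<le> I" "I \<le> (4 * T + 2 * M) * ip U U"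
proof -
  let ?\<tau> = "classical_trace S U" and ?\<Phi> = "\<lambda>t. virial (S t U) (S t U)"
  let ?P = "\<lambda>t. integral {0..t} (\<lambda>t. (?\<tau> t)\<^sup>2)"
  have c: "continuous_on {0..T} (\<lambda>t. (?\<tau> t)\<^sup>2)"
    by (intro continuous_intros continuous_on_subset[OF classical_trace_continuous_on[OF U]]) auto
  have cP: "continuous_on {0..T} ?P"
    by (intro indefinite_integral_continuous_1 integrable_continuous_real c)
  have c\<Phi>: "continuous_on {0..T} ?\<Phi>"
    by (rule continuous_on_subset[OF form_continuous_on[OF bounded_form_virial wave_dom_H0[OF U]]]) auto
  have dP: "(?P has_real_derivative (?\<tau> t)\<^sup>2) (at t)" if t: "0 < t" "t < T" for t
  proof -
    have "(?P has_vector_derivative (?\<tau> t)\<^sup>2) (at t within {0..T})"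
      using t by (intro integral_has_vector_derivative c) auto
    moreover have "at t within {0..T} = at t" using t by (intro at_within_interior) auto
    ultimately show ?thesis by (simp add: has_real_derivative_iff_has_vector_derivative)
  qed
  have \<Phi>: "\<bar>?\<Phi> t\<bar> \<le> 1 / 2 * M * ip U U" if "t \<ge> 0" for t
    using virial_self_le[OF S_H0[OF that wave_dom_H0[OF U]]] unfolding energy_conservation[OF U that] M_def .
  have P: "?P T = I" "?P 0 = 0" using classical_trace_L2(2)[OF U T] by (auto simp: I_def)
  have "(\<lambda>t. ?P t - 2 * ?\<Phi> t - (2 - K) * ip U U * t) 0 \<le> (\<lambda>t. ?P t - 2 * ?\<Phi> t - (2 - K) * ip U U * t) T"
  proof (rule DERIV_nonneg_imp_increasing_open[where f="\<lambda>t. ?P t - 2 * ?\<Phi> t - (2 - K) * ip U U * t"])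
    show "continuous_on {0..T} (\<lambda>t. ?P t - 2 * ?\<Phi> t - (2 - K) * ip U U * t)"
      by (intro continuous_intros cP c\<Phi>)
    fix t assume t: "0 < t" "t < T"
    obtain y where y: "(?\<Phi> has_real_derivative y) (at t)" "2 * y \<le> (?\<tau> t)\<^sup>2 - (2 - K) * ip U U"
      using virial_derivative_bounds[OF U t(1)] by blast
    have "((\<lambda>t. ?P t - 2 * ?\<Phi> t - (2 - K) * ip U U * t) has_real_derivative ((?\<tau> t)\<^sup>2 - 2 * y - (2 - K) * ip U U)) (at t)"
      by (rule DERIV_diff[OF DERIV_diff[OF dP[OF t] DERIV_cmult[OF y(1)]] DERIV_cmult_Id])
    then show "\<exists>z. ((\<lambda>t. ?P t - 2 * ?\<Phi> t - (2 - K) * ip U U * t) has_real_derivative z) (at t) \<and> 0 \<le> z"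
      using y(2) by (intro exI conjI) auto
  qed (use T in simp)
  then show "((2 - K) * T - 2 * M) * ip U U \<le> I"
    using \<Phi>[of 0] \<Phi>[of T] T P by (simp add: algebra_simps)
  have "(\<lambda>t. 2 * ?\<Phi> t + 4 * ip U U * t - ?P t) 0 \<le> (\<lambda>t. 2 * ?\<Phi> t + 4 * ip U U * t - ?P t) T"
  proof (rule DERIV_nonneg_imp_increasing_open[where f="\<lambda>t. 2 * ?\<Phi> t + 4 * ip U U * t - ?P t"])
    show "continuous_on {0..T} (\<lambda>t. 2 * ?\<Phi> t + 4 * ip U U * t - ?P t)"
      by (intro continuous_intros cP c\<Phi>)
    fix t assume t: "0 < t" "t < T"
    obtain y where y: "(?\<Phi> has_real_derivative y) (at t)" "2 * y \<ge> (?\<tau> t)\<^sup>2 - 4 * ip U U"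
      using virial_derivative_bounds[OF U t(1)] by blast
    have "((\<lambda>t. 2 * ?\<Phi> t + 4 * ip U U * t - ?P t) has_real_derivative (2 * y + 4 * ip U U - (?\<tau> t)\<^sup>2)) (at t)"
      by (rule DERIV_diff[OF DERIV_add[OF DERIV_cmult[OF y(1)] DERIV_cmult_Id] dP[OF t]])
    then show "\<exists>z. ((\<lambda>t. 2 * ?\<Phi> t + 4 * ip U U * t - ?P t) has_real_derivative z) (at t) \<and> 0 \<le> z"
      using y(2) by (intro exI conjI) auto
  qed (use T in simp)
  then show "I \<le> (4 * T + 2 * M) * ip U U"
    using \<Phi>[of 0] \<Phi>[of T] T P by (simp add: algebra_simps)
qed

text \<open>The orbit of the difference is at distance 0 from the difference of the orbits; the
  displacements then agree almost everywhere, which leaves the trace unchanged.\<close>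

lemma classical_trace_diff:
  assumes U: "U \<in> wave_dom a" and V: "V \<in> wave_dom a" and t: "t \<ge> 0"
  shows "classical_trace S (lincomb 1 U (-1) V) t = classical_trace S U t - classical_trace S V t"
proof -
  let ?L = "lincomb 1 (S t U) (-1) (S t V)"
  note D = S_wave_dom(1)[OF U t] S_wave_dom(1)[OF V t]
  note L = wave_dom_lincomb[OF D, of 1 "-1"]
  note SL = S_wave_dom(1)[OF wave_dom_lincomb[OF U V, of 1 "-1"] t]
  have "second_deriv_at_1 (fst ?L) = second_deriv_at_1 (fst (S t (lincomb 1 U (-1) V)))"
    using H0_dist_0_AE[OF wave_dom_H0[OF SL] wave_dom_H0[OF L] S_lincomb[OF t wave_dom_H0[OF U] wave_dom_H0[OF V]]] L SL
    by (intro second_deriv_at_1_cong_AE) (auto simp: wave_dom_iff domA_D(1))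
  moreover have "second_deriv_at_1 (fst ?L) = 1 * second_deriv_at_1 (fst (S t U)) + (-1) * second_deriv_at_1 (fst (S t V))"
    using second_deriv_at_1_lincomb[of "fst (S t U)" "fst (S t V)" 1 "-1"] D by (simp add: lincomb_def wave_dom_iff)
  ultimately show ?thesis by (simp add: classical_trace_def)
qed

text \<open>Hidden regularity applied to a difference of solutions: the trace map is Lipschitz from
  the energy norm to L2 in time.\<close>

lemma classical_trace_diff_le:
  assumes U: "U \<in> wave_dom a" and V: "V \<in> wave_dom a" and T: "T > 0"
  shows "(\<integral>t. (classical_trace S U t - classical_trace S V t)\<^sup>2 \<partial>lebesgue_on {0<..<T})
    \<le> (4 * T + 2 * max 1 (4 / a 1)) * (H0_dist a U V)\<^sup>2"
proof -
  have "(\<integral>t. (classical_trace S U t - classical_trace S V t)\<^sup>2 \<partial>lebesgue_on {0<..<T})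
      = (\<integral>t. (classical_trace S (lincomb 1 U (-1) V) t)\<^sup>2 \<partial>lebesgue_on {0<..<T})"
    by (rule Bochner_Integration.integral_cong) (auto simp: classical_trace_diff[OF U V])
  also have "\<dots> \<le> (4 * T + 2 * max 1 (4 / a 1)) * ip (lincomb 1 U (-1) V) (lincomb 1 U (-1) V)"
    by (rule observability_classical(2)[OF wave_dom_lincomb[OF U V] T])
  finally show ?thesis by (simp add: H0_dist_def H0_norm_square)
qed

section \<open>Passage to mild solutions\<close>

lemma approximating_dist_tendsto_0:
  assumes "U0 \<in> H0 a" "approximating_data a U0 U" "approximating_data a U0 V"
  shows "(\<lambda>n. H0_dist a (U n) (V n)) \<longlonglongrightarrow> 0"
proof (rule tendsto_sandwich[OF _ _ tendsto_const])
  have U: "U n \<in> H0 a" "V n \<in> H0 a" for n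
    using assms(2,3) by (auto simp: approximating_data_def wave_dom_H0)
  show "\<forall>\<^sub>F n in sequentially. H0_dist a (U n) (V n) \<le> H0_dist a (U n) U0 + H0_dist a (V n) U0"
    using H0_dist_triangle[OF U(1) assms(1) U(2)] H0_dist_commute[OF assms(1) U(2)] by simp
  have "(\<lambda>n. H0_dist a (U n) U0 + H0_dist a (V n) U0) \<longlonglongrightarrow> 0 + 0"
    using assms(2,3) by (intro tendsto_add) (auto simp: approximating_data_def)
  then show "(\<lambda>n. H0_dist a (U n) U0 + H0_dist a (V n) U0) \<longlonglongrightarrow> 0" by simp
qed (simp add: H0_dist_nonneg)

text \<open>One approximating sequence produces \<open>h\<close> by completeness. Any other
  approaches it in the energy norm, so by the Lipschitz bound its traces have the same limit, as
  \<open>is_mild_trace\<close> demands.\<close>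

lemma mild_trace_exists:
  assumes U0: "U0 \<in> H0 a" and T: "T > 0"
  obtains h U where "is_mild_trace a S T U0 h" "approximating_data a U0 U"
    "(\<lambda>n. \<integral>t. (classical_trace S (U n) t)\<^sup>2 \<partial>lebesgue_on {0<..<T}) \<longlonglongrightarrow> (\<integral>t. (h t)\<^sup>2 \<partial>lebesgue_on {0<..<T})"
proof -
  let ?c = "4 * T + 2 * max 1 (4 / a 1)"
  have c: "?c > 0" using T by (simp add: add_pos_pos)
  obtain U where U: "approximating_data a U0 U" using approximating_data_exists[OF U0] by blast
  have D: "V n \<in> wave_dom a" if "approximating_data a U0 V" for V n
    using that by (simp add: approximating_data_def)
  have Cauchy: "\<exists>N. \<forall>m\<ge>N. \<forall>n\<ge>N. (\<integral>t. (classical_trace S (U m) t - classical_trace S (U n) t)\<^sup>2 \<partial>lebesgue_on {0<..<T}) < e"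
    if e: "e > 0" for e
  proof -
    \<comment> \<open>Chosen so that the Lipschitz bound at distance \<open>2 * d\<close> is exactly
      \<open>e\<close>.\<close>
    define d where "d = sqrt (e / ?c) / 2"
    have d: "d > 0" using e c by (simp add: d_def)
    have "\<forall>\<^sub>F n in sequentially. H0_dist a (U n) U0 < d"
      using U d by (intro order_tendstoD(2)) (auto simp: approximating_data_def)
    then obtain N where N: "\<And>n. n \<ge> N \<Longrightarrow> H0_dist a (U n) U0 < d" by (auto simp: eventually_sequentially)
    have "(\<integral>t. (classical_trace S (U m) t - classical_trace S (U n) t)\<^sup>2 \<partial>lebesgue_on {0<..<T}) < e"
      if mn: "m \<ge> N" "n \<ge> N" for m n
    proof -
      note H = wave_dom_H0[OF D[OF U, of m]] wave_dom_H0[OF D[OF U, of n]]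
      have "H0_dist a (U m) (U n) < 2 * d"
        using H0_dist_triangle[OF H(1) U0 H(2)] H0_dist_commute[OF U0 H(2)] N[OF mn(1)] N[OF mn(2)] by simp
      then have "(H0_dist a (U m) (U n))\<^sup>2 < (2 * d)\<^sup>2"
        by (intro power_strict_mono H0_dist_nonneg) auto
      also have "(2 * d)\<^sup>2 = e / ?c" using e c by (simp add: d_def)
      finally have "?c * (H0_dist a (U m) (U n))\<^sup>2 < ?c * (e / ?c)" using c by (intro mult_strict_left_mono)
      also have "\<dots> = e" using c by simp
      finally show ?thesis
        using classical_trace_diff_le[OF D[OF U, of m] D[OF U, of n] T] by linarith
    qed
    then show ?thesis by blast
  qed
  have fin: "finite_measure (lebesgue_on {0<..<T})" by (rule finite_measure_lebesgue_on) auto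
  note L = classical_trace_L2(1)[OF D T]
  obtain h where h: "h \<in> L2 {0<..<T}" "(\<lambda>n. \<integral>t. (classical_trace S (U n) t - h t)\<^sup>2 \<partial>lebesgue_on {0<..<T}) \<longlonglongrightarrow> 0"
    using L2_complete[OF fin L[OF U] Cauchy] by blast
  have conv: "(\<lambda>n. \<integral>t. (classical_trace S (V n) t - h t)\<^sup>2 \<partial>lebesgue_on {0<..<T}) \<longlonglongrightarrow> 0"
    if V: "approximating_data a U0 V" for V
  proof -
    have "(\<lambda>n. \<integral>t. (classical_trace S (V n) t - classical_trace S (U n) t)\<^sup>2 \<partial>lebesgue_on {0<..<T}) \<longlonglongrightarrow> 0"
    proof (rule tendsto_sandwich[OF _ _ tendsto_const])
      show "\<forall>\<^sub>F n in sequentially. (\<integral>t. (classical_trace S (V n) t - classical_trace S (U n) t)\<^sup>2 \<partial>lebesgue_on {0<..<T})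
          \<le> ?c * (H0_dist a (V n) (U n))\<^sup>2"
        by (intro always_eventually allI classical_trace_diff_le D U V T)
      have "(\<lambda>n. ?c * (H0_dist a (V n) (U n))\<^sup>2) \<longlonglongrightarrow> ?c * 0\<^sup>2"
        by (intro tendsto_intros approximating_dist_tendsto_0[OF U0 V U])
      then show "(\<lambda>n. ?c * (H0_dist a (V n) (U n))\<^sup>2) \<longlonglongrightarrow> 0" by simp
    qed simp
    from L2_lincomb_tendsto_0[OF L2_diff[OF L[OF V] L[OF U]] L2_diff[OF L[OF U] h(1)] this h(2), of 1 1]
    show ?thesis by simp
  qed
  have "is_mild_trace a S T U0 h"
    unfolding is_mild_trace_def using h(1) U L conv by blast
  then show ?thesis using that U L2_tendsto_norm[OF L[OF U] h] by blast
qed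

lemma energy_at_0:
  assumes "U0 \<in> H0 a" shows "energy a S U0 0 = 1 / 2 * ip U0 U0"
proof -
  note H = S_H0[OF order_refl assms]
  have f: "fst (S 0 U0) \<in> H20" "snd (S 0 U0) \<in> L2_inv a" using H by (auto simp: H0_iff)
  have i: "integrable M01 (\<lambda>x. (snd (S 0 U0) x)\<^sup>2 / a x)" "integrable M01 (\<lambda>x. (weak_deriv 2 (fst (S 0 U0)) x)\<^sup>2)"
    using L2_inv_mult_integrable[OF f(2,2)] H20_D(2)[OF f(1)] by (auto simp: power2_eq_square L2_def)
  have "energy a S U0 0 = 1 / 2 * ip (S 0 U0) (S 0 U0)"
    using i by (simp add: energy_def ip_self)
  also have "ip (S 0 U0) (S 0 U0) = ip U0 U0"
    using bounded_form_cong[OF bounded_form_ip H assms _ S_0[OF assms]] H assms by simp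
  finally show ?thesis .
qed

text \<open>Both sides of the classical lower bound converge along an approximating sequence. The
  factor 2 appears because the energy is half of \<open>ip\<close>.\<close>

lemma observability_inequality:
  assumes T: "T > 0" and C: "C \<le> 2 * ((2 - K) * T - 2 * max 1 (4 / a 1))"
  shows "observability_inequality a S T C"
  unfolding observability_inequality_def
proof
  fix U0 assume U0: "U0 \<in> H0 a"
  obtain h U where h: "is_mild_trace a S T U0 h" "approximating_data a U0 U"
    "(\<lambda>n. \<integral>t. (classical_trace S (U n) t)\<^sup>2 \<partial>lebesgue_on {0<..<T}) \<longlonglongrightarrow> (\<integral>t. (h t)\<^sup>2 \<partial>lebesgue_on {0<..<T})"
    using mild_trace_exists[OF U0 T] by blast
  have D: "U n \<in> wave_dom a" for n using h(2) by (simp add: approximating_data_def)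
  have "(\<lambda>n. H0_norm a (U n)) \<longlonglongrightarrow> H0_norm a U0"
  proof (rule LIM_zero_cancel, rule Lim_null_comparison)
    show "\<forall>\<^sub>F n in sequentially. norm (H0_norm a (U n) - H0_norm a U0) \<le> H0_dist a (U n) U0"
    proof (intro always_eventually allI)
      fix n
      show "norm (H0_norm a (U n) - H0_norm a U0) \<le> H0_dist a (U n) U0"
        using H0_norm_le_dist[OF wave_dom_H0[OF D] U0, of n] H0_norm_le_dist[OF U0 wave_dom_H0[OF D], of n]
          H0_dist_commute[OF U0 wave_dom_H0[OF D], of n] by simp
    qed
    show "(\<lambda>n. H0_dist a (U n) U0) \<longlonglongrightarrow> 0" using h(2) by (simp add: approximating_data_def)
  qed
  then have "(\<lambda>n. C / 2 * (H0_norm a (U n))\<^sup>2) \<longlonglongrightarrow> C / 2 * (H0_norm a U0)\<^sup>2"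
    by (intro tendsto_intros)
  then have lim: "(\<lambda>n. C / 2 * ip (U n) (U n)) \<longlonglongrightarrow> C / 2 * ip U0 U0" by (simp add: H0_norm_square)
  have "C / 2 * ip (U n) (U n) \<le> (\<integral>t. (classical_trace S (U n) t)\<^sup>2 \<partial>lebesgue_on {0<..<T})" for n
  proof -
    have "C / 2 * ip (U n) (U n) \<le> ((2 - K) * T - 2 * max 1 (4 / a 1)) * ip (U n) (U n)"
      using C by (intro mult_right_mono ip_nonneg) simp
    also have "\<dots> \<le> (\<integral>t. (classical_trace S (U n) t)\<^sup>2 \<partial>lebesgue_on {0<..<T})"
      by (rule observability_classical(1)[OF D T])
    finally show ?thesis .
  qed
  then have "C / 2 * ip U0 U0 \<le> (\<integral>t. (h t)\<^sup>2 \<partial>lebesgue_on {0<..<T})"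
    by (intro LIMSEQ_le[OF lim h(3)]) auto
  then show "\<exists>h. is_mild_trace a S T U0 h \<and> C * energy a S U0 0 \<le> (\<integral>t. (h t)\<^sup>2 \<partial>lebesgue_on {0<..<T})"
    using h(1) by (intro exI[of _ h] conjI) (simp_all add: energy_at_0[OF U0])
qed

end

theorem corollary4p1:
  fixes a :: "real \<Rightarrow> real" and S :: "real \<Rightarrow> state \<Rightarrow> state" and K T :: real
  assumes degenerate: "weakly_degenerate a \<or> strongly_degenerate a"
    and K: "K = degeneracy_const a"
    and semigroup: "contraction_semigroup a S" "generated_by_wave_op a S"
    and T: "T > 4 / (2 - K) * Max {1, 4 / a 1, 4 * K / a 1}"
  shows "observable a S T \<and>
         ereal (T * (2 - K) - 4 * Max {1, 4 / a 1, 4 * K / a 1}) \<le> observability_const a S T"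
proof -
  interpret dc: degenerate_coefficient a K
    unfolding K by (rule degenerate_coefficientI[OF degenerate])
  interpret wave_semigroup a K S
    by unfold_locales (rule semigroup)+
  define M where "M = Max {1, 4 / a 1, 4 * K / a 1}"
  define C where "C = T * (2 - K) - 4 * M"
  have M: "M \<ge> 1" "M \<ge> max 1 (4 / a 1)" by (simp_all add: M_def)
  have K2: "2 - K > 0" using dc.K by simp
  have T': "T > 4 / (2 - K) * M" using T by (simp add: M_def)
  have "T > 0" by (rule less_trans[OF _ T']) (use K2 M in auto)
  have "4 * M < T * (2 - K)" using T' K2 by (simp add: field_simps)
  then have C: "C > 0" by (simp add: C_def)
  \<comment> \<open>The admissible constant \<open>2 * ((2 - K) * T - 2 * max 1 (4 / a 1))\<close>
    exceeds \<open>C\<close> by at least \<open>(2 - K) * T\<close>, since \<open>M\<close>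
    dominates the maximum; so the sign of this term decides.\<close>
  have "0 \<le> (2 - K) * T" using K2 \<open>T > 0\<close> by simp
  then have "C \<le> 2 * ((2 - K) * T - 2 * max 1 (4 / a 1))"
    using M unfolding C_def by (simp add: algebra_simps)
  then have obs: "observability_inequality a S T C"
    by (rule observability_inequality[OF \<open>T > 0\<close>])
  have "ereal C \<le> observability_const a S T"
    unfolding observability_const_def by (intro SUP_upper) (use C obs in simp)
  then show ?thesis using C obs unfolding observable_def C_def M_def by blast
qed

end
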